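(* Let $k$ be an algebraically closed field and let $E_1^m,E_2^m,E_3^m,E_4^m$ ($m\ge0$), $M$, $M'$ be the exceptional representations of the quiver $Q_1$ described in the context. Write $[X,Y]=(\hom(X,Y),\hom^1(X,Y))$. The dimensions of $\mathrm{Hom}(X,Y)$ and $\mathrm{Hom}^1(X,Y)=\mathrm{Ext}^1(X,Y)$ for pairs of (distinct) exceptional objects of $Rep_k(Q_1)$ are as follows ($m,n\geq 0$ throughout). For $m<n$: $[E_1^m,E_1^n]=(0,n-m-1)$ and $[E_1^n,E_1^m]=(1+n-m,0)$; $[E_4^m,E_4^n]=(0,n-m-1)$ and $[E_4^n,E_4^m]=(1+n-m,0)$. For $n<m$: $[E_2^m,E_2^n]=(0,m-n-1)$ and $[E_2^n,E_2^m]=(1+m-n,0)$; $[E_3^m,E_3^n]=(0,m-n-1)$ and $[E_3^n,E_3^m]=(1+m-n,0)$. For all $m,n$: $[E_1^m,E_2^n]=(0,n+m+2)$, $[E_2^n,E_1^m]=(n+m,0)$; $[E_1^m,E_3^n]=(0,n+m+1)$, $[E_3^n,E_1^m]=(n+m,0)$; $[E_2^m,E_4^n]=(1+n+m,0)$, $[E_4^n,E_2^m]=(0,n+m+2)$; $[E_3^m,E_4^n]=(n+m,0)$, $[E_4^n,E_3^m]=(0,n+m+2)$. If $m\le n$: $[E_1^m,E_4^n]=(0,n-m)$, $[E_4^n,E_1^m]=(1+n-m,0)$. If $n<m$: $[E_1^m,E_4^n]=(m-n,0)$, $[E_4^n,E_1^m]=(0,m-n-1)$. If $n\le m$: $[E_2^m,E_3^n]=(0,m-n)$,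 $[E_3^n,E_2^m]=(1+m-n,0)$. If $m<n$: $[E_2^m,E_3^n]=(n-m,0)$, $[E_3^n,E_2^m]=(0,n-m-1)$. For all $m$: $[M,E_1^m]=(0,0)$, $[E_1^m,M]=(0,1)$; $[M,E_2^m]=(0,0)$, $[E_2^m,M]=(1,0)$; $[M,E_3^m]=(0,1)$, $[E_3^m,M]=(0,0)$; $[M,E_4^m]=(1,0)$, $[E_4^m,M]=(0,0)$; $[M',E_1^m]=(1,0)$, $[E_1^m,M']=(0,0)$; $[M',E_2^m]=(0,1)$, $[E_2^m,M']=(0,0)$; $[M',E_3^m]=(0,0)$, $[E_3^m,M']=(1,0)$; $[M',E_4^m]=(0,0)$, $[E_4^m,M']=(0,1)$. Finally $[M,M']=(0,1)$ and $[M',M]=(0,1)$.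
   Context: $Q_1$ is the quiver with vertices $b,mid,e$ and arrows $b\to e$, $b\to mid$, $mid\to e$; $Rep_k(Q_1)$ is its category of finite-dimensional $k$-representations; $\hom=\dim_k\mathrm{Hom}$, $\hom^1=\dim_k\mathrm{Ext}^1$. A representation is given by spaces $(V_b,V_{mid},V_e)$ and maps $(V_b\to V_e, V_b\to V_{mid}, V_{mid}\to V_e)$. The exceptional objects of $Rep_k(Q_1)$ up to isomorphism are ($m\ge0$): $E_1^m$: $(k^{m+1},k^m,k^m)$, $(\pi_+^m,\pi_-^m,\mathrm{Id})$; $E_2^m$: $(k^{m},k^{m+1},k^{m+1})$, $(j_+^m,j_-^m,\mathrm{Id})$; $E_3^m$: $(k^{m},k^{m},k^{m+1})$, $(j_+^m,\mathrm{Id},j_-^m)$; $E_4^m$: $(k^{m+1},k^{m+1},k^{m})$, $(\pi_+^m,\mathrm{Id},\pi_-^m)$; $M$: $(0,k,0)$, zero maps; $M'$: $(k,0,k)$, $(\mathrm{Id},0,0)$. Here $\pi_+^m(a_1,\dots,a_{m+1})=(a_1,\dots,a_m)$, $\pi_-^m(a_1,\dots,a_{m+1})=(a_2,\dots,a_{m+1})$, $j_+^m(a_1,\dots,a_m)=(a_1,\dots,a_m,0)$, $j_-^m(a_1,\dots,a_m)=(0,a_1,\dots,a_m)$ (zero maps for $m=0$). *)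

theory Defs
  imports
    "HOL-Library.Function_Algebras"
    "HOL-Computational_Algebra.Polynomial"
begin

text \<open>
  All finite-dimensional vector spaces are taken to be subspaces of the countably infinite
  dimensional space of sequences \<^typ>\<open>nat \<Rightarrow> 'k\<close>. Every finite-dimensional space is isomorphic to
  one of these, so the resulting category of representations is equivalent to the category of all
  finite-dimensional representations. Coordinates are numbered from 0.
\<close>

definition vscale :: "'k::field \<Rightarrow> (nat \<Rightarrow> 'k) \<Rightarrow> (nat \<Rightarrow> 'k)" where
  "vscale c x = (\<lambda>i. c * x i)"

interpretation vec: vector_space vscale
  by unfold_locales (auto simp: vscale_def fun_eq_iff algebra_simps)

definition fin_dim_space :: "(nat \<Rightarrow> 'k::field) set \<Rightarrow> bool" where
  "fin_dim_space V \<longleftrightarrow> (\<exists>B. finite B \<and> V = vec.span B)"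

definition linear_map ::
    "(nat \<Rightarrow> 'k::field) set \<Rightarrow> (nat \<Rightarrow> 'k) set \<Rightarrow> ((nat \<Rightarrow> 'k) \<Rightarrow> (nat \<Rightarrow> 'k)) \<Rightarrow> bool" where
  "linear_map V W f \<longleftrightarrow>
     (\<forall>x\<in>V. f x \<in> W) \<and>
     (\<forall>x\<in>V. \<forall>y\<in>V. f (x + y) = f x + f y) \<and>
     (\<forall>c. \<forall>x\<in>V. f (vscale c x) = vscale c (f x))"


section \<open>Representations of the quiver $Q_1$\<close>

datatype vertex = Vb | Vmid | Ve

datatype arrow = Arr_be | Arr_bmid | Arr_mide

fun src :: "arrow \<Rightarrow> vertex" where
  "src Arr_be = Vb"
| "src Arr_bmid = Vb"
| "src Arr_mide = Vmid"

fun tgt :: "arrow \<Rightarrow> vertex" where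
  "tgt Arr_be = Ve"
| "tgt Arr_bmid = Vmid"
| "tgt Arr_mide = Ve"

record 'k quiver_rep =
  space :: "vertex \<Rightarrow> (nat \<Rightarrow> 'k) set"
  action :: "arrow \<Rightarrow> (nat \<Rightarrow> 'k) \<Rightarrow> (nat \<Rightarrow> 'k)"

definition is_rep :: "'k::field quiver_rep \<Rightarrow> bool" where
  "is_rep X \<longleftrightarrow>
     (\<forall>v. fin_dim_space (space X v)) \<and>
     (\<forall>a. linear_map (space X (src a)) (space X (tgt a)) (action X a))"

type_synonym 'k rep_hom = "vertex \<Rightarrow> (nat \<Rightarrow> 'k) \<Rightarrow> (nat \<Rightarrow> 'k)"

text \<open>
  The components of a morphism are linear maps between subspaces; as HOL functions they are made
  unique by letting them vanish outside their domain. With this convention a Hom space is a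
  subspace of \<^typ>\<open>'k rep_hom\<close> with its pointwise operations.
\<close>

definition Hom :: "'k::field quiver_rep \<Rightarrow> 'k quiver_rep \<Rightarrow> 'k rep_hom set" where
  "Hom X Y = {f.
     (\<forall>v. linear_map (space X v) (space Y v) (f v)) \<and>
     (\<forall>v x. x \<notin> space X v \<longrightarrow> f v x = 0) \<and>
     (\<forall>a. \<forall>x \<in> space X (src a). f (tgt a) (action X a x) = action Y a (f (src a) x))}"

definition hom_comp :: "'k rep_hom \<Rightarrow> 'k rep_hom \<Rightarrow> 'k rep_hom" (infixl \<open>\<circ>\<^sub>R\<close> 55) where
  "g \<circ>\<^sub>R f = (\<lambda>v x. g v (f v x))"

definition hscale :: "'k::field \<Rightarrow> 'k rep_hom \<Rightarrow> 'k rep_hom" where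
  "hscale c f = (\<lambda>v x. vscale c (f v x))"

interpretation hom: vector_space hscale
  by unfold_locales (auto simp: hscale_def vscale_def fun_eq_iff algebra_simps)

definition hom0 :: "'k::field quiver_rep \<Rightarrow> 'k quiver_rep \<Rightarrow> nat" where
  "hom0 X Y = hom.dim (Hom X Y)"


section \<open>$\mathrm{Ext}^1$\<close>

definition surjective :: "'k::field quiver_rep \<Rightarrow> 'k quiver_rep \<Rightarrow> 'k rep_hom \<Rightarrow> bool" where
  "surjective X Y f \<longleftrightarrow> (\<forall>v. f v ` space X v = space Y v)"

definition exact_at ::
    "'k::field quiver_rep \<Rightarrow> 'k quiver_rep \<Rightarrow> 'k rep_hom \<Rightarrow> 'k rep_hom \<Rightarrow> bool" where
  "exact_at X Y f g \<longleftrightarrow> (\<forall>v. f v ` space X v = {y \<in> space Y v. g v y = 0})"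

definition projective :: "'k::field quiver_rep \<Rightarrow> bool" where
  "projective P \<longleftrightarrow> is_rep P \<and>
     (\<forall>Y Z g h. is_rep Y \<and> is_rep Z \<and> g \<in> Hom Y Z \<and> surjective Y Z g \<and> h \<in> Hom P Z
        \<longrightarrow> (\<exists>h' \<in> Hom P Y. g \<circ>\<^sub>R h' = h))"

text \<open>$\cdots \to P_2 \xrightarrow{d_1} P_1 \xrightarrow{d_0} P_0 \xrightarrow{\varepsilon} X \to 0$\<close>

definition projective_resolution ::
    "'k::field quiver_rep \<Rightarrow> (nat \<Rightarrow> 'k quiver_rep) \<Rightarrow> (nat \<Rightarrow> 'k rep_hom) \<Rightarrow> 'k rep_hom \<Rightarrow> bool"
  where
  "projective_resolution X P d \<epsilon> \<longleftrightarrow>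
     (\<forall>n. projective (P n)) \<and>
     (\<forall>n. d n \<in> Hom (P (Suc n)) (P n)) \<and>
     \<epsilon> \<in> Hom (P 0) X \<and>
     surjective (P 0) X \<epsilon> \<and>
     exact_at (P 1) (P 0) (d 0) \<epsilon> \<and>
     (\<forall>n. exact_at (P (Suc (Suc n))) (P (Suc n)) (d (Suc n)) (d n))"

text \<open>
  For subspaces $B \subseteq Z$: the classes of the elements of \<open>S \<subseteq> Z\<close> form a basis of $Z/B$,
  and the dimension of $Z/B$ as the size of such an \<open>S\<close>.
\<close>

definition basis_mod :: "'k::field rep_hom set \<Rightarrow> 'k rep_hom set \<Rightarrow> 'k rep_hom set \<Rightarrow> bool" where
  "basis_mod Z B S \<longleftrightarrow> finite S \<and> S \<subseteq> Z \<and>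
     (\<forall>c. (\<Sum>s\<in>S. hscale (c s) s) \<in> B \<longrightarrow> (\<forall>s\<in>S. c s = 0)) \<and>
     (\<forall>z\<in>Z. \<exists>c. z - (\<Sum>s\<in>S. hscale (c s) s) \<in> B)"

definition quot_dim :: "'k::field rep_hom set \<Rightarrow> 'k rep_hom set \<Rightarrow> nat" where
  "quot_dim Z B = card (SOME S. basis_mod Z B S)"

definition cocycles1 ::
    "(nat \<Rightarrow> 'k::field quiver_rep) \<Rightarrow> (nat \<Rightarrow> 'k rep_hom) \<Rightarrow> 'k quiver_rep \<Rightarrow> 'k rep_hom set" where
  "cocycles1 P d Y = {f \<in> Hom (P 1) Y. f \<circ>\<^sub>R d 1 = 0}"

definition coboundaries1 ::
    "(nat \<Rightarrow> 'k::field quiver_rep) \<Rightarrow> (nat \<Rightarrow> 'k rep_hom) \<Rightarrow> 'k quiver_rep \<Rightarrow> 'k rep_hom set" where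
  "coboundaries1 P d Y = {g \<circ>\<^sub>R d 0 | g. g \<in> Hom (P 0) Y}"

text \<open>
  $\mathrm{Ext}^1(X,Y)$ is the first cohomology of $\mathrm{Hom}(P_\bullet,Y)$ for a projective
  resolution $P_\bullet$ of $X$; as usual, some resolution is chosen.
\<close>

definition hom1 :: "'k::field quiver_rep \<Rightarrow> 'k quiver_rep \<Rightarrow> nat" where
  "hom1 X Y =
     (let (P, d, _) = (SOME (P, d, \<epsilon>). projective_resolution X P d \<epsilon>)
      in quot_dim (cocycles1 P d Y) (coboundaries1 P d Y))"

definition bracket :: "'k::field quiver_rep \<Rightarrow> 'k quiver_rep \<Rightarrow> nat \<times> nat" (\<open>\<lbrakk>_, _\<rbrakk>\<^sub>R\<close>) where
  "\<lbrakk>X, Y\<rbrakk>\<^sub>R = (hom0 X Y, hom1 X Y)"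


section \<open>The exceptional representations\<close>

definition kpow :: "nat \<Rightarrow> (nat \<Rightarrow> 'k::field) set" where
  "kpow n = {x. \<forall>i\<ge>n. x i = 0}"

definition pi_plus :: "nat \<Rightarrow> (nat \<Rightarrow> 'k::field) \<Rightarrow> (nat \<Rightarrow> 'k)" where
  "pi_plus m x = (\<lambda>i. if i < m then x i else 0)"

definition pi_minus :: "nat \<Rightarrow> (nat \<Rightarrow> 'k::field) \<Rightarrow> (nat \<Rightarrow> 'k)" where
  "pi_minus m x = (\<lambda>i. if i < m then x (i + 1) else 0)"

definition j_plus :: "nat \<Rightarrow> (nat \<Rightarrow> 'k::field) \<Rightarrow> (nat \<Rightarrow> 'k)" where
  "j_plus m x = (\<lambda>i. if i < m then x i else 0)"

definition j_minus :: "nat \<Rightarrow> (nat \<Rightarrow> 'k::field) \<Rightarrow> (nat \<Rightarrow> 'k)" where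
  "j_minus m x = (\<lambda>i. if 1 \<le> i \<and> i \<le> m then x (i - 1) else 0)"

text \<open>\<open>mk_rep (p, q, r) (f, g, h)\<close> lists spaces and maps in the order
  $(V_b, V_{mid}, V_e)$ and $(V_b \to V_e,\ V_b \to V_{mid},\ V_{mid} \to V_e)$.\<close>

definition mk_rep ::
    "nat \<times> nat \<times> nat \<Rightarrow>
     ((nat \<Rightarrow> 'k) \<Rightarrow> (nat \<Rightarrow> 'k)) \<times> ((nat \<Rightarrow> 'k) \<Rightarrow> (nat \<Rightarrow> 'k)) \<times> ((nat \<Rightarrow> 'k) \<Rightarrow> (nat \<Rightarrow> 'k)) \<Rightarrow>
     'k::field quiver_rep" where
  "mk_rep = (\<lambda>(p, q, r) (f, g, h).
     \<lparr> space = (\<lambda>v. case v of Vb \<Rightarrow> kpow p | Vmid \<Rightarrow> kpow q | Ve \<Rightarrow> kpow r),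
       action = (\<lambda>a. case a of Arr_be \<Rightarrow> f | Arr_bmid \<Rightarrow> g | Arr_mide \<Rightarrow> h) \<rparr>)"

text \<open>The first argument only fixes the ground field.\<close>

definition E1 :: "'k::field itself \<Rightarrow> nat \<Rightarrow> 'k quiver_rep" where
  "E1 _ m = mk_rep (m + 1, m, m) (pi_plus m, pi_minus m, id)"

definition E2 :: "'k::field itself \<Rightarrow> nat \<Rightarrow> 'k quiver_rep" where
  "E2 _ m = mk_rep (m, m + 1, m + 1) (j_plus m, j_minus m, id)"

definition E3 :: "'k::field itself \<Rightarrow> nat \<Rightarrow> 'k quiver_rep" where
  "E3 _ m = mk_rep (m, m, m + 1) (j_plus m, id, j_minus m)"

definition E4 :: "'k::field itself \<Rightarrow> nat \<Rightarrow> 'k quiver_rep" where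
  "E4 _ m = mk_rep (m + 1, m + 1, m) (pi_plus m, id, pi_minus m)"

definition M :: "'k::field itself \<Rightarrow> 'k quiver_rep" where
  "M _ = mk_rep (0, 1, 0) (0, 0, 0)"

definition M' :: "'k::field itself \<Rightarrow> 'k quiver_rep" where
  "M' _ = mk_rep (1, 0, 1) (id, 0, 0)"

lemma fin_dim_space_kpow: "fin_dim_space (kpow n :: (nat \<Rightarrow> 'k::field) set)"
proof -
  define e :: "nat \<Rightarrow> nat \<Rightarrow> 'k" where "e = (\<lambda>j i. if i = j then 1 else 0)"
  have sub: "vec.subspace (kpow n :: (nat \<Rightarrow> 'k) set)"
    by (auto simp: vec.subspace_def kpow_def vscale_def)
  have "vec.span (e ` {..<n}) \<subseteq> kpow n"
    by (rule vec.span_minimal[OF _ sub]) (auto simp: kpow_def e_def)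
  moreover have "x \<in> vec.span (e ` {..<n})" if "x \<in> kpow n" for x
  proof -
    have "(\<Sum>j<m. vscale (x j) (e j)) = (\<lambda>i. if i < m then x i else 0)" for m
      by (induction m) (auto simp: fun_eq_iff vscale_def e_def less_Suc_eq)
    moreover have "(\<lambda>i. if i < n then x i else 0) = x"
      using that by (auto simp: kpow_def fun_eq_iff)
    ultimately have "x = (\<Sum>j<n. vscale (x j) (e j))"
      by simp
    also have "\<dots> \<in> vec.span (e ` {..<n})"
      by (intro vec.span_sum vec.span_scale vec.span_base) auto
    finally show ?thesis .
  qed
  ultimately show ?thesis
    unfolding fin_dim_space_def by (intro exI[of _ "e ` {..<n}"]) auto
qed

lemma is_rep_exceptional:
  "is_rep (E1 k m)" "is_rep (E2 k m)" "is_rep (E3 k m)" "is_rep (E4 k m)"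
  "is_rep (M k)" "is_rep (M' k)"
  unfolding is_rep_def E1_def E2_def E3_def E4_def M_def M'_def mk_rep_def
  by (auto simp: fin_dim_space_kpow split: vertex.split)
     (case_tac a; auto simp: linear_map_def kpow_def vscale_def fun_eq_iff pi_plus_def
        pi_minus_def j_plus_def j_minus_def)+

end

theory Submission
  imports Defs
begin

text \<open>
  For representations \<open>X\<close>, \<open>Y\<close> the map sending a family \<open>f\<close> of linear maps \<open>X\<^sub>v \<rightarrow> Y\<^sub>v\<close> to the family of
  failures of commutativity \<open>f X\<^sub>a - Y\<^sub>a f : X\<^sub>s \<rightarrow> Y\<^sub>t\<close> over the arrows \<open>a : s \<rightarrow> t\<close> has kernel \<open>Hom(X, Y)\<close>
  and cokernel \<open>Ext\<^sup>1(X, Y)\<close>. Hence \<open>hom - hom\<^sup>1\<close> is the Euler form \<open>\<chi>\<close> of the dimension vectors. Among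
  the pairs in question at most one of \<open>hom\<close>, \<open>hom\<^sup>1\<close> is nonzero, so it suffices to show
  \<open>hom \<le> max \<chi> 0\<close>, that is, to find \<open>max \<chi> 0\<close> matrix entries whose vanishing forces a morphism to
  vanish. The matrices of morphisms are banded Toeplitz or Hankel matrices, which makes this easy.
\<close>

section \<open>Linear algebra\<close>

text \<open>\<open>hom1\<close> rests on a resolution and a basis that are both picked by
  \<open>SOME\<close>, so the cokernel description must be proved for every projective resolution,
  of any length. The link is a diagram chase: a cocycle on \<open>P 1\<close> factors vertexwise
  through \<open>d 0\<close>, and the failure of the factor to be a morphism descends along
  \<epsilon> to an arrow family on X, determined modulo defects. Reversing the chase needs every
  arrow family on a projective to be a defect. On a free representation such equations are solved
  path by path, and a projective is a retract of a free one. The bound on hom counts diagonals: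
  vectors killed or coordinates missed by the structure maps force zeros along the border, and each
  diagonal that avoids them leaves one parameter. Morphisms realizing these parameters are never
  constructed, since nonnegativity of Ext^1 supplies the lower bound.\<close>

lemma (in vector_space) inj_on_if_scalars_zero:
  assumes "finite I"
    and indep: "\<And>c. (\<Sum>i\<in>I. scale (c i) (b i)) = 0 \<Longrightarrow> \<forall>i\<in>I. c i = 0"
  shows "inj_on b I"
proof (rule inj_onI, rule ccontr)
  fix i j assume ij: "i \<in> I" "j \<in> I" "b i = b j" "i \<noteq> j"
  define c where "c = (\<lambda>k. (if k = i then 1 else 0) - (if k = j then 1 else 0) :: 'a)"
  have "(\<Sum>k\<in>I. scale (c k) (b k)) =
      (\<Sum>k\<in>I. if k = i then b k else 0) - (\<Sum>k\<in>I. if k = j then b k else 0)"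
    unfolding c_def scale_left_diff_distrib sum_subtractf
    by (intro arg_cong2[where f = "(-)"] sum.cong) auto
  also have "\<dots> = 0" using ij assms(1) by simp
  finally have "c i = 0" using indep ij by blast
  then show False using ij by (simp add: c_def)
qed

lemma (in vector_space) dim_eq_card_family:
  assumes "finite I" "b ` I \<subseteq> V"
    and indep: "\<And>c. (\<Sum>i\<in>I. scale (c i) (b i)) = 0 \<Longrightarrow> \<forall>i\<in>I. c i = 0"
    and gen: "\<And>v. v \<in> V \<Longrightarrow> \<exists>c. v = (\<Sum>i\<in>I. scale (c i) (b i))"
  shows "dim V = card I"
proof (rule dim_unique[of "b ` I"])
  have inj: "inj_on b I" using assms(1) indep by (rule inj_on_if_scalars_zero)
  show "b ` I \<subseteq> V" by fact
  show "card (b ` I) = card I" using inj by (rule card_image)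
  show "V \<subseteq> span (b ` I)"
  proof
    fix v assume "v \<in> V"
    then obtain c where "v = (\<Sum>i\<in>I. scale (c i) (b i))" using gen by blast
    then show "v \<in> span (b ` I)"
      by (simp add: span_sum span_scale span_base)
  qed
  show "independent (b ` I)"
  proof (rule independent_if_scalars_zero)
    show "finite (b ` I)" using assms(1) by simp
    fix f x assume "(\<Sum>x\<in>b ` I. scale (f x) x) = 0" "x \<in> b ` I"
    moreover have "(\<Sum>x\<in>b ` I. scale (f x) x) = (\<Sum>i\<in>I. scale (f (b i)) (b i))"
      using inj by (simp add: sum.reindex)
    ultimately show "f x = 0" using indep[of "f \<circ> b"] by auto
  qed
qed

section \<open>Bases of quotients of subspaces\<close>

text \<open>Agrees with \<open>basis_mod\<close> when t is \<open>id\<close>. Indexing by a family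
  lets one index set S serve quotients of two different spaces, so that a basis can be carried
  between Ext^1 and the cokernel of \<open>defect\<close>.\<close>

definition (in vector_space) basis_family_mod :: "'b set \<Rightarrow> 'b set \<Rightarrow> 'i set \<Rightarrow> ('i \<Rightarrow> 'b) \<Rightarrow> bool" where
  "basis_family_mod Q U S t \<longleftrightarrow> finite S \<and> t ` S \<subseteq> Q \<and>
     (\<forall>c. (\<Sum>s\<in>S. scale (c s) (t s)) \<in> U \<longrightarrow> (\<forall>s\<in>S. c s = 0)) \<and>
     (\<forall>q\<in>Q. \<exists>c. q - (\<Sum>s\<in>S. scale (c s) (t s)) \<in> U)"

text \<open>A coincidence of two values would give a nontrivial combination equal to 0, hence in U.
  So t is injective on S and coefficients can be moved across it.\<close>

lemma (in vector_space) basis_family_mod_image: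
  assumes "basis_family_mod Q U S t" "0 \<in> U"
  shows "basis_family_mod Q U (t ` S) id"
proof -
  have S: "finite S" "t ` S \<subseteq> Q" "\<And>q. q \<in> Q \<Longrightarrow> \<exists>c. q - (\<Sum>s\<in>S. scale (c s) (t s)) \<in> U"
    and indep: "\<And>c. (\<Sum>s\<in>S. scale (c s) (t s)) \<in> U \<Longrightarrow> \<forall>s\<in>S. c s = 0"
    using assms(1) by (auto simp: basis_family_mod_def)
  have inj: "inj_on t S"
    using S(1) indep assms(2) by (intro inj_on_if_scalars_zero) auto
  have sum: "(\<Sum>x\<in>t ` S. scale (c x) (id x)) = (\<Sum>s\<in>S. scale (c (t s)) (t s))" for c
    using inj by (simp add: sum.reindex)
  have "\<exists>c. q - (\<Sum>x\<in>t ` S. scale (c x) (id x)) \<in> U" if q: "q \<in> Q" for q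
  proof -
    obtain c where c: "q - (\<Sum>s\<in>S. scale (c s) (t s)) \<in> U" using S(3)[OF q] by blast
    have "(\<Sum>s\<in>S. scale (c (inv_into S t (t s))) (t s)) = (\<Sum>s\<in>S. scale (c s) (t s))"
      using inj by (intro sum.cong) auto
    then show ?thesis using c unfolding sum by (intro exI[of _ "c \<circ> inv_into S t"]) simp
  qed
  moreover have "\<forall>x\<in>t ` S. c x = 0" if "(\<Sum>x\<in>t ` S. scale (c x) (id x)) \<in> U" for c
    using that indep[of "c \<circ> t"] unfolding sum by simp
  ultimately show ?thesis using S(1,2) unfolding basis_family_mod_def by simp
qed

lemma (in vector_space) finite_basis_exists:
  assumes "finite F" "V \<subseteq> span F"
  obtains B where "finite B" "B \<subseteq> V" "independent B" "V \<subseteq> span B" "card B = dim V"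
proof -
  obtain B where B: "B \<subseteq> V" "independent B" "V \<subseteq> span B" "card B = dim V"
    using basis_exists by metis
  then have "finite B" using independent_span_bound[OF assms(1)] assms(2) by blast
  then show ?thesis using B that by blast
qed

lemma (in vector_space) span_finite_sum:
  assumes "finite B" "v \<in> span B"
  shows "\<exists>c. v = (\<Sum>x\<in>B. scale (c x) x)"
  using assms span_finite[OF assms(1)] by auto

lemma (in vector_space) independent_sum_zero:
  assumes "finite B" "independent B" "(\<Sum>x\<in>B. scale (c x) x) = 0" "x \<in> B"
  shows "c x = 0"
  using assms dependent_finite by blast

text \<open>A basis of U together with representatives of a basis of Q/U is a basis of Q. Indexing
  it by the disjoint sum \<open>J <+> S\<close> avoids treating coincidences of values
  separately.\<close>

lemma (in vector_space) dim_mod: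
  assumes Q: "subspace Q" "U \<subseteq> Q" "subspace U" "finite F" "Q \<subseteq> span F"
    and S: "basis_family_mod Q U S t"
  shows "dim Q = dim U + card S"
proof -
  obtain J where J: "finite J" "J \<subseteq> U" "independent J" "U \<subseteq> span J" "card J = dim U"
    using finite_basis_exists[OF Q(4), of U] Q by blast
  have fin: "finite S" using S by (simp add: basis_family_mod_def)
  have sum: "(\<Sum>i\<in>J <+> S. scale (c i) (case_sum id t i)) =
      (\<Sum>x\<in>J. scale (c (Inl x)) x) + (\<Sum>s\<in>S. scale (c (Inr s)) (t s))" for c
    using J(1) fin by (simp add: sum.Plus)
  have "dim Q = card (J <+> S)"
  proof (rule dim_eq_card_family)
    show "finite (J <+> S)" using J(1) fin by simp
    show "case_sum id t ` (J <+> S) \<subseteq> Q"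
      using J Q S by (auto simp: basis_family_mod_def)
  next
    fix c assume 0: "(\<Sum>i\<in>J <+> S. scale (c i) (case_sum id t i)) = 0"
    let ?u = "\<Sum>x\<in>J. scale (c (Inl x)) x"
    have "?u \<in> U" using J Q(3) by (auto intro!: subspace_sum subspace_scale)
    moreover have "(\<Sum>s\<in>S. scale (c (Inr s)) (t s)) = - ?u"
      using 0 unfolding sum by (simp add: eq_neg_iff_add_eq_0 add.commute)
    ultimately have "(\<Sum>s\<in>S. scale (c (Inr s)) (t s)) \<in> U"
      using Q(3) by (simp add: subspace_neg)
    then have r: "\<forall>s\<in>S. c (Inr s) = 0"
      using S unfolding basis_family_mod_def by fast
    then have "?u = 0" using 0 unfolding sum by simp
    then have "\<forall>x\<in>J. c (Inl x) = 0" using independent_sum_zero[OF J(1,3), of "\<lambda>x. c (Inl x)"] by blast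
    with r show "\<forall>i\<in>J <+> S. c i = 0" by auto
  next
    fix q assume "q \<in> Q"
    then obtain c where "q - (\<Sum>s\<in>S. scale (c s) (t s)) \<in> U"
      using S unfolding basis_family_mod_def by blast
    then obtain d where d: "q - (\<Sum>s\<in>S. scale (c s) (t s)) = (\<Sum>x\<in>J. scale (d x) x)"
      using span_finite_sum[OF J(1)] J(4) by blast
    then have "q = (\<Sum>i\<in>J <+> S. scale (case_sum d c i) (case_sum id t i))"
      unfolding sum by (simp add: algebra_simps)
    then show "\<exists>c. q = (\<Sum>i\<in>J <+> S. scale (c i) (case_sum id t i))" by blast
  qed
  then show ?thesis using J fin by (simp add: card_Plus)
qed

text \<open>Extend a basis of U to a basis of Q; the added vectors represent a basis of the
  quotient.\<close>

lemma (in vector_space) basis_family_mod_exists: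
  assumes Q: "subspace Q" "U \<subseteq> Q" "subspace U" "finite F" "Q \<subseteq> span F"
  obtains S where "basis_family_mod Q U S id"
proof -
  obtain J where J: "finite J" "J \<subseteq> U" "independent J" "U \<subseteq> span J" "card J = dim U"
    using finite_basis_exists[OF Q(4), of U] Q by blast
  obtain B where B: "J \<subseteq> B" "B \<subseteq> Q" "independent B" "Q \<subseteq> span B"
    using maximal_independent_subset_extend[of J Q] J Q by blast
  have finB: "finite B" using independent_span_bound[OF Q(4) B(3)] B(2) Q(5) by blast
  define S where "S = B - J"
  have split: "(\<Sum>x\<in>B. scale (c x) x) = (\<Sum>x\<in>J. scale (c x) x) + (\<Sum>x\<in>S. scale (c x) x)" for c
    unfolding S_def using sum.subset_diff[OF B(1) finB] by (simp add: add.commute)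
  have "basis_family_mod Q U S id"
    unfolding basis_family_mod_def
  proof (intro conjI allI impI ballI)
    show "finite S" "id ` S \<subseteq> Q" using finB B by (auto simp: S_def)
  next
    fix c s assume c: "(\<Sum>s\<in>S. scale (c s) (id s)) \<in> U" "s \<in> S"
    then obtain d where d: "(\<Sum>s\<in>S. scale (c s) s) = (\<Sum>x\<in>J. scale (d x) x)"
      using span_finite_sum[OF J(1)] J(4) by auto
    \<comment> \<open>A combination of S that lies in U is also a combination of J with coefficients
      d. Their difference is a relation on all of B, and e are its coefficients.\<close>
    define e where "e x = (if x \<in> J then - d x else c x)" for x
    have "(\<Sum>x\<in>B. scale (e x) x) = (\<Sum>x\<in>J. scale (- d x) x) + (\<Sum>s\<in>S. scale (c s) s)"
      unfolding split by (intro arg_cong2[where f = "(+)"] sum.cong) (auto simp: e_def S_def)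
    also have "\<dots> = 0" using d by (simp add: sum_negf)
    finally show "c s = 0"
      using independent_sum_zero[OF finB B(3), of e s] c(2) by (auto simp: e_def S_def)
  next
    fix q assume "q \<in> Q"
    then obtain c where "q = (\<Sum>x\<in>B. scale (c x) x)"
      using span_finite_sum[OF finB] B(4) by blast
    then have "q - (\<Sum>s\<in>S. scale (c s) (id s)) = (\<Sum>x\<in>J. scale (c x) x)"
      unfolding split by simp
    also have "\<dots> \<in> U" using J Q(3) by (auto intro!: subspace_sum subspace_scale)
    finally show "\<exists>c. q - (\<Sum>s\<in>S. scale (c s) (id s)) \<in> U" by blast
  qed
  then show ?thesis by (rule that)
qed

text \<open>Linearity on a subspace only: the maps of interest need not extend linearly by their
  defining formula.\<close>

locale linear_on_subspace = vs1: vector_space s1 + vs2: vector_space s2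
  for s1 :: "'a::field \<Rightarrow> 'b::ab_group_add \<Rightarrow> 'b" and s2 :: "'a \<Rightarrow> 'c::ab_group_add \<Rightarrow> 'c" +
  fixes V :: "'b set" and f :: "'b \<Rightarrow> 'c"
  assumes subspace_dom: "vs1.subspace V"
    and add: "x \<in> V \<Longrightarrow> y \<in> V \<Longrightarrow> f (x + y) = f x + f y"
    and scale: "x \<in> V \<Longrightarrow> f (s1 c x) = s2 c (f x)"
begin

lemma zero: "f 0 = 0"
  using scale[of 0 0] subspace_dom by (simp add: vs1.subspace_0)

lemma sum:
  assumes "\<And>i. i \<in> I \<Longrightarrow> g i \<in> V"
  shows "f (\<Sum>i\<in>I. s1 (c i) (g i)) = (\<Sum>i\<in>I. s2 (c i) (f (g i)))"
  using assms
proof (induction I rule: infinite_finite_induct)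
  case (insert i I)
  then show ?case
    by (simp add: add scale vs1.subspace_sum vs1.subspace_scale subspace_dom)
qed (simp_all add: zero)

lemma diff: "x \<in> V \<Longrightarrow> y \<in> V \<Longrightarrow> f (x - y) = f x - f y"
  using add[of x "s1 (-1) y"] scale[of y "-1"] by (simp add: vs1.subspace_neg subspace_dom)

lemma subspace_image: "vs2.subspace (f ` V)"
  unfolding vs2.subspace_def
proof (intro conjI ballI allI)
  show "0 \<in> f ` V" using zero vs1.subspace_0[OF subspace_dom] by force
next
  fix x y assume "x \<in> f ` V" "y \<in> f ` V"
  then show "x + y \<in> f ` V" by (auto simp: add[symmetric] vs1.subspace_add subspace_dom)
next
  fix c x assume "x \<in> f ` V"
  then show "s2 c x \<in> f ` V" by (auto simp: scale[symmetric] vs1.subspace_scale subspace_dom)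
qed

lemma subspace_kernel: "vs1.subspace {x \<in> V. f x = 0}"
  unfolding vs1.subspace_def
  by (auto simp: zero add scale vs1.subspace_0 vs1.subspace_add vs1.subspace_scale subspace_dom)

text \<open>F may contain vectors outside V, where nothing is known about f, so it is first replaced
  by a finite basis inside V.\<close>

lemma image_subset_span: "V \<subseteq> vs1.span F \<Longrightarrow> finite F \<Longrightarrow> \<exists>G. finite G \<and> f ` V \<subseteq> vs2.span G"
proof -
  assume F: "V \<subseteq> vs1.span F" "finite F"
  obtain B where B: "finite B" "B \<subseteq> V" "V \<subseteq> vs1.span B"
    using vs1.finite_basis_exists[OF F(2,1)] by metis
  have "f x \<in> vs2.span (f ` B)" if x: "x \<in> V" for x
  proof -
    obtain c where "x = (\<Sum>b\<in>B. s1 (c b) b)" using vs1.span_finite_sum[OF B(1), of x] x B(3) by blast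
    then have "f x = (\<Sum>b\<in>B. s2 (c b) (f b))" using sum[of B "\<lambda>b. b"] B(2) by auto
    then show ?thesis by (simp add: vs2.span_sum vs2.span_scale vs2.span_base)
  qed
  then show ?thesis using B(1) by (intro exI[of _ "f ` B"]) auto
qed

text \<open>Preimages of a basis of the image form a basis of V modulo the kernel.\<close>

lemma rank_nullity:
  assumes F: "finite F" "V \<subseteq> vs1.span F"
  shows "vs1.dim V = vs1.dim {x \<in> V. f x = 0} + vs2.dim (f ` V)"
proof -
  obtain G where G: "finite G" "f ` V \<subseteq> vs2.span G" using image_subset_span F by blast
  obtain J where J: "finite J" "J \<subseteq> f ` V" "vs2.independent J" "f ` V \<subseteq> vs2.span J"
    "card J = vs2.dim (f ` V)"
    using vs2.finite_basis_exists[OF G] by blast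
  define t where "t = inv_into V f"
  have t: "t y \<in> V" "f (t y) = y" if "y \<in> J" for y
    using J(2) that by (auto simp: t_def inv_into_into f_inv_into_f)
  have sumt: "(\<Sum>y\<in>J. s1 (c y) (t y)) \<in> V" "f (\<Sum>y\<in>J. s1 (c y) (t y)) = (\<Sum>y\<in>J. s2 (c y) y)" for c
    using t sum[of J t] by (auto intro!: vs1.subspace_sum vs1.subspace_scale subspace_dom)
  have "vs1.basis_family_mod V {x \<in> V. f x = 0} J t"
    unfolding vs1.basis_family_mod_def
  proof (intro conjI allI impI ballI)
    show "finite J" "t ` J \<subseteq> V" using J t by auto
  next
    fix c y assume "(\<Sum>y\<in>J. s1 (c y) (t y)) \<in> {x \<in> V. f x = 0}" "y \<in> J"
    then show "c y = 0" using sumt vs2.independent_sum_zero[OF J(1,3)] by auto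
  next
    fix x assume x: "x \<in> V"
    then obtain c where "f x = (\<Sum>y\<in>J. s2 (c y) y)"
      using vs2.span_finite_sum[OF J(1)] J(4) by blast
    then have "x - (\<Sum>y\<in>J. s1 (c y) (t y)) \<in> {x \<in> V. f x = 0}"
      using x sumt by (auto simp: diff vs1.subspace_diff subspace_dom)
    then show "\<exists>c. x - (\<Sum>y\<in>J. s1 (c y) (t y)) \<in> {x \<in> V. f x = 0}" by blast
  qed
  from vs1.dim_mod[OF subspace_dom _ subspace_kernel F this] J show ?thesis by auto
qed

end

section \<open>Families of linear maps between coordinate subspaces\<close>

interpretation vec2: vector_space_pair vscale vscale ..

lemma sum_fun_apply: "(\<Sum>i\<in>I. f i) x = (\<Sum>i\<in>I. f i x)"
  by (induction I rule: infinite_finite_induct) auto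

lemma linear_mapD:
  assumes "linear_map V W f"
  shows linear_map_in: "x \<in> V \<Longrightarrow> f x \<in> W"
    and linear_map_add: "x \<in> V \<Longrightarrow> y \<in> V \<Longrightarrow> f (x + y) = f x + f y"
    and linear_map_scale: "x \<in> V \<Longrightarrow> f (vscale c x) = vscale c (f x)"
  using assms by (auto simp: linear_map_def)

lemma linear_map_zero: "linear_map V W f \<Longrightarrow> vec.subspace V \<Longrightarrow> f 0 = 0"
  using linear_map_scale[of V W f 0 0] vec.subspace_0[of V] by simp

lemma linear_map_minus:
  "linear_map V W f \<Longrightarrow> vec.subspace V \<Longrightarrow> x \<in> V \<Longrightarrow> f (- x) = - f x"
  using linear_map_scale[of V W f x "-1"] by simp

lemma linear_map_diff:
  "linear_map V W f \<Longrightarrow> vec.subspace V \<Longrightarrow> x \<in> V \<Longrightarrow> y \<in> V \<Longrightarrow> f (x - y) = f x - f y"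
  using linear_map_add[of V W f x "- y"] linear_map_minus[of V W f y] vec.subspace_neg[of V y] by simp

lemma fin_dim_space_subspace: "fin_dim_space V \<Longrightarrow> vec.subspace V"
  unfolding fin_dim_space_def by (auto simp: vec.subspace_span)

lemma fin_dim_spaceI:
  assumes "vec.subspace V" "finite F" "V \<subseteq> vec.span F"
  shows "fin_dim_space V"
proof -
  obtain B where "finite B" "B \<subseteq> V" "V \<subseteq> vec.span B"
    using vec.finite_basis_exists[OF assms(2,3)] by metis
  then have "V = vec.span B" using vec.span_minimal[OF _ assms(1), of B] by blast
  with \<open>finite B\<close> show ?thesis unfolding fin_dim_space_def by blast
qed

section \<open>Factoring and lifting linear maps\<close>

text \<open>Choose partners on a basis of S and extend linearly; closure of R under sums and
  multiples keeps the extension inside R. Since R may be multivalued, both factorizations and lifts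
  are instances.\<close>

lemma linear_selection:
  assumes S: "vec.subspace S" and W: "vec.subspace W"
    and total: "\<And>x. x \<in> S \<Longrightarrow> \<exists>y. R x y"
    and R_0: "R 0 0"
    and R_add: "\<And>x x' y y'. R x y \<Longrightarrow> R x' y' \<Longrightarrow> R (x + x') (y + y')"
    and R_scale: "\<And>c x y. R x y \<Longrightarrow> R (vscale c x) (vscale c y)"
    and R_W: "\<And>x y. R x y \<Longrightarrow> y \<in> W"
  obtains h where "linear_map UNIV W h" "\<And>x. x \<in> S \<Longrightarrow> R x (h x)"
proof -
  obtain B where B: "B \<subseteq> S" "vec.independent B" "S \<subseteq> vec.span B"
    using vec.maximal_independent_subset by blast
  obtain g where g: "\<And>x. x \<in> B \<Longrightarrow> R x (g x)" using total B(1) by (metis subsetD)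
  define h where "h = vec2.construct B g"
  interpret h: Vector_Spaces.linear vscale vscale h
    unfolding h_def by (rule vec2.linear_construct[OF B(2)])
  have "h x \<in> W" for x
  proof -
    have "h x \<in> vec.span (g ` B)" unfolding h_def by (rule vec2.construct_in_span[OF B(2)])
    also have "\<dots> \<subseteq> W" using g R_W by (intro vec.span_minimal W) blast
    finally show ?thesis .
  qed
  moreover have "R x (h x)" if "x \<in> vec.span B" for x
    using that
  proof (induction rule: vec.span_induct_alt)
    case base
    then show ?case using R_0 by (simp only: h.zero)
  next
    case (step c x y)
    then have "h x = g x" unfolding h_def by (intro vec2.construct_basis[OF B(2)])
    with step show ?case by (simp only: h.add h.scale) (intro R_add R_scale g)
  qed
  ultimately show ?thesis
    using B(3) by (intro that[of h]) (auto simp: linear_map_def h.add h.scale)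
qed

lemma subspace_linear_map_image_kernel:
  assumes "linear_map V W f" "vec.subspace V" "vec.subspace W"
  shows "vec.subspace (f ` V)" "vec.subspace {x \<in> V. f x = 0}"
proof -
  interpret linear_on_subspace vscale vscale V f
    using assms by unfold_locales (auto simp: linear_map_def)
  show "vec.subspace (f ` V)" "vec.subspace {x \<in> V. f x = 0}"
    by (rule subspace_image subspace_kernel)+
qed

text \<open>With p an inclusion this extends f from a subspace; with p a differential or an
  augmentation it lets f descend past the kernel of p.\<close>

lemma linear_map_factor:
  assumes sub: "vec.subspace V" "vec.subspace U" "vec.subspace W"
    and p: "linear_map V U p" and f: "linear_map V W f"
    and ker: "\<And>x. x \<in> V \<Longrightarrow> p x = 0 \<Longrightarrow> f x = 0"
  obtains h where "linear_map UNIV W h" "\<And>x. x \<in> V \<Longrightarrow> h (p x) = f x"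
proof -
  let ?R = "\<lambda>y w. \<exists>x\<in>V. p x = y \<and> f x = w"
  obtain h where h: "linear_map UNIV W h" "\<And>y. y \<in> p ` V \<Longrightarrow> ?R y (h y)"
  proof (rule linear_selection[of "p ` V" W ?R])
    show "vec.subspace (p ` V)" using subspace_linear_map_image_kernel p sub by blast
    show "?R 0 0" using linear_map_zero p f sub vec.subspace_0 by blast
    fix c x x' y y'
    assume a: "?R x y"
    then show "?R (vscale c x) (vscale c y)"
      using vec.subspace_scale[OF sub(1)] linear_map_scale[OF p] linear_map_scale[OF f] by metis
    assume "?R x' y'"
    with a show "?R (x + x') (y + y')"
      using vec.subspace_add[OF sub(1)] linear_map_add[OF p] linear_map_add[OF f] by metis
  qed (use sub f in \<open>auto simp: linear_map_def\<close>)
  show ?thesis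
  proof (rule that[OF h(1)])
    fix x assume x: "x \<in> V"
    \<comment> \<open>The selection only provides some x' with the same image as x; x - x' lies in
      the kernel of p, so f does not see the difference.\<close>
    then obtain x' where x': "x' \<in> V" "p x' = p x" "f x' = h (p x)" using h(2)[of "p x"] by blast
    then have "f (x - x') = 0"
      using x by (intro ker) (auto simp: linear_map_diff[OF p] sub vec.subspace_diff)
    then show "h (p x) = f x" using x x' by (simp add: linear_map_diff[OF f] sub)
  qed
qed

lemma linear_map_lift:
  assumes sub: "vec.subspace S" "vec.subspace V"
    and g: "linear_map V U g" "g ` V = U" and f: "linear_map S U f"
  obtains h where "linear_map UNIV V h" "\<And>x. x \<in> S \<Longrightarrow> g (h x) = f x"
proof -
  let ?R = "\<lambda>x y. x \<in> S \<and> y \<in> V \<and> g y = f x"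
  obtain h where "linear_map UNIV V h" "\<And>x. x \<in> S \<Longrightarrow> ?R x (h x)"
  proof (rule linear_selection[of S V ?R])
    fix x assume "x \<in> S"
    then have "f x \<in> g ` V" using f g(2) by (simp add: linear_map_def)
    then show "\<exists>y. ?R x y" using \<open>x \<in> S\<close> by auto
  next
    show "?R 0 0"
      using linear_map_zero[OF g(1) sub(2)] linear_map_zero[OF f sub(1)] sub by (simp add: vec.subspace_0)
  qed (use sub f g(1) in \<open>auto simp: linear_map_def vec.subspace_add vec.subspace_scale\<close>)
  then show ?thesis using that by blast
qed

text \<open>The scaling \<open>hscale\<close> for an arbitrary index type, so that families over
  vertices and over arrows share one theory.\<close>

definition fscale :: "'k::field \<Rightarrow> ('i \<Rightarrow> (nat \<Rightarrow> 'k) \<Rightarrow> (nat \<Rightarrow> 'k)) \<Rightarrow> 'i \<Rightarrow> (nat \<Rightarrow> 'k) \<Rightarrow> (nat \<Rightarrow> 'k)" where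
  "fscale c f = (\<lambda>i x. vscale c (f i x))"

interpretation fam: vector_space fscale
  by unfold_locales (auto simp: fscale_def vscale_def fun_eq_iff algebra_simps)

lemma hscale_eq_fscale: "hscale = fscale"
  by (simp add: fun_eq_iff hscale_def fscale_def)

definition lin_maps ::
    "('i \<Rightarrow> (nat \<Rightarrow> 'k::field) set) \<Rightarrow> ('i \<Rightarrow> (nat \<Rightarrow> 'k) set) \<Rightarrow> ('i \<Rightarrow> (nat \<Rightarrow> 'k) \<Rightarrow> (nat \<Rightarrow> 'k)) set" where
  "lin_maps V W = {f. (\<forall>i. linear_map (V i) (W i) (f i)) \<and> (\<forall>i x. x \<notin> V i \<longrightarrow> f i x = 0)}"

lemma lin_mapsD:
  assumes "f \<in> lin_maps V W"
  shows lin_maps_linear: "linear_map (V i) (W i) (f i)"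
    and lin_maps_outside: "x \<notin> V i \<Longrightarrow> f i x = 0"
  using assms by (auto simp: lin_maps_def)

lemma lin_maps_zero: "f \<in> lin_maps V W \<Longrightarrow> vec.subspace (V i) \<Longrightarrow> f i 0 = 0"
  by (meson lin_maps_linear linear_map_zero)

lemma lin_maps_in: "f \<in> lin_maps V W \<Longrightarrow> vec.subspace (W i) \<Longrightarrow> f i x \<in> W i"
  by (metis lin_maps_linear lin_maps_outside linear_map_in vec.subspace_0)

lemma subspace_lin_maps:
  assumes "\<And>i. vec.subspace (V i)" "\<And>i. vec.subspace (W i)"
  shows "fam.subspace (lin_maps V W)"
  unfolding fam.subspace_def
  by (auto simp: lin_maps_def linear_map_def fscale_def assms vec.subspace_0 vec.subspace_add
      vec.subspace_scale vec.scale_right_distrib mult.commute add.assoc add.left_commute)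

lemma lin_maps_restrict:
  assumes "\<And>i. linear_map (V i) (W i) (h i)" "\<And>i. vec.subspace (V i)"
  shows "(\<lambda>i x. if x \<in> V i then h i x else 0) \<in> lin_maps V W"
  using assms by (auto simp: lin_maps_def linear_map_def vec.subspace_add vec.subspace_scale)

text \<open>Both sides vanish off \<open>V i\<close>, so the factorization holds at every sequence
  and can be read as an equation of functions.\<close>

lemma lin_maps_factor:
  assumes sub: "\<And>i. vec.subspace (V i)" "\<And>i. vec.subspace (U i)" "\<And>i. vec.subspace (W i)"
    and p: "p \<in> lin_maps V U" and f: "f \<in> lin_maps V W"
    and ker: "\<And>i x. x \<in> V i \<Longrightarrow> p i x = 0 \<Longrightarrow> f i x = 0"
  obtains h where "h \<in> lin_maps U W" "\<And>i x. h i (p i x) = f i x"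
proof -
  have "\<exists>h. linear_map UNIV (W i) h \<and> (\<forall>x\<in>V i. h (p i x) = f i x)" for i
    using linear_map_factor[OF sub lin_maps_linear[OF p] lin_maps_linear[OF f] ker] by metis
  then obtain h where h: "\<And>i. linear_map UNIV (W i) (h i)" "\<And>i x. x \<in> V i \<Longrightarrow> h i (p i x) = f i x"
    by metis
  let ?h = "\<lambda>i x. if x \<in> U i then h i x else 0"
  have mem: "?h \<in> lin_maps U W"
    using h(1) sub by (intro lin_maps_restrict) (auto simp: linear_map_def)
  show ?thesis
  proof (rule that[OF mem])
    fix i x
    show "?h i (p i x) = f i x"
    proof (cases "x \<in> V i")
      case True
      then show ?thesis using h(2) lin_maps_in[OF p sub(2)] by simp
    next
      case False
      then have "p i x = 0" "f i x = 0"
        using lin_maps_outside[OF p] lin_maps_outside[OF f] by auto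
      then show ?thesis using lin_maps_zero[OF mem sub(2)] by (simp only:)
    qed
  qed
qed

lemma lin_maps_lift:
  assumes sub: "\<And>i. vec.subspace (S i)" "\<And>i. vec.subspace (V i)"
    and g: "g \<in> lin_maps V U" "\<And>i. g i ` V i = U i" and f: "f \<in> lin_maps S U"
  obtains h where "h \<in> lin_maps S V" "\<And>i x. g i (h i x) = f i x"
proof -
  have "\<exists>h. linear_map UNIV (V i) h \<and> (\<forall>x\<in>S i. g i (h x) = f i x)" for i
    using linear_map_lift[OF sub lin_maps_linear[OF g(1)] g(2) lin_maps_linear[OF f]] by metis
  then obtain h where h: "\<And>i. linear_map UNIV (V i) (h i)" "\<And>i x. x \<in> S i \<Longrightarrow> g i (h i x) = f i x"
    by metis
  show ?thesis
  proof (rule that)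
    show "(\<lambda>i x. if x \<in> S i then h i x else 0) \<in> lin_maps S V"
      using h(1) sub by (intro lin_maps_restrict) (auto simp: linear_map_def)
  qed (use h(2) lin_maps_outside[OF f] lin_maps_zero[OF g(1) sub(2)] in auto)
qed

lemma lin_maps_comp:
  assumes sub: "\<And>i. vec.subspace (U i)"
    and p: "p \<in> lin_maps V U" and h: "h \<in> lin_maps U W"
  shows "(\<lambda>i x. h i (p i x)) \<in> lin_maps V W"
  using assms lin_maps_zero[OF h sub] by (auto simp: lin_maps_def linear_map_def)

section \<open>Coordinates and matrix units\<close>

definition unit_vec :: "nat \<Rightarrow> nat \<Rightarrow> 'k::field" where
  "unit_vec c = (\<lambda>i. if i = c then 1 else 0)"

lemma unit_vec_in_kpow [simp]: "unit_vec c \<in> kpow n \<longleftrightarrow> c < n"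
  by (auto simp: unit_vec_def kpow_def not_le[symmetric])

lemma sum_unit_vec:
  assumes "c < n"
  shows "(\<Sum>i<n. a i * unit_vec c i) = a c"
  using assms by (simp add: unit_vec_def if_distrib cong: if_cong)

lemma subspace_kpow: "vec.subspace (kpow n)"
  by (rule fin_dim_space_subspace[OF fin_dim_space_kpow])

lemma kpow_expand:
  assumes "x \<in> kpow n"
  shows "x = (\<Sum>c<n. vscale (x c) (unit_vec c))"
  using assms by (auto simp: fun_eq_iff sum_fun_apply vscale_def unit_vec_def kpow_def if_distrib cong: if_cong)

lemma linear_map_kpow_expand:
  assumes "linear_map (kpow n) W f" "x \<in> kpow n"
  shows "f x r = (\<Sum>c<n. x c * f (unit_vec c) r)"
proof -
  interpret linear_on_subspace vscale vscale "kpow n :: (nat \<Rightarrow> 'a) set" f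
    using assms subspace_kpow by unfold_locales (auto simp: linear_map_def)
  have "f x = (\<Sum>c<n. vscale (x c) (f (unit_vec c)))"
    using sum[of "{..<n}" unit_vec x] kpow_expand[OF assms(2)] by simp
  then show ?thesis by (simp add: sum_fun_apply vscale_def)
qed

lemma
  fixes p q :: "'i \<Rightarrow> nat"
  assumes fin: "finite (UNIV :: 'i set)"
  shows dim_lin_maps_kpow:
      "fam.dim (lin_maps (\<lambda>i. kpow (p i) :: (nat \<Rightarrow> 'k::field) set) (\<lambda>i. kpow (q i))) = (\<Sum>i\<in>UNIV. p i * q i)"
    and finite_span_lin_maps_kpow:
      "\<exists>F. finite F \<and> lin_maps (\<lambda>i. kpow (p i) :: (nat \<Rightarrow> 'k::field) set) (\<lambda>i. kpow (q i)) \<subseteq> fam.span F"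
proof -
  let ?L = "lin_maps (\<lambda>i. kpow (p i) :: (nat \<Rightarrow> 'k::field) set) (\<lambda>i. kpow (q i))"
  let ?I = "SIGMA i:UNIV. {..<p i} \<times> {..<q i}"
  \<comment> \<open>\<open>b (j, c, s)\<close> is the matrix unit at index j sending
    \<open>unit_vec c\<close> to \<open>unit_vec s\<close>, cut off outside the domain.\<close>
  define b :: "'i \<times> nat \<times> nat \<Rightarrow> 'i \<Rightarrow> (nat \<Rightarrow> 'k) \<Rightarrow> (nat \<Rightarrow> 'k)" where
    "b = (\<lambda>(j, c, s) i x r. if i = j \<and> x \<in> kpow (p i) \<and> r = s then x c else 0)"
  \<comment> \<open>A combination of matrix units has the coefficient \<open>k (i, c, r)\<close> as
    its entry in row r and column c at i. Independence and generation are both read off from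
    this.\<close>
  have sum_b: "(\<Sum>t\<in>?I. fscale (k t) (b t)) i x r =
      (if x \<in> kpow (p i) \<and> r < q i then \<Sum>c<p i. k (i, c, r) * x c else 0)" for k i x r
  proof -
    have "(\<Sum>t\<in>?I. fscale (k t) (b t)) i x r = (\<Sum>t\<in>?I. k t * b t i x r)"
      by (simp add: sum_fun_apply fscale_def vscale_def)
    also have "\<dots> = (\<Sum>j\<in>UNIV. \<Sum>t\<in>{..<p j} \<times> {..<q j}. k (j, t) * b (j, t) i x r)"
      using fin by (subst sum.Sigma) (auto simp: case_prod_beta)
    also have "\<dots> = (\<Sum>j\<in>UNIV. if j = i then \<Sum>t\<in>{..<p i} \<times> {..<q i}. k (i, t) * b (i, t) i x r else 0)"
      by (intro sum.cong) (auto simp: b_def intro!: sum.neutral)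
    also have "\<dots> = (\<Sum>t\<in>{..<p i} \<times> {..<q i}. k (i, t) * b (i, t) i x r)"
      using fin by simp
    also have "\<dots> = (\<Sum>c<p i. \<Sum>s<q i. k (i, c, s) * b (i, c, s) i x r)"
      by (subst sum.cartesian_product) (simp add: case_prod_beta)
    also have "\<dots> = (\<Sum>c<p i. \<Sum>s<q i. if s = r then if x \<in> kpow (p i) then k (i, c, s) * x c else 0 else 0)"
      by (intro sum.cong) (auto simp: b_def)
    finally show ?thesis by (auto intro!: sum.neutral)
  qed
  have finI: "finite ?I" using fin by auto
  have sub: "b ` ?I \<subseteq> ?L"
    by (auto simp: b_def lin_maps_def linear_map_def kpow_def vscale_def fun_eq_iff)
  have gen: "\<exists>k. f = (\<Sum>t\<in>?I. fscale (k t) (b t))" if "f \<in> ?L" for f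
  proof
    show "f = (\<Sum>t\<in>?I. fscale (case t of (i, c, r) \<Rightarrow> f i (unit_vec c) r) (b t))"
    proof (intro ext)
      fix i x r
      have "f i x r = (\<Sum>c<p i. x c * f i (unit_vec c) r)" if "x \<in> kpow (p i)"
        using linear_map_kpow_expand[OF lin_maps_linear[OF \<open>f \<in> ?L\<close>] that] .
      moreover have "f i x r = 0" if "x \<notin> kpow (p i) \<or> \<not> r < q i"
        using that
      proof
        assume "x \<notin> kpow (p i)"
        then show ?thesis using lin_maps_outside[OF \<open>f \<in> ?L\<close>] by simp
      next
        assume "\<not> r < q i"
        then show ?thesis using lin_maps_in[OF \<open>f \<in> ?L\<close> subspace_kpow, of i x] by (simp add: kpow_def)
      qed
      ultimately show "f i x r = (\<Sum>t\<in>?I. fscale (case t of (i, c, r) \<Rightarrow> f i (unit_vec c) r) (b t)) i x r"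
        unfolding sum_b by (auto simp: mult.commute)
    qed
  qed
  have "fam.dim ?L = card ?I"
  proof (rule fam.dim_eq_card_family[OF finI sub _ gen])
    fix k assume 0: "(\<Sum>t\<in>?I. fscale (k t) (b t)) = 0"
    show "\<forall>t\<in>?I. k t = 0"
    proof (clarsimp)
      fix i c r assume "c < p i" "r < q i"
      moreover have "(\<Sum>t\<in>?I. fscale (k t) (b t)) i (unit_vec c) r = 0"
        using 0 by simp
      ultimately show "k (i, c, r) = 0"
        unfolding sum_b by (simp add: sum_unit_vec)
    qed
  qed
  also have "card ?I = (\<Sum>i\<in>UNIV. p i * q i)" using fin by simp
  finally show "fam.dim ?L = (\<Sum>i\<in>UNIV. p i * q i)" .
  have "?L \<subseteq> fam.span (b ` ?I)"
  proof
    fix f assume "f \<in> ?L"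
    then obtain k where "f = (\<Sum>t\<in>?I. fscale (k t) (b t))" using gen by blast
    then show "f \<in> fam.span (b ` ?I)"
      by (simp only:) (intro fam.span_sum fam.span_scale fam.span_base imageI)
  qed
  then show "\<exists>F. finite F \<and> ?L \<subseteq> fam.span F" using finI by blast
qed

section \<open>Projective representations\<close>

text \<open>R is a linear relation that induces an isomorphism of Q/U with Q'/U', so partners of
  representatives are again representatives. A relation fits better than a map because the
  connecting construction depends on choices.\<close>

lemma basis_family_mod_transfer:
  assumes R: "R 0 0" "\<And>x x' y y'. R x y \<Longrightarrow> R x' y' \<Longrightarrow> R (x + x') (y + y')"
      "\<And>c x y. R x y \<Longrightarrow> R (fscale c x) (fscale c y)"
    and total: "\<And>y. y \<in> Q' \<Longrightarrow> \<exists>x\<in>Q. R x y"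
    and R_iff: "\<And>x y. R x y \<Longrightarrow> x \<in> U \<longleftrightarrow> y \<in> U'"
    and t: "fam.basis_family_mod Q U S t" and u: "\<And>s. s \<in> S \<Longrightarrow> R (t s) (u s) \<and> u s \<in> Q'"
  shows "fam.basis_family_mod Q' U' S u"
proof -
  have sum: "R (\<Sum>s\<in>S. fscale (c s) (t s)) (\<Sum>s\<in>S. fscale (c s) (u s))" for c
    using u
  proof (induction S rule: infinite_finite_induct)
    case (insert s S)
    then have "R (fscale (c s) (t s) + (\<Sum>s\<in>S. fscale (c s) (t s)))
        (fscale (c s) (u s) + (\<Sum>s\<in>S. fscale (c s) (u s)))"
      by (intro R) auto
    with insert.hyps show ?case by (simp only: sum.insert simp_thms)
  qed (use R(1) in \<open>simp_all only: sum.infinite sum.empty simp_thms\<close>)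
  have diff: "R (x - x') (y - y')" if "R x y" "R x' y'" for x x' y y'
  proof -
    have "R (x + fscale (-1) x') (y + fscale (-1) y')" by (intro R that)
    then show ?thesis by (simp only: fam.scale_minus_left fam.scale_one add_uminus_conv_diff)
  qed
  show ?thesis
    unfolding fam.basis_family_mod_def
  proof (intro conjI allI impI ballI)
    show "finite S" "u ` S \<subseteq> Q'" using t u by (auto simp: fam.basis_family_mod_def)
  next
    fix c s assume "(\<Sum>s\<in>S. fscale (c s) (u s)) \<in> U'" "s \<in> S"
    then show "c s = 0" using t R_iff[OF sum] unfolding fam.basis_family_mod_def by blast
  next
    fix y assume "y \<in> Q'"
    then obtain x where x: "x \<in> Q" "R x y" using total by blast
    then obtain c where "x - (\<Sum>s\<in>S. fscale (c s) (t s)) \<in> U"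
      using t unfolding fam.basis_family_mod_def by blast
    then have "y - (\<Sum>s\<in>S. fscale (c s) (u s)) \<in> U'"
      using R_iff[OF diff[OF x(2) sum]] by blast
    then show "\<exists>c. y - (\<Sum>s\<in>S. fscale (c s) (u s)) \<in> U'" by blast
  qed
qed

lemma rep_subspace: "is_rep X \<Longrightarrow> vec.subspace (space X v)"
  by (simp add: is_rep_def fin_dim_space_subspace)

lemma rep_action: "is_rep X \<Longrightarrow> linear_map (space X (src a)) (space X (tgt a)) (action X a)"
  by (simp add: is_rep_def)

lemma rep_actionD:
  assumes "is_rep X" "x \<in> space X (src a)"
  shows rep_action_in: "action X a x \<in> space X (tgt a)"
    and rep_action_add: "y \<in> space X (src a) \<Longrightarrow> action X a (x + y) = action X a x + action X a y"
    and rep_action_diff: "y \<in> space X (src a) \<Longrightarrow> action X a (x - y) = action X a x - action X a y"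
    and rep_action_scale: "action X a (vscale c x) = vscale c (action X a x)"
  using linear_map_in[OF rep_action[OF assms(1)] assms(2)]
    linear_map_add[OF rep_action[OF assms(1)] assms(2)]
    linear_map_diff[OF rep_action[OF assms(1)] rep_subspace[OF assms(1)] assms(2)]
    linear_map_scale[OF rep_action[OF assms(1)] assms(2)]
  by auto

lemma rep_action_zero: "is_rep X \<Longrightarrow> action X a 0 = 0"
  using linear_map_zero[OF rep_action rep_subspace] .

abbreviation vertex_maps :: "'k::field quiver_rep \<Rightarrow> 'k quiver_rep \<Rightarrow> (vertex \<Rightarrow> (nat \<Rightarrow> 'k) \<Rightarrow> nat \<Rightarrow> 'k) set" where
  "vertex_maps X Y \<equiv> lin_maps (space X) (space Y)"

abbreviation arrow_maps :: "'k::field quiver_rep \<Rightarrow> 'k quiver_rep \<Rightarrow> (arrow \<Rightarrow> (nat \<Rightarrow> 'k) \<Rightarrow> nat \<Rightarrow> 'k) set" where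
  "arrow_maps X Y \<equiv> lin_maps (\<lambda>a. space X (src a)) (\<lambda>a. space Y (tgt a))"

text \<open>The differential of the standard two-term complex of X and Y. The cut-off outside the
  source space places the result in \<open>arrow_maps\<close>.\<close>

definition defect :: "'k::field quiver_rep \<Rightarrow> 'k quiver_rep \<Rightarrow> 'k rep_hom \<Rightarrow> arrow \<Rightarrow> (nat \<Rightarrow> 'k) \<Rightarrow> nat \<Rightarrow> 'k" where
  "defect X Y f = (\<lambda>a x. if x \<in> space X (src a)
     then f (tgt a) (action X a x) - action Y a (f (src a) x) else 0)"

lemma Hom_iff: "f \<in> Hom X Y \<longleftrightarrow> f \<in> vertex_maps X Y \<and> defect X Y f = 0"
  by (auto simp: Hom_def lin_maps_def defect_def fun_eq_iff)

lemma Hom_eq_kernel: "Hom X Y = {f \<in> vertex_maps X Y. defect X Y f = 0}"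
  using Hom_iff by blast

lemma Hom_vertex_maps: "f \<in> Hom X Y \<Longrightarrow> f \<in> vertex_maps X Y"
  by (simp add: Hom_iff)

lemma Hom_action: "f \<in> Hom X Y \<Longrightarrow> x \<in> space X (src a) \<Longrightarrow> f (tgt a) (action X a x) = action Y a (f (src a) x)"
  by (simp add: Hom_def)

lemma defect_in_arrow_maps:
  assumes X: "is_rep X" and Y: "is_rep Y" and f: "f \<in> vertex_maps X Y"
  shows "defect X Y f \<in> arrow_maps X Y"
proof -
  note [simp] = rep_subspace[OF X] rep_subspace[OF Y] rep_actionD[OF X] rep_actionD[OF Y]
    lin_maps_in[OF f] linear_mapD[OF lin_maps_linear[OF f]]
  show ?thesis
    unfolding defect_def
    by (rule lin_maps_restrict)
      (auto simp: linear_map_def vec.subspace_diff vec.scale_right_diff_distrib)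
qed

lemma vscale_diff_apply: "vscale c (x - y) i = vscale c x i - vscale c y i"
  by (simp add: vscale_def algebra_simps)

lemma defect_linear:
  assumes X: "is_rep X" and Y: "is_rep Y"
  shows "linear_on_subspace fscale fscale (vertex_maps X Y) (defect X Y)"
proof unfold_locales
  show "fam.subspace (vertex_maps X Y)"
    by (intro subspace_lin_maps rep_subspace X Y)
  note [simp] = rep_subspace[OF Y] lin_maps_in rep_actionD[OF Y]
  fix f g c assume f: "f \<in> vertex_maps X Y"
  show "defect X Y (fscale c f) = fscale c (defect X Y f)"
    using f by (auto simp: defect_def fscale_def fun_eq_iff vscale_diff_apply)
  assume "g \<in> vertex_maps X Y"
  then show "defect X Y (f + g) = defect X Y f + defect X Y g"
    using f by (auto simp: defect_def fun_eq_iff)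
qed

text \<open>This says that \<open>Ext\<^sup>1(P, -)\<close>, computed as a cokernel, vanishes; it turns out to be equivalent to
  projectivity.\<close>

definition unobstructed :: "'k::field quiver_rep \<Rightarrow> bool" where
  "unobstructed P \<longleftrightarrow> (\<forall>Y. is_rep Y \<longrightarrow> arrow_maps P Y \<subseteq> defect P Y ` vertex_maps P Y)"

lemma unobstructedD:
  assumes "unobstructed P" "is_rep Y" "c \<in> arrow_maps P Y"
  obtains f where "f \<in> vertex_maps P Y" "defect P Y f = c"
  using assms unfolding unobstructed_def by blast

definition kernel_rep :: "'k::field quiver_rep \<Rightarrow> 'k rep_hom \<Rightarrow> 'k quiver_rep" where
  "kernel_rep X f = \<lparr>space = (\<lambda>v. {x \<in> space X v. f v x = 0}), action = action X\<rparr>"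

lemma kernel_rep_simps [simp]:
  "space (kernel_rep X f) v = {x \<in> space X v. f v x = 0}"
  "action (kernel_rep X f) = action X"
  by (simp_all add: kernel_rep_def)

lemma is_rep_kernel_rep:
  assumes X: "is_rep X" and Y: "is_rep Y" and f: "f \<in> Hom X Y"
  shows "is_rep (kernel_rep X f)"
proof -
  have "fin_dim_space {x \<in> space X v. f v x = 0}" for v
  proof -
    obtain B where "finite B" "space X v = vec.span B"
      using X unfolding is_rep_def fin_dim_space_def by blast
    moreover have "vec.subspace {x \<in> space X v. f v x = 0}"
      using subspace_linear_map_image_kernel(2)[OF lin_maps_linear[OF Hom_vertex_maps[OF f]]] X Y
      by (simp add: rep_subspace)
    ultimately show ?thesis by (intro fin_dim_spaceI[of _ B]) auto
  qed
  moreover have "linear_map {x \<in> space X (src a). f (src a) x = 0} {x \<in> space X (tgt a). f (tgt a) x = 0} (action X a)" for a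
    using rep_actionD[OF X] Hom_action[OF f] rep_action_zero[OF Y] by (auto simp: linear_map_def)
  ultimately show ?thesis by (simp add: is_rep_def)
qed

text \<open>Lift h vertexwise to h0. Its defect has values in the kernel of g because g and h are
  morphisms, so it is also the defect of some f into that kernel. Then h0 - f is a morphism, and g
  takes it to h.\<close>

lemma unobstructed_projective:
  assumes P: "is_rep P" "unobstructed P"
  shows "projective P"
  unfolding projective_def
proof (intro conjI P(1) allI impI; elim conjE)
  fix Y Z g h
  assume Y: "is_rep Y" and Z: "is_rep Z" and g: "g \<in> Hom Y Z" "surjective Y Z g" and h: "h \<in> Hom P Z"
  obtain h0 where h0: "h0 \<in> vertex_maps P Y" "\<And>v x. g v (h0 v x) = h v x"
    using lin_maps_lift[of "space P" "space Y" g "space Z" h] P Y g h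
    by (auto simp: rep_subspace Hom_vertex_maps surjective_def)
  let ?N = "kernel_rep Y g"
  let ?c = "defect P Y h0"
  have c: "?c \<in> arrow_maps P Y" by (rule defect_in_arrow_maps[OF P(1) Y h0(1)])
  have "g (tgt a) (?c a x) = 0" for a x
  proof (cases "x \<in> space P (src a)")
    case True
    have "g (tgt a) (?c a x) = g (tgt a) (h0 (tgt a) (action P a x)) - g (tgt a) (action Y a (h0 (src a) x))"
      using True Y
      by (auto simp: defect_def rep_subspace rep_action_in lin_maps_in[OF h0(1)]
          intro!: linear_map_diff[OF lin_maps_linear[OF Hom_vertex_maps[OF g(1)]]])
    also have "\<dots> = h (tgt a) (action P a x) - action Z a (g (src a) (h0 (src a) x))"
      using Y by (simp add: h0 Hom_action[OF g(1)] lin_maps_in[OF h0(1)] rep_subspace)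
    also have "\<dots> = 0" using True by (simp add: h0 Hom_action[OF h])
    finally show ?thesis .
  next
    case False
    then show ?thesis
      using lin_maps_zero[OF Hom_vertex_maps[OF g(1)]] Y by (simp add: defect_def rep_subspace)
  qed
  then have "?c \<in> arrow_maps P ?N"
    using c by (auto simp: lin_maps_def linear_map_def)
  then obtain f where f: "f \<in> vertex_maps P ?N" "defect P ?N f = ?c"
    using unobstructedD[OF P(2) is_rep_kernel_rep[OF Y Z g(1)]] by blast
  have f': "f \<in> vertex_maps P Y" "\<And>v x. g v (f v x) = 0"
  proof -
    show "f \<in> vertex_maps P Y" using f(1) by (auto simp: lin_maps_def linear_map_def)
    show "g v (f v x) = 0" for v x
      using lin_maps_in[OF f(1), of v x] rep_subspace[OF is_rep_kernel_rep[OF Y Z g(1)]]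
      by simp
  qed
  interpret D: linear_on_subspace fscale fscale "vertex_maps P Y" "defect P Y"
    by (rule defect_linear[OF P(1) Y])
  \<comment> \<open>The kernel carries the action of Y, so both targets give the same
    defect.\<close>
  have "defect P ?N f = defect P Y f" by (simp add: defect_def fun_eq_iff)
  then have "defect P Y f = ?c" using f(2) by (simp only:)
  then have "h0 - f \<in> Hom P Y"
    using h0(1) f'(1) D.subspace_dom by (simp add: Hom_iff D.diff fam.subspace_diff)
  moreover have "g \<circ>\<^sub>R (h0 - f) = h"
  proof (intro ext)
    fix v x i
    have "g v (h0 v x - f v x) = g v (h0 v x) - g v (f v x)"
      using Y by (intro linear_map_diff[OF lin_maps_linear[OF Hom_vertex_maps[OF g(1)]]])
        (auto simp: rep_subspace lin_maps_in[OF h0(1)] lin_maps_in[OF f'(1)])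
    then show "(g \<circ>\<^sub>R (h0 - f)) v x i = h v x i"
      by (simp add: hom_comp_def h0 f')
  qed
  ultimately show "\<exists>h'\<in>Hom P Y. g \<circ>\<^sub>R h' = h" by blast
qed

lemma lin_maps_inclusion:
  assumes "\<And>i. vec.subspace (V i)" "\<And>i. V i \<subseteq> W i"
  shows "(\<lambda>i x. if x \<in> V i then x else 0) \<in> lin_maps V W"
  using assms by (intro lin_maps_restrict) (auto simp: linear_map_def)

text \<open>This is the heredity of the quiver. An arrow family on N extends linearly to P without
  any compatibility condition, is a defect there, and the solution restricts to N.\<close>

lemma unobstructed_subrep:
  assumes P: "is_rep P" "unobstructed P"
    and N: "is_rep N" "\<And>v. space N v \<subseteq> space P v" "action N = action P"
  shows "unobstructed N"
  unfolding unobstructed_def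
proof (intro allI impI subsetI)
  fix Y c assume Y: "is_rep Y" and c: "c \<in> arrow_maps N Y"
  let ?i = "\<lambda>a x. if x \<in> space N (src a) then x else 0"
  \<comment> \<open>Factoring c through the inclusion \<open>?i\<close> extends it from N to
    P.\<close>
  obtain h where h: "h \<in> arrow_maps P Y" "\<And>a x. h a (?i a x) = c a x"
  proof (rule lin_maps_factor[of "\<lambda>a. space N (src a)" "\<lambda>a. space P (src a)" "\<lambda>a. space Y (tgt a)" ?i c])
    show "?i \<in> lin_maps (\<lambda>a. space N (src a)) (\<lambda>a. space P (src a))"
      using N by (intro lin_maps_inclusion rep_subspace)
    show "c a x = 0" if "x \<in> space N (src a)" "?i a x = 0" for a x
      using that lin_maps_zero[OF c] rep_subspace[OF N(1)] by simp
  qed (use N(1) P(1) Y c in \<open>auto simp: rep_subspace\<close>)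
  obtain f where f: "f \<in> vertex_maps P Y" "defect P Y f = h"
    using unobstructedD[OF P(2) Y h(1)] by blast
  let ?f = "\<lambda>v x. if x \<in> space N v then f v x else 0"
  have "?f \<in> vertex_maps N Y"
    using linear_mapD[OF lin_maps_linear[OF f(1)]] subsetD[OF N(2)] N(1)
    by (intro lin_maps_restrict) (auto simp: linear_map_def rep_subspace)
  moreover have "defect N Y ?f = c"
  proof (intro ext)
    fix a x i
    show "defect N Y ?f a x i = c a x i"
    proof (cases "x \<in> space N (src a)")
      case True
      then have "defect N Y ?f a x = defect P Y f a x"
        using N(2) rep_action_in[OF N(1) True] N(3) by (auto simp: defect_def)
      also have "\<dots> = c a x" using h(2)[of a x] f(2) True by simp
      finally show ?thesis by simp
    next
      case False
      then show ?thesis using lin_maps_outside[OF c, of x a] by (simp add: defect_def)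
    qed
  qed
  ultimately show "c \<in> defect N Y ` vertex_maps N Y" by blast
qed

section \<open>Direct sums and the free cover\<close>

text \<open>All spaces must consist of sequences, so a direct sum is encoded with one summand at the
  even and the other at the odd positions; \<open>evens\<close> and \<open>odds\<close> are the
  projections.\<close>

definition interleave :: "(nat \<Rightarrow> 'k) \<Rightarrow> (nat \<Rightarrow> 'k) \<Rightarrow> nat \<Rightarrow> 'k::field" where
  "interleave x y = (\<lambda>i. if even i then x (i div 2) else y (i div 2))"

definition evens :: "(nat \<Rightarrow> 'k) \<Rightarrow> nat \<Rightarrow> 'k::field" where
  "evens z = (\<lambda>i. z (2 * i))"

definition odds :: "(nat \<Rightarrow> 'k) \<Rightarrow> nat \<Rightarrow> 'k::field" where
  "odds z = (\<lambda>i. z (2 * i + 1))"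

lemma evens_odds_simps [simp]:
  "evens (interleave x y) = x" "odds (interleave x y) = y"
  "evens (z + w) = evens z + evens w" "odds (z + w) = odds z + odds w"
  "evens (vscale c z) = vscale c (evens z)" "odds (vscale c z) = vscale c (odds z)"
  "evens 0 = 0" "odds 0 = 0" "interleave 0 0 = 0"
  by (auto simp: evens_def odds_def interleave_def vscale_def fun_eq_iff)

lemma interleave_zero_linear:
  "interleave (x + y) 0 = interleave x 0 + interleave y 0"
  "interleave 0 (x + y) = interleave 0 x + interleave 0 y"
  "interleave (vscale c x) 0 = vscale c (interleave x 0)"
  "interleave 0 (vscale c x) = vscale c (interleave 0 x)"
  by (auto simp: interleave_def vscale_def fun_eq_iff)

lemma interleave_evens_odds: "interleave (evens z) 0 + interleave 0 (odds z) = z"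
  by (auto simp: interleave_def evens_def odds_def fun_eq_iff)

definition dsum :: "(nat \<Rightarrow> 'k) set \<Rightarrow> (nat \<Rightarrow> 'k) set \<Rightarrow> (nat \<Rightarrow> 'k::field) set" where
  "dsum V W = {z. evens z \<in> V \<and> odds z \<in> W}"

lemma mem_dsum [simp]: "z \<in> dsum V W \<longleftrightarrow> evens z \<in> V \<and> odds z \<in> W"
  by (simp add: dsum_def)

lemma subspace_dsum: "vec.subspace V \<Longrightarrow> vec.subspace W \<Longrightarrow> vec.subspace (dsum V W)"
  by (auto simp: vec.subspace_def)

lemma fin_dim_space_dsum:
  assumes "fin_dim_space V" "fin_dim_space W"
  shows "fin_dim_space (dsum V W)"
proof -
  note sub = assms[THEN fin_dim_space_subspace]
  interpret L: linear_on_subspace vscale vscale V "\<lambda>x. interleave x 0"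
    using sub by unfold_locales (auto simp: interleave_zero_linear)
  interpret R: linear_on_subspace vscale vscale W "\<lambda>y. interleave 0 y"
    using sub by unfold_locales (auto simp: interleave_zero_linear)
  obtain F where F: "finite F" "(\<lambda>x. interleave x 0) ` V \<subseteq> vec.span F"
    using L.image_subset_span assms(1) unfolding fin_dim_space_def by blast
  obtain G where G: "finite G" "(\<lambda>y. interleave 0 y) ` W \<subseteq> vec.span G"
    using R.image_subset_span assms(2) unfolding fin_dim_space_def by blast
  have "z \<in> vec.span (F \<union> G)" if "z \<in> dsum V W" for z
  proof -
    have "interleave (evens z) 0 \<in> vec.span (F \<union> G)" "interleave 0 (odds z) \<in> vec.span (F \<union> G)"
      using that[unfolded mem_dsum] F(2) G(2) vec.span_mono[of F "F \<union> G"] vec.span_mono[of G "F \<union> G"] by blast+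
    then have "interleave (evens z) 0 + interleave 0 (odds z) \<in> vec.span (F \<union> G)"
      by (rule vec.span_add)
    then show ?thesis by (simp only: interleave_evens_odds)
  qed
  then show ?thesis
    using F(1) G(1) subspace_dsum[OF sub] by (intro fin_dim_spaceI[of _ "F \<union> G"]) auto
qed

text \<open>The representation freely generated by the spaces of \<open>X\<close>: the summands at a vertex correspond to
  the paths ending there.\<close>

definition free_rep :: "'k::field quiver_rep \<Rightarrow> 'k quiver_rep" where
  "free_rep X = \<lparr>
     space = (\<lambda>v. case v of
         Vb \<Rightarrow> space X Vb
       | Vmid \<Rightarrow> dsum (space X Vmid) (space X Vb)
       | Ve \<Rightarrow> dsum (space X Ve) (dsum (dsum (space X Vmid) (space X Vb)) (space X Vb))),
     action = (\<lambda>a x. case a of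
         Arr_be \<Rightarrow> interleave 0 (interleave 0 x)
       | Arr_bmid \<Rightarrow> interleave 0 x
       | Arr_mide \<Rightarrow> interleave 0 (interleave x 0))\<rparr>"

text \<open>Each summand is moved to the vertex by the action along its path. At \<open>Ve\<close>,
  \<open>odds (odds x)\<close> belongs to the arrow from b, \<open>evens (evens (odds x))\<close> to
  the arrow from mid, and \<open>odds (evens (odds x))\<close> to the path through mid.\<close>

definition free_cover :: "'k::field quiver_rep \<Rightarrow> 'k rep_hom" where
  "free_cover X = (\<lambda>v x. if x \<in> space (free_rep X) v then
     (case v of
         Vb \<Rightarrow> x
       | Vmid \<Rightarrow> evens x + action X Arr_bmid (odds x)
       | Ve \<Rightarrow> evens x + action X Arr_be (odds (odds x)) + action X Arr_mide
           (evens (evens (odds x)) + action X Arr_bmid (odds (evens (odds x))))) else 0)"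

lemma all_arrow: "(\<forall>a. Q a) \<longleftrightarrow> Q Arr_be \<and> Q Arr_bmid \<and> Q Arr_mide"
  using arrow.exhaust by metis

lemma all_vertex: "(\<forall>v. Q v) \<longleftrightarrow> Q Vb \<and> Q Vmid \<and> Q Ve"
  using vertex.exhaust by metis

lemma is_rep_free_rep: "is_rep X \<Longrightarrow> is_rep (free_rep X)"
  unfolding is_rep_def all_arrow all_vertex free_rep_def
  by (auto simp: interleave_zero_linear fin_dim_space_dsum fin_dim_space_subspace vec.subspace_0 linear_map_def)

lemma free_cover_Hom:
  assumes X: "is_rep X"
  shows "free_cover X \<in> Hom (free_rep X) X"
proof -
  note R = rep_action_in[OF X, of _ Arr_be] rep_action_in[OF X, of _ Arr_bmid] rep_action_in[OF X, of _ Arr_mide]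
    rep_action_add[OF X, of _ Arr_be] rep_action_add[OF X, of _ Arr_bmid] rep_action_add[OF X, of _ Arr_mide]
    rep_action_scale[OF X, of _ Arr_be] rep_action_scale[OF X, of _ Arr_bmid] rep_action_scale[OF X, of _ Arr_mide]
  note [simp] = R[simplified] rep_subspace[OF X] vec.subspace_add vec.subspace_scale subspace_dsum
    vec.subspace_0 rep_action_zero[OF X] vec.scale_right_distrib
  have "linear_map (space (free_rep X) v) (space X v) (free_cover X v)" for v
    by (cases v) (auto simp: linear_map_def free_rep_def free_cover_def)
  moreover have "free_cover X (tgt a) (action (free_rep X) a x) = action X a (free_cover X (src a) x)"
    if "x \<in> space (free_rep X) (src a)" for a x
    using that by (cases a) (auto simp: free_rep_def free_cover_def)
  ultimately show ?thesis by (auto simp: Hom_def free_cover_def)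
qed

lemma free_cover_surjective:
  assumes X: "is_rep X"
  shows "surjective (free_rep X) X (free_cover X)"
  unfolding surjective_def
proof (intro allI equalityI subsetI)
  fix v x assume "x \<in> free_cover X v ` space (free_rep X) v"
  then show "x \<in> space X v"
    using lin_maps_in[OF Hom_vertex_maps[OF free_cover_Hom[OF X]] rep_subspace[OF X]] by auto
next
  fix v x assume "x \<in> space X v"
  \<comment> \<open>The summand of the trivial path already covers \<open>space X v\<close>.\<close>
  then have "x = free_cover X v (case v of Vb \<Rightarrow> x | _ \<Rightarrow> interleave x 0)"
    "(case v of Vb \<Rightarrow> x | _ \<Rightarrow> interleave x 0) \<in> space (free_rep X) v"
    using rep_subspace[OF X]
    by (auto split: vertex.split simp: free_cover_def free_rep_def vec.subspace_0 subspace_dsum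
        rep_action_zero[OF X])
  then show "x \<in> free_cover X v ` space (free_rep X) v" by blast
qed

text \<open>Every arrow embeds its source as a summand of its target, so f can be built path by
  path: 0 on the generators, and on the summand reached by an arrow a the value of
  \<open>c a\<close> plus the action of Y on the value found before.\<close>

lemma unobstructed_free_rep:
  assumes X: "is_rep X"
  shows "unobstructed (free_rep X)"
  unfolding unobstructed_def
proof (intro allI impI subsetI)
  let ?F = "free_rep X"
  fix Y c assume Y: "is_rep Y" and c: "c \<in> arrow_maps ?F Y"
  \<comment> \<open>The solution at \<open>Vmid\<close>, needed again for the paths that continue to
    \<open>Ve\<close>.\<close>
  define m where "m u = c Arr_bmid (odds u)" for u
  define f where "f = (\<lambda>v x. if x \<in> space ?F v then (case v of Vb \<Rightarrow> 0 | Vmid \<Rightarrow> m x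
    | Ve \<Rightarrow> c Arr_be (odds (odds x)) + (c Arr_mide (evens (odds x))
        + action Y Arr_mide (m (evens (odds x))))) else 0)"
  have cin: "c Arr_be x \<in> space Y Ve" "c Arr_bmid x \<in> space Y Vmid" "c Arr_mide x \<in> space Y Ve" for x
    using lin_maps_in[OF c] rep_subspace[OF Y] by (metis tgt.simps)+
  note cl = lin_maps_linear[OF c, of Arr_be] lin_maps_linear[OF c, of Arr_bmid] lin_maps_linear[OF c, of Arr_mide]
  note [simp] = cin cl[THEN linear_map_add, simplified] cl[THEN linear_map_scale, simplified]
    rep_action_in[OF Y, of _ Arr_mide, simplified] rep_action_add[OF Y, of _ Arr_mide, simplified]
    rep_action_scale[OF Y, of _ Arr_mide, simplified] lin_maps_zero[OF c rep_subspace[OF is_rep_free_rep[OF X]]]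
    rep_subspace[OF X] rep_subspace[OF Y] vec.subspace_add vec.subspace_scale vec.subspace_0 subspace_dsum
    rep_action_zero[OF Y] vec.scale_right_distrib
  have "f \<in> vertex_maps ?F Y"
    unfolding f_def
  proof (rule lin_maps_restrict)
    fix v
    show "vec.subspace (space ?F v)" using rep_subspace[OF is_rep_free_rep[OF X]] .
    show "linear_map (space ?F v) (space Y v) (\<lambda>x. case v of Vb \<Rightarrow> 0 | Vmid \<Rightarrow> m x
      | Ve \<Rightarrow> c Arr_be (odds (odds x)) + (c Arr_mide (evens (odds x))
        + action Y Arr_mide (m (evens (odds x)))))"
      by (cases v) (auto simp: linear_map_def m_def free_rep_def)
  qed
  moreover have "defect ?F Y f = c"
  proof (intro ext)
    fix a x i
    show "defect ?F Y f a x i = c a x i"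
    proof (cases "x \<in> space ?F (src a)")
      case True
      then show ?thesis
        by (cases a) (auto simp: defect_def f_def m_def free_rep_def)
    next
      case False
      then show ?thesis using lin_maps_outside[OF c, of x a] by (simp add: defect_def)
    qed
  qed
  ultimately show "c \<in> defect ?F Y ` vertex_maps ?F Y" by blast
qed

section \<open>Resolutions and the Euler form\<close>

text \<open>Naturality in the first variable: p commutes with the actions, so composing with it
  commutes with forming the defect.\<close>

lemma defect_comp:
  assumes X': "is_rep X'" and Y: "is_rep Y"
    and p: "p \<in> Hom X X'" and f: "f \<in> vertex_maps X' Y"
  shows "defect X Y (f \<circ>\<^sub>R p) = (\<lambda>a x. defect X' Y f a (p (src a) x))"
proof (intro ext)
  fix a x i
  show "defect X Y (f \<circ>\<^sub>R p) a x i = defect X' Y f a (p (src a) x) i"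
  proof (cases "x \<in> space X (src a)")
    case True
    then have "p (src a) x \<in> space X' (src a)"
      using lin_maps_in[OF Hom_vertex_maps[OF p]] X' by (simp add: rep_subspace)
    then show ?thesis using True Hom_action[OF p True] by (simp add: defect_def hom_comp_def)
  next
    case False
    then have "p (src a) x = 0" using lin_maps_outside[OF Hom_vertex_maps[OF p]] by blast
    moreover have "defect X' Y f a 0 = 0"
      using lin_maps_zero[OF defect_in_arrow_maps[OF X' Y f]] X' by (simp add: rep_subspace)
    ultimately show ?thesis using False by (simp add: defect_def)
  qed
qed

lemma vertex_maps_comp:
  assumes "is_rep U" "p \<in> vertex_maps X U" "f \<in> vertex_maps U Y"
  shows "f \<circ>\<^sub>R p \<in> vertex_maps X Y"
  using lin_maps_comp[OF rep_subspace[OF assms(1)] assms(2,3)] by (simp add: hom_comp_def)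

lemma arrow_maps_comp:
  assumes "is_rep U" "p \<in> vertex_maps X U" "c \<in> arrow_maps U Y"
  shows "(\<lambda>a x. c a (p (src a) x)) \<in> arrow_maps X Y"
proof (rule lin_maps_comp[where U = "\<lambda>a. space U (src a)" and p = "\<lambda>a. p (src a)" and h = c])
  show "(\<lambda>a. p (src a)) \<in> lin_maps (\<lambda>a. space X (src a)) (\<lambda>a. space U (src a))"
    using assms(2) by (simp add: lin_maps_def)
qed (use assms in \<open>auto simp: rep_subspace\<close>)

lemma inclusion_Hom:
  assumes "is_rep N" "\<And>v. space N v \<subseteq> space P v" "action N = action P"
  shows "(\<lambda>v x. if x \<in> space N v then x else 0) \<in> Hom N P"
  using lin_maps_inclusion[of "space N" "space P"] assms rep_subspace[OF assms(1)]
    rep_action_in[OF assms(1)]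
  by (auto simp: Hom_iff defect_def fun_eq_iff)

text \<open>The free cover of P splits. Pull the arrow family back to the free representation, solve
  there, and compose the solution with the section s.\<close>

lemma projective_unobstructed:
  assumes "projective P"
  shows "unobstructed P"
  unfolding unobstructed_def
proof (intro allI impI subsetI)
  have P: "is_rep P" using assms by (simp add: projective_def)
  let ?F = "free_rep P" and ?e = "free_cover P"
  note F = is_rep_free_rep[OF P] and e = free_cover_Hom[OF P]
  \<comment> \<open>In the convention of \<open>Hom\<close> the identity is cut off to 0 outside the
    spaces; s lifts it.\<close>
  obtain s where s: "s \<in> Hom P ?F" "?e \<circ>\<^sub>R s = (\<lambda>v x. if x \<in> space P v then x else 0)"
    using assms P F e free_cover_surjective[OF P] inclusion_Hom[of P P]
    unfolding projective_def by blast
  fix Y c assume Y: "is_rep Y" and c: "c \<in> arrow_maps P Y"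
  obtain f where f: "f \<in> vertex_maps ?F Y" "defect ?F Y f = (\<lambda>a x. c a (?e (src a) x))"
    using unobstructedD[OF unobstructed_free_rep[OF P] Y arrow_maps_comp[OF P Hom_vertex_maps[OF e] c]]
    by blast
  have "defect P Y (f \<circ>\<^sub>R s) = (\<lambda>a x. c a ((?e \<circ>\<^sub>R s) (src a) x))"
    using defect_comp[OF F Y s(1) f(1)] f(2) by (simp add: hom_comp_def)
  also have "\<dots> = c"
    unfolding s(2) using lin_maps_zero[OF c] lin_maps_outside[OF c] rep_subspace[OF P]
    by (auto simp: fun_eq_iff)
  finally show "c \<in> defect P Y ` vertex_maps P Y"
    using vertex_maps_comp[OF F Hom_vertex_maps[OF s(1)] f(1)] by blast
qed

definition zero_rep :: "'k::field quiver_rep" where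
  "zero_rep = \<lparr>space = (\<lambda>v. {0}), action = (\<lambda>a x. 0)\<rparr>"

lemma projective_zero_rep: "projective zero_rep"
proof (rule unobstructed_projective)
  have "fin_dim_space ({0} :: (nat \<Rightarrow> 'a) set)"
    unfolding fin_dim_space_def by (rule exI[of _ "{}"]) simp
  then show "is_rep (zero_rep :: 'a quiver_rep)"
    by (auto simp: is_rep_def zero_rep_def linear_map_def)
  show "unobstructed (zero_rep :: 'a quiver_rep)"
    unfolding unobstructed_def
  proof (intro allI impI subsetI)
    fix Y :: "'a quiver_rep" and c assume Y: "is_rep Y" and c: "c \<in> arrow_maps zero_rep Y"
    have "c a x = 0" for a x
      using lin_maps_outside[OF c, of x a] lin_maps_zero[OF c, of a]
      by (cases "x = 0") (auto simp: zero_rep_def)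
    then have "c = 0" by (simp add: fun_eq_iff)
    moreover have "0 \<in> vertex_maps zero_rep Y" "defect zero_rep Y 0 = 0"
      using Y by (auto simp: lin_maps_def linear_map_def rep_subspace vec.subspace_0 defect_def
          fun_eq_iff rep_action_zero)
    ultimately show "c \<in> defect zero_rep Y ` vertex_maps zero_rep Y" by force
  qed
qed

text \<open>A subrepresentation of an unobstructed representation is unobstructed, so the kernel of the
  free cover is already projective.\<close>

lemma projective_resolution_exists:
  assumes X: "is_rep X"
  shows "\<exists>P d \<epsilon>. projective_resolution X P d \<epsilon>"
proof -
  let ?F = "free_rep X" and ?e = "free_cover X"
  let ?K = "kernel_rep ?F ?e"
  note F = is_rep_free_rep[OF X] and e = free_cover_Hom[OF X]
  have K: "is_rep ?K" by (rule is_rep_kernel_rep[OF F X e])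
  define P where "P n = (if n = 0 then ?F else if n = 1 then ?K else zero_rep)" for n :: nat
  define d :: "nat \<Rightarrow> 'a rep_hom" where
    "d n = (if n = 0 then \<lambda>v x. if x \<in> space ?K v then x else 0 else 0)" for n
  have "projective (P n)" for n
    using unobstructed_projective[OF F unobstructed_free_rep[OF X]] projective_zero_rep
      unobstructed_projective[OF K unobstructed_subrep[OF F unobstructed_free_rep[OF X] K]]
    by (auto simp: P_def)
  moreover have "d n \<in> Hom (P (Suc n)) (P n)" for n
  proof (cases n)
    case 0
    then show ?thesis using inclusion_Hom[OF K, of ?F] by (auto simp: P_def d_def)
  next
    case (Suc m)
    then show ?thesis using rep_subspace[OF K] rep_action_zero[OF K]
      by (auto simp: P_def d_def Hom_def linear_map_def zero_rep_def vec.subspace_0 simp del: kernel_rep_simps)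
  qed
  moreover have "exact_at (P 1) (P 0) (d 0) ?e"
    by (auto simp: exact_at_def P_def d_def)
  moreover have "exact_at (P (Suc (Suc n))) (P (Suc n)) (d (Suc n)) (d n)" for n
    using rep_subspace[OF K, THEN vec.subspace_0]
    by (auto simp: exact_at_def P_def d_def zero_rep_def)
  ultimately show ?thesis
    using e free_cover_surjective[OF X] unfolding projective_resolution_def
    by (intro exI[of _ P] exI[of _ d] exI[of _ ?e]) (simp add: P_def)
qed

lemma basis_mod_iff: "basis_mod Z B S \<longleftrightarrow> fam.basis_family_mod Z B S id"
  by (simp add: basis_mod_def fam.basis_family_mod_def hscale_eq_fscale)

text \<open>The connecting relation of the double complex of a resolution identifies the first cohomology
  with the cokernel of \<^const>\<open>defect\<close>.\<close>

lemma quot_dim_cocycles: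
  assumes X: "is_rep X" and Y: "is_rep Y" and res: "projective_resolution X P d \<epsilon>"
    and fin: "finite F" "arrow_maps X Y \<subseteq> fam.span F"
  shows "fam.dim (arrow_maps X Y) =
    fam.dim (defect X Y ` vertex_maps X Y) + quot_dim (cocycles1 P d Y) (coboundaries1 P d Y)"
proof -
  let ?Z = "cocycles1 P d Y" and ?B = "coboundaries1 P d Y"
  let ?Q = "arrow_maps X Y" and ?I = "defect X Y ` vertex_maps X Y"
  have P: "is_rep (P n)" for n using res by (auto simp: projective_resolution_def projective_def)
  have free: "unobstructed (P 0)" using res by (auto simp: projective_resolution_def projective_unobstructed)
  have d: "d n \<in> Hom (P (Suc n)) (P n)" for n using res by (simp add: projective_resolution_def)
  have \<epsilon>: "\<epsilon> \<in> Hom (P 0) X" "\<And>v. \<epsilon> v ` space (P 0) v = space X v"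
    using res by (auto simp: projective_resolution_def surjective_def)
  have ex0: "d 0 v ` space (P 1) v = {y \<in> space (P 0) v. \<epsilon> v y = 0}" for v
    using res by (auto simp: projective_resolution_def exact_at_def)
  have ex1: "d 1 v ` space (P 2) v = {y \<in> space (P 1) v. d 0 v y = 0}" for v
    using res by (auto simp: projective_resolution_def exact_at_def numeral_2_eq_2)
  note dv = d[THEN Hom_vertex_maps] and ev = \<epsilon>(1)[THEN Hom_vertex_maps]
  have ed: "\<epsilon> v (d 0 v x) = 0" for v x
    using ex0[of v] lin_maps_outside[OF dv[of 0]] lin_maps_zero[OF ev] rep_subspace[OF P]
    by (cases "x \<in> space (P 1) v") auto
  have dd: "d 0 v (d 1 v x) = 0" for v x
    using ex1[of v] lin_maps_outside[OF dv[of 1]] lin_maps_zero[OF dv[of 0]] rep_subspace[OF P]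
    by (cases "x \<in> space (P 2) v") (auto simp: numeral_2_eq_2)
  interpret D0: linear_on_subspace fscale fscale "vertex_maps (P 0) Y" "defect (P 0) Y"
    by (rule defect_linear[OF P Y])
  interpret D: linear_on_subspace fscale fscale "vertex_maps X Y" "defect X Y"
    by (rule defect_linear[OF X Y])
  \<comment> \<open>\<open>R f h\<close>: some vertexwise factor g of f through \<open>d 0\<close>
    has a defect that descends along \<epsilon> to h. The factor g is not unique, hence a
    relation.\<close>
  define R where "R f h \<longleftrightarrow> h \<in> ?Q \<and> (\<exists>g \<in> vertex_maps (P 0) Y.
      f = g \<circ>\<^sub>R d 0 \<and> defect (P 0) Y g = (\<lambda>a x. h a (\<epsilon> (src a) x)))" for f h
  note sub = rep_subspace[OF P] rep_subspace[OF X] rep_subspace[OF Y]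
  have subQ: "fam.subspace ?Q" by (intro subspace_lin_maps sub)

  have RQ: "R f h \<Longrightarrow> h \<in> ?Q" for f h unfolding R_def by blast
  have R0: "R 0 0"
    unfolding R_def using fam.subspace_0[OF subQ] fam.subspace_0[OF D0.subspace_dom] D0.zero
    by (auto intro!: bexI[of _ 0] simp: hom_comp_def fun_eq_iff)
  have Radd: "R (f + f') (h + h')" if f: "R f h" "R f' h'" for f f' h h'
  proof -
    from f obtain g g' where "g \<in> vertex_maps (P 0) Y" "g' \<in> vertex_maps (P 0) Y"
      "f = g \<circ>\<^sub>R d 0" "f' = g' \<circ>\<^sub>R d 0" "h \<in> ?Q" "h' \<in> ?Q"
      "defect (P 0) Y g = (\<lambda>a x. h a (\<epsilon> (src a) x))" "defect (P 0) Y g' = (\<lambda>a x. h' a (\<epsilon> (src a) x))"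
      unfolding R_def by blast
    then show ?thesis
      unfolding R_def
      by (auto intro!: bexI[of _ "g + g'"] fam.subspace_add subQ D0.subspace_dom simp: D0.add)
        (auto simp: hom_comp_def fun_eq_iff)
  qed
  have Rscale: "R (fscale c f) (fscale c h)" if f: "R f h" for c f h
  proof -
    from f obtain g where "g \<in> vertex_maps (P 0) Y" "f = g \<circ>\<^sub>R d 0" "h \<in> ?Q"
      "defect (P 0) Y g = (\<lambda>a x. h a (\<epsilon> (src a) x))"
      unfolding R_def by blast
    then show ?thesis
      unfolding R_def
      by (auto intro!: bexI[of _ "fscale c g"] fam.subspace_scale subQ D0.subspace_dom simp: D0.scale)
        (auto simp: hom_comp_def fun_eq_iff fscale_def)
  qed
  \<comment> \<open>A cocycle vanishes on the image of \<open>d 1\<close>, which is the kernel of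
    \<open>d 0\<close>, so it factors as g after \<open>d 0\<close>. Since f is a morphism, the
    defect of g vanishes on the image of \<open>d 0\<close>, which is the kernel of \<epsilon>, and
    descends to X.\<close>
  have total: "\<exists>h. R f h" if f: "f \<in> ?Z" for f
  proof -
    have f1: "f \<in> Hom (P 1) Y" "\<And>v x. f v (d 1 v x) = 0"
      using f by (auto simp: cocycles1_def hom_comp_def fun_eq_iff)
    obtain g where g: "g \<in> vertex_maps (P 0) Y" "\<And>v x. g v (d 0 v x) = f v x"
    proof (rule lin_maps_factor[OF sub(1) sub(1) sub(3) dv[of 0, folded One_nat_def] Hom_vertex_maps[OF f1(1)]])
      fix v x assume "x \<in> space (P 1) v" "d 0 v x = 0"
      then have "x \<in> d 1 v ` space (P 2) v" using ex1[of v] by simp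
      then show "f v x = 0" using f1(2) by auto
    qed (rule that)
    have fg: "f = g \<circ>\<^sub>R d 0" using g(2) by (simp add: hom_comp_def fun_eq_iff)
    have "defect (P 1) Y f = 0" using f1(1) by (simp add: Hom_iff)
    then have gd: "defect (P 0) Y g a (d 0 (src a) x) = 0" for a x
      using defect_comp[OF P Y d[of 0] g(1)] unfolding fg by (simp add: fun_eq_iff)
    obtain h where h: "h \<in> ?Q" "\<And>a x. h a (\<epsilon> (src a) x) = defect (P 0) Y g a x"
    proof (rule lin_maps_factor[of "\<lambda>a. space (P 0) (src a)" "\<lambda>a. space X (src a)" "\<lambda>a. space Y (tgt a)"
            "\<lambda>a. \<epsilon> (src a)" "defect (P 0) Y g"])
      show "(\<lambda>a. \<epsilon> (src a)) \<in> lin_maps (\<lambda>a. space (P 0) (src a)) (\<lambda>a. space X (src a))"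
        using ev by (simp add: lin_maps_def)
      show "defect (P 0) Y g \<in> arrow_maps (P 0) Y"
        by (rule defect_in_arrow_maps[OF P Y g(1)])
      fix a x assume "x \<in> space (P 0) (src a)" "\<epsilon> (src a) x = 0"
      then have "x \<in> d 0 (src a) ` space (P 1) (src a)" using ex0 by simp
      then show "defect (P 0) Y g a x = 0" using gd by auto
    qed (use sub in auto)
    then show ?thesis unfolding R_def using g(1) fg by (intro exI[of _ h]) auto
  qed
  \<comment> \<open>Pulled back along \<epsilon>, h is the defect of some g because
    \<open>P 0\<close> is unobstructed. As \<epsilon> kills the image of \<open>d 0\<close>, g after
    \<open>d 0\<close> is a morphism.\<close>
  have surj: "\<exists>f\<in>?Z. R f h" if h: "h \<in> ?Q" for h
  proof -
    obtain g where g: "g \<in> vertex_maps (P 0) Y" "defect (P 0) Y g = (\<lambda>a x. h a (\<epsilon> (src a) x))"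
      using unobstructedD[OF free Y arrow_maps_comp[OF X ev h]] by blast
    have "g \<circ>\<^sub>R d 0 \<in> vertex_maps (P 1) Y"
      using vertex_maps_comp[OF P dv[of 0] g(1)] by simp
    moreover have "defect (P 1) Y (g \<circ>\<^sub>R d 0) = 0"
      using defect_comp[OF P Y d[of 0] g(1)] g(2) ed lin_maps_zero[OF h] sub
      by (simp add: fun_eq_iff)
    moreover have "(g \<circ>\<^sub>R d 0) \<circ>\<^sub>R d 1 = 0"
    proof -
      have "g v (d 0 v (d 1 v x)) = 0" for v x
        unfolding dd by (rule lin_maps_zero[OF g(1) sub(1)])
      then show ?thesis by (simp add: hom_comp_def fun_eq_iff)
    qed
    ultimately show ?thesis using g h by (auto simp: R_def cocycles1_def Hom_iff)
  qed
  \<comment> \<open>If f is also g' after \<open>d 0\<close> with a morphism g', then g - g' kills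
    the kernel of \<epsilon> and comes from some u on X with defect h. Conversely, subtracting u
    after \<epsilon> turns g into a morphism with the same composite f.\<close>
  have R_iff: "f \<in> ?B \<longleftrightarrow> h \<in> ?I" if R: "R f h" for f h
  proof -
    from R obtain g where g: "g \<in> vertex_maps (P 0) Y" "f = g \<circ>\<^sub>R d 0"
      "defect (P 0) Y g = (\<lambda>a x. h a (\<epsilon> (src a) x))" and h: "h \<in> ?Q"
      unfolding R_def by blast
    show ?thesis
    proof
      assume "f \<in> ?B"
      then obtain g' where g': "g' \<in> Hom (P 0) Y" "f = g' \<circ>\<^sub>R d 0" unfolding coboundaries1_def by blast
      note gg = fam.subspace_diff[OF D0.subspace_dom g(1) Hom_vertex_maps[OF g'(1)]]
      obtain u where u: "u \<in> vertex_maps X Y" "\<And>v x. u v (\<epsilon> v x) = (g - g') v x"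
      proof (rule lin_maps_factor[OF sub(1) sub(2) sub(3) ev gg])
        fix v x assume "x \<in> space (P 0) v" "\<epsilon> v x = 0"
        then obtain y where "x = d 0 v y" using ex0[of v] by blast
        moreover have "(g \<circ>\<^sub>R d 0) v y = (g' \<circ>\<^sub>R d 0) v y" using g(2) g'(2) by simp
        ultimately show "(g - g') v x = 0" by (simp add: hom_comp_def)
      qed (rule that)
      have "u \<circ>\<^sub>R \<epsilon> = g - g'" using u(2) by (simp add: hom_comp_def fun_eq_iff)
      moreover have "defect (P 0) Y (g - g') = defect (P 0) Y g"
        using D0.diff[OF g(1) Hom_vertex_maps[OF g'(1)]] g'(1) by (simp add: Hom_iff)
      ultimately have uh: "defect X Y u a (\<epsilon> (src a) x) = h a (\<epsilon> (src a) x)" for a x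
        using defect_comp[OF X Y \<epsilon>(1) u(1)] g(3) by metis
      have "defect X Y u a x = h a x" for a x
      proof (cases "x \<in> space X (src a)")
        case True
        then show ?thesis using uh \<epsilon>(2)[of "src a"] by (metis imageE)
      next
        case False
        then show ?thesis using lin_maps_outside[OF h, of x a] by (simp add: defect_def)
      qed
      then have "h = defect X Y u" by (simp add: fun_eq_iff)
      then show "h \<in> ?I" using u(1) by blast
    next
      assume "h \<in> ?I"
      then obtain u where u: "u \<in> vertex_maps X Y" "h = defect X Y u" by blast
      note ue = vertex_maps_comp[OF X ev u(1)]
      have "defect (P 0) Y (g - (u \<circ>\<^sub>R \<epsilon>)) = 0"
        using D0.diff[OF g(1) ue] defect_comp[OF X Y \<epsilon>(1) u(1)] g(3) u(2) by simp
      then have "g - (u \<circ>\<^sub>R \<epsilon>) \<in> Hom (P 0) Y"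
        using fam.subspace_diff[OF D0.subspace_dom g(1) ue] by (simp add: Hom_iff)
      moreover have "f = (g - (u \<circ>\<^sub>R \<epsilon>)) \<circ>\<^sub>R d 0"
      proof -
        have "u v (\<epsilon> v (d 0 v x)) = 0" for v x
          unfolding ed by (rule lin_maps_zero[OF u(1) sub(2)])
        then show ?thesis using g(2) by (simp add: hom_comp_def fun_eq_iff)
      qed
      ultimately show "f \<in> ?B" unfolding coboundaries1_def by blast
    qed
  qed

  have I: "fam.subspace ?I" "?I \<subseteq> ?Q"
    using D.subspace_image defect_in_arrow_maps[OF X Y] by auto
  \<comment> \<open>A basis of the cokernel is carried to the cohomology first, only to show that
    the set picked by \<open>SOME\<close> in \<open>quot_dim\<close> really is a basis.\<close>
  obtain T where T: "fam.basis_family_mod ?Q ?I T id"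
    using fam.basis_family_mod_exists[OF subQ I(2,1) fin] .
  obtain t where t: "\<And>h. h \<in> T \<Longrightarrow> t h \<in> ?Z \<and> R (t h) h"
  proof -
    have "\<forall>h\<in>T. \<exists>f. f \<in> ?Z \<and> R f h" using surj T unfolding fam.basis_family_mod_def by (simp add: subset_iff) blast
    then show ?thesis using that by metis
  qed
  have "fam.basis_family_mod ?Z ?B T t"
  proof (rule basis_family_mod_transfer[where R = "\<lambda>h f. R f h", OF R0 Radd Rscale _ _ T])
    show "\<exists>h\<in>?Q. R f h" if "f \<in> ?Z" for f using total[OF that] RQ by blast
    show "h \<in> ?I \<longleftrightarrow> f \<in> ?B" if "R f h" for f h using R_iff[OF that] by simp
    show "R (t h) (id h) \<and> t h \<in> ?Z" if "h \<in> T" for h using t[OF that] by simp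
  qed
  moreover have "0 \<in> ?B"
    using R_iff[OF R0] fam.subspace_0[OF I(1)] by blast
  ultimately have "basis_mod ?Z ?B (t ` T)"
    unfolding basis_mod_iff by (rule fam.basis_family_mod_image)
  then have "basis_mod ?Z ?B (SOME S. basis_mod ?Z ?B S)" by (rule someI)
  then obtain S where S: "fam.basis_family_mod ?Z ?B S id" "quot_dim ?Z ?B = card S"
    unfolding basis_mod_iff quot_dim_def by blast
  obtain u where u: "\<And>s. s \<in> S \<Longrightarrow> R s (u s)"
  proof -
    have "\<forall>s\<in>S. \<exists>h. R s h" using total S(1) unfolding fam.basis_family_mod_def by (simp add: subset_iff)
    then show ?thesis using that by metis
  qed
  \<comment> \<open>The picked basis is carried back to the cokernel, where \<open>dim_mod\<close>
    counts it.\<close>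
  have "fam.basis_family_mod ?Q ?I S u"
  proof (rule basis_family_mod_transfer[where R = R, OF R0 Radd Rscale surj R_iff S(1)])
    show "R (id s) (u s) \<and> u s \<in> ?Q" if "s \<in> S" for s using u[OF that] RQ by simp
  qed
  from fam.dim_mod[OF subQ I(2,1) fin this] S(2) show ?thesis by simp
qed

text \<open>Existence of a resolution ensures that the \<open>SOME\<close> in \<open>hom1\<close>
  picks a genuine one.\<close>

lemma hom1_projective_resolution:
  assumes "is_rep X"
  obtains P d \<epsilon> where "projective_resolution X P d \<epsilon>"
    "hom1 X Y = quot_dim (cocycles1 P d Y) (coboundaries1 P d Y)"
proof -
  let ?r = "SOME (P, d, \<epsilon>). projective_resolution X P d \<epsilon>"
  have "\<exists>r. case r of (P, d, \<epsilon>) \<Rightarrow> projective_resolution X P d \<epsilon>"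
    using projective_resolution_exists[OF assms] by auto
  then have "case ?r of (P, d, \<epsilon>) \<Rightarrow> projective_resolution X P d \<epsilon>"
    by (rule someI_ex)
  then show ?thesis
    using that by (cases ?r) (auto simp: hom1_def)
qed

text \<open>The rank of \<open>defect\<close> complements hom in the vertex families and Ext^1 in
  the arrow families, and cancels. The first parenthesis sums over arrows, the second over vertices;
  having sums on both sides avoids truncated subtraction.\<close>

lemma euler_form:
  fixes p q :: "vertex \<Rightarrow> nat"
  assumes X: "is_rep X" and Y: "is_rep Y"
    and pX: "\<And>v. space X v = kpow (p v)" and qY: "\<And>v. space Y v = kpow (q v)"
  shows "hom0 X Y + (p Vb * q Ve + p Vb * q Vmid + p Vmid * q Ve) =
    hom1 X Y + (p Vb * q Vb + p Vmid * q Vmid + p Ve * q Ve)"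
proof -
  have vertices: "(UNIV :: vertex set) = {Vb, Vmid, Ve}"
    using vertex.exhaust by blast
  have arrows: "(UNIV :: arrow set) = {Arr_be, Arr_bmid, Arr_mide}"
    using arrow.exhaust by blast
  have V: "vertex_maps X Y = lin_maps (\<lambda>v. kpow (p v)) (\<lambda>v. kpow (q v))"
    and A: "arrow_maps X Y = lin_maps (\<lambda>a. kpow (p (src a))) (\<lambda>a. kpow (q (tgt a)))"
  proof -
    have "space X = (\<lambda>v. kpow (p v))" "space Y = (\<lambda>v. kpow (q v))"
      by (intro ext pX qY)+
    then show "vertex_maps X Y = lin_maps (\<lambda>v. kpow (p v)) (\<lambda>v. kpow (q v))"
      "arrow_maps X Y = lin_maps (\<lambda>a. kpow (p (src a))) (\<lambda>a. kpow (q (tgt a)))"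
      by simp_all
  qed
  have finV: "finite (UNIV :: vertex set)" and finA: "finite (UNIV :: arrow set)"
    unfolding vertices arrows by simp_all
  obtain F where F: "finite F" "vertex_maps X Y \<subseteq> fam.span F"
    using finite_span_lin_maps_kpow[OF finV, of p q] unfolding V by metis
  obtain G where G: "finite G" "arrow_maps X Y \<subseteq> fam.span G"
    using finite_span_lin_maps_kpow[OF finA, of "\<lambda>a. p (src a)" "\<lambda>a. q (tgt a)"] unfolding A by metis
  obtain P d \<epsilon> where "projective_resolution X P d \<epsilon>"
    "hom1 X Y = quot_dim (cocycles1 P d Y) (coboundaries1 P d Y)"
    using hom1_projective_resolution[OF X] .
  then have "fam.dim (arrow_maps X Y) = fam.dim (defect X Y ` vertex_maps X Y) + hom1 X Y"
    using quot_dim_cocycles[OF X Y _ G] by simp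
  moreover have "fam.dim (vertex_maps X Y) = hom0 X Y + fam.dim (defect X Y ` vertex_maps X Y)"
  proof -
    interpret D: linear_on_subspace fscale fscale "vertex_maps X Y" "defect X Y"
      by (rule defect_linear[OF X Y])
    show ?thesis
      using D.rank_nullity[OF F] by (simp add: hom0_def Hom_eq_kernel hscale_eq_fscale)
  qed
  moreover have "fam.dim (vertex_maps X Y) = p Vb * q Vb + p Vmid * q Vmid + p Ve * q Ve"
    unfolding V dim_lin_maps_kpow[OF finV] unfolding vertices by simp
  moreover have "fam.dim (arrow_maps X Y) = p Vb * q Ve + p Vb * q Vmid + p Vmid * q Ve"
    unfolding A dim_lin_maps_kpow[OF finA] unfolding arrows by simp
  ultimately show ?thesis by simp
qed

section \<open>Morphisms between exceptional representations\<close>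

text \<open>The N selected entries form a linear map \<Phi> from Hom to k^N, and \<open>sep\<close>
  makes its kernel trivial.\<close>

lemma hom0_le:
  fixes p q :: "vertex \<Rightarrow> nat"
  assumes X: "is_rep X" and Y: "is_rep Y"
    and pX: "\<And>v. space X v = kpow (p v)" and qY: "\<And>v. space Y v = kpow (q v)"
    and sep: "\<And>f. f \<in> Hom X Y \<Longrightarrow> (\<And>i. i < N \<Longrightarrow> case pos i of (v, r, c) \<Rightarrow> f v (unit_vec c) r = 0)
      \<Longrightarrow> \<forall>v. \<forall>c<p v. \<forall>r<q v. f v (unit_vec c) r = 0"
  shows "hom0 X Y \<le> N"
proof -
  define \<Phi> :: "'a rep_hom \<Rightarrow> nat \<Rightarrow> 'a" where
    "\<Phi> f = (\<lambda>i. if i < N then case pos i of (v, r, c) \<Rightarrow> f v (unit_vec c) r else 0)" for f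
  interpret D: linear_on_subspace fscale fscale "vertex_maps X Y" "defect X Y"
    by (rule defect_linear[OF X Y])
  interpret L: linear_on_subspace fscale vscale "Hom X Y" \<Phi>
    using D.subspace_kernel
    by unfold_locales (auto simp: Hom_eq_kernel \<Phi>_def fscale_def vscale_def fun_eq_iff split: prod.split)
  have "space X = (\<lambda>v. kpow (p v))" "space Y = (\<lambda>v. kpow (q v))"
    by (intro ext pX qY)+
  moreover have "finite (UNIV :: vertex set)"
    using vertex.exhaust by (intro finite_subset[of UNIV "{Vb, Vmid, Ve}"]) auto
  ultimately obtain F where F: "finite F" "vertex_maps X Y \<subseteq> fam.span F"
    using finite_span_lin_maps_kpow[of p q] by metis
  have "{f \<in> Hom X Y. \<Phi> f = 0} \<subseteq> {0}"
  proof clarify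
    fix f assume f: "f \<in> Hom X Y" "\<Phi> f = 0"
    have "case pos i of (v, r, c) \<Rightarrow> f v (unit_vec c) r = 0" if "i < N" for i
      using fun_cong[OF f(2), of i] that by (simp add: \<Phi>_def split: prod.splits)
    then have 0: "\<forall>v. \<forall>c<p v. \<forall>r<q v. f v (unit_vec c) r = 0"
      using sep[OF f(1)] by blast
    have "f v x r = 0" for v x r
    proof (cases "x \<in> space X v")
      case True
      have "f v (unit_vec c) r = 0" if "c < p v" for c
      proof (cases "r < q v")
        case False
        then show ?thesis
          using lin_maps_in[OF Hom_vertex_maps[OF f(1)] rep_subspace[OF Y], of v "unit_vec c"] qY
          by (simp add: kpow_def)
      qed (use 0 that in simp)
      then show ?thesis
        using linear_map_kpow_expand[of "p v" _ "f v" x r] lin_maps_linear[OF Hom_vertex_maps[OF f(1)], of v]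
          True unfolding pX by simp
    next
      case False
      then show ?thesis using lin_maps_outside[OF Hom_vertex_maps[OF f(1)]] by simp
    qed
    then show "f = 0" by (simp add: fun_eq_iff)
  qed
  then have "fam.dim {f \<in> Hom X Y. \<Phi> f = 0} = 0"
    using fam.dim_le_card[of _ "{}"] by simp
  moreover have "\<Phi> ` Hom X Y \<subseteq> vec.span (unit_vec ` {..<N})"
  proof clarify
    fix f
    have "\<Phi> f \<in> kpow N" by (simp add: \<Phi>_def kpow_def)
    from kpow_expand[OF this] show "\<Phi> f \<in> vec.span (unit_vec ` {..<N})"
      by (metis (no_types, lifting) imageI vec.span_base vec.span_scale vec.span_sum)
  qed
  then have "vec.dim (\<Phi> ` Hom X Y) \<le> card (unit_vec ` {..<N} :: (nat \<Rightarrow> 'a) set)"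
    by (rule vec.dim_le_card) simp
  then have "vec.dim (\<Phi> ` Hom X Y) \<le> N"
    by (rule order_trans[OF _ order_trans[OF card_image_le]]) simp_all
  moreover have "fam.dim (Hom X Y) = fam.dim {f \<in> Hom X Y. \<Phi> f = 0} + vec.dim (\<Phi> ` Hom X Y)"
    using F Hom_vertex_maps[of _ X Y] by (intro L.rank_nullity[of F]) auto
  ultimately show ?thesis by (simp add: hom0_def hscale_eq_fscale)
qed

text \<open>Since \<open>hom - hom\<^sup>1 = N - e\<close> by the Euler form and one of \<open>N\<close>, \<open>e\<close> vanishes, an upper bound for \<open>hom\<close>
  is enough. The triple \<open>pos i = (v, r, c)\<close> designates the entry in row \<open>r\<close> and column \<open>c\<close> at \<open>v\<close>.\<close>

lemma bracket_eqI:
  assumes X: "is_rep X" and Y: "is_rep Y"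
    and mk: "X = mk_rep (p, q, r) F" "Y = mk_rep (p', q', r') G"
    and chi: "N + (p * r' + p * q' + q * r') = e + (p * p' + q * q' + r * r')"
    and alt: "N = 0 \<or> e = 0"
    and sep: "\<And>f. f \<in> Hom X Y \<Longrightarrow> (\<And>i. i < N \<Longrightarrow> case pos i of (v, r, c) \<Rightarrow> f v (unit_vec c) r = 0) \<Longrightarrow>
      (\<forall>c<p. \<forall>i<p'. f Vb (unit_vec c) i = 0) \<and> (\<forall>c<q. \<forall>i<q'. f Vmid (unit_vec c) i = 0) \<and>
      (\<forall>c<r. \<forall>i<r'. f Ve (unit_vec c) i = 0)"
  shows "\<lbrakk>X, Y\<rbrakk>\<^sub>R = (N, e)"
proof -
  let ?d = "\<lambda>a b c v. case v of Vb \<Rightarrow> a | Vmid \<Rightarrow> b | Ve \<Rightarrow> (c :: nat)"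
  have sp: "space X v = kpow (?d p q r v)" "space Y v = kpow (?d p' q' r' v)" for v
    unfolding mk by (cases F; cases G; cases v; simp add: mk_rep_def)+
  have "hom0 X Y \<le> N"
  proof (rule hom0_le[OF X Y sp])
    fix f assume "f \<in> Hom X Y" "\<And>i. i < N \<Longrightarrow> case pos i of (v, r, c) \<Rightarrow> f v (unit_vec c) r = 0"
    from sep[OF this] show "\<forall>v. \<forall>c<?d p q r v. \<forall>i<?d p' q' r' v. f v (unit_vec c) i = 0"
      by (simp split: vertex.split)
  qed
  moreover have "hom0 X Y + (p * r' + p * q' + q * r') = hom1 X Y + (p * p' + q * q' + r * r')"
    using euler_form[OF X Y sp] by simp
  \<comment> \<open>If N = 0, the bound gives hom = 0 and the Euler form gives Ext^1. If e = 0, the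
    Euler form gives hom \<ge> N, which meets the bound.\<close>
  ultimately show ?thesis using chi alt by (auto simp: bracket_def)
qed

lemma
  assumes f: "f \<in> Hom X Y"
    and X: "X = mk_rep (p, q, r) (F1, F2, F3)" and Y: "Y = mk_rep (p', q', r') (G1, G2, G3)"
  shows Hom_zero: "f v 0 = 0"
    and Hom_be: "c < p \<Longrightarrow> f Ve (F1 (unit_vec c)) i = G1 (f Vb (unit_vec c)) i"
    and Hom_bmid: "c < p \<Longrightarrow> f Vmid (F2 (unit_vec c)) i = G2 (f Vb (unit_vec c)) i"
    and Hom_mide: "c < q \<Longrightarrow> f Ve (F3 (unit_vec c)) i = G3 (f Vmid (unit_vec c)) i"
proof -
  have "space X v = kpow (case v of Vb \<Rightarrow> p | Vmid \<Rightarrow> q | Ve \<Rightarrow> r)"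
    unfolding X by (cases v) (simp_all add: mk_rep_def)
  then show "f v 0 = 0"
    using lin_maps_zero[OF Hom_vertex_maps[OF f]] by (simp add: subspace_kpow)
qed (use Hom_action[OF f, of _ Arr_be] Hom_action[OF f, of _ Arr_bmid] Hom_action[OF f, of _ Arr_mide]
  in \<open>auto simp: X Y mk_rep_def\<close>)

text \<open>In the source these maps act on columns, and \<open>structure_map_apply\<close>
  describes them on rows in the target. Together they turn each commuting square into relations
  between matrix entries.\<close>

lemma structure_map_unit_vec:
  "pi_plus m (unit_vec c) = (if c < m then unit_vec c else 0)"
  "pi_minus m (unit_vec 0) = 0"
  "pi_minus m (unit_vec (Suc c)) = (if c < m then unit_vec c else 0)"
  "j_plus m (unit_vec c) = (if c < m then unit_vec c else 0)"
  "j_minus m (unit_vec c) = (if c < m then unit_vec (Suc c) else 0)"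
  by (auto simp: fun_eq_iff pi_plus_def pi_minus_def j_plus_def j_minus_def unit_vec_def)

lemma structure_map_apply:
  "pi_plus m x i = (if i < m then x i else 0)"
  "pi_minus m x i = (if i < m then x (Suc i) else 0)"
  "j_plus m x i = (if i < m then x i else 0)"
  "j_minus m x 0 = 0"
  "j_minus m x (Suc i) = (if i < m then x i else 0)"
  by (auto simp: pi_plus_def pi_minus_def j_plus_def j_minus_def)

lemmas structure_map_simps = structure_map_unit_vec structure_map_apply

section \<open>Vanishing of matrices constant along diagonals or antidiagonals\<close>

text \<open>A diagonal below the main one starts at a zero of the first column. One starting at
  column c of the top row meets the last column in row m - c, where the entry is known to vanish if
  m - c < n. The other columns are those with c < m + 1 - n, which \<open>top\<close> covers; there
  are none if m < n.\<close>

lemma toeplitz_zero: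
  fixes A :: "nat \<Rightarrow> nat \<Rightarrow> 'a::zero"
  assumes shift: "\<And>i c. i < n \<Longrightarrow> c < m \<Longrightarrow> A (Suc i) (Suc c) = A i c"
    and first: "\<And>i. i < n \<Longrightarrow> A (Suc i) 0 = 0"
    and last: "\<And>i. i < n \<Longrightarrow> A i m = 0"
    and top: "\<And>d. d < m + 1 - n \<Longrightarrow> A 0 d = 0"
    and "i \<le> n" "c \<le> m"
  shows "A i c = 0"
  using \<open>i \<le> n\<close> \<open>c \<le> m\<close>
proof (induction i arbitrary: c)
  case 0
  show ?case
  proof (cases "c < m + 1 - n")
    case False
    have "A j (c + j) = A 0 c" if "j \<le> m - c" for j
      using that False 0 by (induction j) (auto simp: shift)
    from this[of "m - c"] show ?thesis using last[of "m - c"] False 0 by simp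
  qed (rule top)
next
  case (Suc i)
  then show ?case by (cases c) (auto simp: first shift)
qed

text \<open>Going up and to the right, every antidiagonal ends in the top row or in the last
  column.\<close>

lemma antidiagonal_zero:
  fixes A :: "nat \<Rightarrow> nat \<Rightarrow> 'a::zero"
  assumes shift: "\<And>i c. Suc i < n \<Longrightarrow> c < m \<Longrightarrow> A (Suc i) c = A i (Suc c)"
    and top: "\<And>c. 0 < n \<Longrightarrow> c < m \<Longrightarrow> A 0 c = 0"
    and last: "\<And>i. i < n \<Longrightarrow> A i m = 0"
    and "i < n" "c \<le> m"
  shows "A i c = 0"
  using \<open>i < n\<close> \<open>c \<le> m\<close>
  by (induction i arbitrary: c) (metis last le_eq_less_or_eq top, metis Suc_lessD Suc_leI last le_eq_less_or_eq shift)

text \<open>A and C are overlapping parts of one Hankel matrix, with n + 1 rows and m columns,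
  respectively n rows and m + 1 columns. Going down and to the left, an antidiagonal ends in the
  first column of C or the bottom row of A, which are n + m entries in all.\<close>

lemma
  fixes A C :: "nat \<Rightarrow> nat \<Rightarrow> 'a::zero"
  assumes shift: "\<And>i c. i < n \<Longrightarrow> c < m \<Longrightarrow> C i (Suc c) = A (Suc i) c"
    and eq: "\<And>i c. i < n \<Longrightarrow> c < m \<Longrightarrow> A i c = C i c"
    and first: "\<And>i. i < n \<Longrightarrow> C i 0 = 0"
    and bottom: "\<And>c. c < m \<Longrightarrow> A n c = 0"
  shows hankel_zero: "i < n \<Longrightarrow> c \<le> m \<Longrightarrow> C i c = 0"
    and hankel_zero': "i \<le> n \<Longrightarrow> c < m \<Longrightarrow> A i c = 0"
proof -
  have C: "C i c = 0" if "i < n" "c \<le> m" for i c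
    using that
  proof (induction c arbitrary: i)
    case (Suc c)
    then show ?case by (cases "Suc i = n") (auto simp: shift bottom eq)
  qed (simp add: first)
  then show "i < n \<Longrightarrow> c \<le> m \<Longrightarrow> C i c = 0" .
  show "i \<le> n \<Longrightarrow> c < m \<Longrightarrow> A i c = 0"
    using C[of i c] by (cases "i = n") (auto simp: eq bottom)
qed

section \<open>Pairs with Toeplitz matrices\<close>

text \<open>The matrix at \<open>Vb\<close> is (n+1) x (m+1). The matrix at \<open>Ve\<close> is its
  upper left n x m block by the arrow from b, and its lower right one by the path through mid; the
  vectors killed by the projections give the zeros. The free diagonals start at columns 0 to m - n
  of the top row. Truncated subtraction covers both orders of m and n.\<close>

lemma bracket_E1_E1: "\<lbrakk>E1 k m, E1 k n\<rbrakk>\<^sub>R = (m + 1 - n, n - m - 1)"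
proof (rule bracket_eqI[OF is_rep_exceptional(1) is_rep_exceptional(1) E1_def E1_def,
      where pos = "\<lambda>d. (Vb, 0, d)"])
  fix f assume f: "f \<in> Hom (E1 k m) (E1 k n)"
    and z: "\<And>i. i < m + 1 - n \<Longrightarrow> case (\<lambda>d. (Vb, 0, d)) i of (v, r, c) \<Rightarrow> f v (unit_vec c) r = 0"
  note H = Hom_be[OF f E1_def E1_def] Hom_bmid[OF f E1_def E1_def] Hom_mide[OF f E1_def E1_def]
  note [simp] = Hom_zero[OF f E1_def E1_def] structure_map_simps
  have CA: "f Ve (unit_vec c) i = f Vb (unit_vec c) i" if "c < m" "i < n" for c i
    using H(1)[of c i] that by simp
  have BC: "f Vmid (unit_vec c) i = f Ve (unit_vec c) i" if "c < m" for c i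
    using H(3)[of c i] that by simp
  have A: "f Vb (unit_vec c) i = 0" if "i \<le> n" "c \<le> m" for i c
  proof (rule toeplitz_zero[of n m "\<lambda>i c. f Vb (unit_vec c) i"])
    show "f Vb (unit_vec (Suc c)) (Suc i) = f Vb (unit_vec c) i" if "i < n" "c < m" for i c
      using H(2)[of "Suc c" i] CA[of c i] BC[of c i] that by simp
    show "f Vb (unit_vec 0) (Suc i) = 0" if "i < n" for i using H(2)[of 0 i] that by simp
    show "f Vb (unit_vec m) i = 0" if "i < n" for i using H(1)[of m i] that by simp
  qed (use z that in auto)
  show "(\<forall>c<m + 1. \<forall>i<n + 1. f Vb (unit_vec c) i = 0) \<and>
      (\<forall>c<m. \<forall>i<n. f Vmid (unit_vec c) i = 0) \<and>
      (\<forall>c<m. \<forall>i<n. f Ve (unit_vec c) i = 0)"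
    using A BC CA by simp
\<comment> \<open>\<open>chi\<close> and \<open>alt\<close> remain. Writing the larger of m and n as
  the smaller plus a difference removes the truncated subtractions.\<close>
qed (cases "n \<le> m"; auto simp: algebra_simps not_le dest!: le_Suc_ex less_imp_Suc_add)+

lemma bracket_E4_E4: "\<lbrakk>E4 k m, E4 k n\<rbrakk>\<^sub>R = (m + 1 - n, n - m - 1)"
proof (rule bracket_eqI[OF is_rep_exceptional(4) is_rep_exceptional(4) E4_def E4_def,
      where pos = "\<lambda>d. (Vb, 0, d)"])
  fix f assume f: "f \<in> Hom (E4 k m) (E4 k n)"
    and z: "\<And>i. i < m + 1 - n \<Longrightarrow> case (\<lambda>d. (Vb, 0, d)) i of (v, r, c) \<Rightarrow> f v (unit_vec c) r = 0"
  note H = Hom_be[OF f E4_def E4_def] Hom_bmid[OF f E4_def E4_def] Hom_mide[OF f E4_def E4_def]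
  note [simp] = Hom_zero[OF f E4_def E4_def] structure_map_simps
  have CA: "f Ve (unit_vec c) i = f Vb (unit_vec c) i" if "c < m" "i < n" for c i
    using H(1)[of c i] that by simp
  have BA: "f Vmid (unit_vec c) i = f Vb (unit_vec c) i" if "c \<le> m" for c i
    using H(2)[of c i] that by simp
  have A: "f Vb (unit_vec c) i = 0" if "i \<le> n" "c \<le> m" for i c
  proof (rule toeplitz_zero[of n m "\<lambda>i c. f Vb (unit_vec c) i"])
    show "f Vb (unit_vec (Suc c)) (Suc i) = f Vb (unit_vec c) i" if "i < n" "c < m" for i c
      using H(3)[of "Suc c" i] CA[of c i] BA[of "Suc c" "Suc i"] that by simp
    show "f Vb (unit_vec 0) (Suc i) = 0" if "i < n" for i using H(3)[of 0 i] BA[of 0 "Suc i"] that by simp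
    show "f Vb (unit_vec m) i = 0" if "i < n" for i using H(1)[of m i] that by simp
  qed (use z that in auto)
  show "(\<forall>c<m + 1. \<forall>i<n + 1. f Vb (unit_vec c) i = 0) \<and>
      (\<forall>c<m + 1. \<forall>i<n + 1. f Vmid (unit_vec c) i = 0) \<and>
      (\<forall>c<m. \<forall>i<n. f Ve (unit_vec c) i = 0)"
    using A BA CA by simp
qed (cases "n \<le> m"; auto simp: algebra_simps not_le dest!: le_Suc_ex less_imp_Suc_add)+

text \<open>The diagonal shift is split between two arrows: b to mid moves by a row, mid to e by a
  column.\<close>

lemma bracket_E4_E1: "\<lbrakk>E4 k m, E1 k n\<rbrakk>\<^sub>R = (m + 1 - n, n - m - 1)"
proof (rule bracket_eqI[OF is_rep_exceptional(4) is_rep_exceptional(1) E4_def E1_def,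
      where pos = "\<lambda>d. (Vb, 0, d)"])
  fix f assume f: "f \<in> Hom (E4 k m) (E1 k n)"
    and z: "\<And>i. i < m + 1 - n \<Longrightarrow> case (\<lambda>d. (Vb, 0, d)) i of (v, r, c) \<Rightarrow> f v (unit_vec c) r = 0"
  note H = Hom_be[OF f E4_def E1_def] Hom_bmid[OF f E4_def E1_def] Hom_mide[OF f E4_def E1_def]
  note [simp] = Hom_zero[OF f E4_def E1_def] structure_map_simps
  have CA: "f Ve (unit_vec c) i = f Vb (unit_vec c) i" if "c < m" "i < n" for c i
    using H(1)[of c i] that by simp
  have BA: "f Vmid (unit_vec c) i = f Vb (unit_vec c) (Suc i)" if "c \<le> m" "i < n" for c i
    using H(2)[of c i] that by simp
  have A: "f Vb (unit_vec c) i = 0" if "i \<le> n" "c \<le> m" for i c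
  proof (rule toeplitz_zero[of n m "\<lambda>i c. f Vb (unit_vec c) i"])
    show "f Vb (unit_vec (Suc c)) (Suc i) = f Vb (unit_vec c) i" if "i < n" "c < m" for i c
      using H(3)[of "Suc c" i] CA[of c i] BA[of "Suc c" i] that by simp
    show "f Vb (unit_vec 0) (Suc i) = 0" if "i < n" for i using H(3)[of 0 i] BA[of 0 i] that by simp
    show "f Vb (unit_vec m) i = 0" if "i < n" for i using H(1)[of m i] that by simp
  qed (use z that in auto)
  show "(\<forall>c<m + 1. \<forall>i<n + 1. f Vb (unit_vec c) i = 0) \<and>
      (\<forall>c<m + 1. \<forall>i<n. f Vmid (unit_vec c) i = 0) \<and>
      (\<forall>c<m. \<forall>i<n. f Ve (unit_vec c) i = 0)"
    using A BA CA by simp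
qed (cases "n \<le> m"; auto simp: algebra_simps not_le dest!: le_Suc_ex less_imp_Suc_add)+

text \<open>Since b to mid is the identity in the target, the vector killed by
  \<open>pi_minus\<close> makes the whole first column at \<open>Vb\<close> vanish, corner included.
  This costs the main diagonal, hence the offset \<open>d + 1\<close>.\<close>

lemma bracket_E1_E4: "\<lbrakk>E1 k m, E4 k n\<rbrakk>\<^sub>R = (m - n, n - m)"
proof (rule bracket_eqI[OF is_rep_exceptional(1) is_rep_exceptional(4) E1_def E4_def,
      where pos = "\<lambda>d. (Vb, 0, d + 1)"])
  fix f assume f: "f \<in> Hom (E1 k m) (E4 k n)"
    and z: "\<And>i. i < m - n \<Longrightarrow> case (\<lambda>d. (Vb, 0, d + 1)) i of (v, r, c) \<Rightarrow> f v (unit_vec c) r = 0"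
  note H = Hom_be[OF f E1_def E4_def] Hom_bmid[OF f E1_def E4_def] Hom_mide[OF f E1_def E4_def]
  note [simp] = Hom_zero[OF f E1_def E4_def] structure_map_simps
  have CA: "f Ve (unit_vec c) i = f Vb (unit_vec c) i" if "c < m" "i < n" for c i
    using H(1)[of c i] that by simp
  have BC: "f Vmid (unit_vec c) (Suc i) = f Ve (unit_vec c) i" if "c < m" "i < n" for c i
    using H(3)[of c i] that by simp
  have AB: "f Vb (unit_vec (Suc c)) i = f Vmid (unit_vec c) i" if "c < m" for c i
    using H(2)[of "Suc c" i] that by simp
  have first: "f Vb (unit_vec 0) i = 0" for i using H(2)[of 0 i] by simp
  have A: "f Vb (unit_vec c) i = 0" if "i \<le> n" "c \<le> m" for i c
  proof (rule toeplitz_zero[of n m "\<lambda>i c. f Vb (unit_vec c) i"])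
    show "f Vb (unit_vec (Suc c)) (Suc i) = f Vb (unit_vec c) i" if "i < n" "c < m" for i c
      using AB[of c "Suc i"] CA[of c i] BC[of c i] that by simp
    show "f Vb (unit_vec 0) (Suc i) = 0" if "i < n" for i using first by simp
    show "f Vb (unit_vec m) i = 0" if "i < n" for i using H(1)[of m i] that by simp
    show "f Vb (unit_vec d) 0 = 0" if "d < m + 1 - n" for d
      using that z[of "d - 1"] first[of 0] by (cases d) auto
  qed (use that in auto)
  show "(\<forall>c<m + 1. \<forall>i<n + 1. f Vb (unit_vec c) i = 0) \<and>
      (\<forall>c<m. \<forall>i<n + 1. f Vmid (unit_vec c) i = 0) \<and>
      (\<forall>c<m. \<forall>i<n. f Ve (unit_vec c) i = 0)"
    using A AB[symmetric] CA by simp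
qed (cases "n \<le> m"; auto simp: algebra_simps not_le dest!: le_Suc_ex less_imp_Suc_add)+

text \<open>With inclusions instead of projections the matrix at \<open>Ve\<close> is the one to
  study, and \<open>toeplitz_zero\<close> is applied to its transpose: the free diagonals start in
  the first column.\<close>

lemma bracket_E2_E2: "\<lbrakk>E2 k m, E2 k n\<rbrakk>\<^sub>R = (n + 1 - m, m - n - 1)"
proof (rule bracket_eqI[OF is_rep_exceptional(2) is_rep_exceptional(2) E2_def E2_def,
      where pos = "\<lambda>d. (Ve, d, 0)"])
  fix f assume f: "f \<in> Hom (E2 k m) (E2 k n)"
    and z: "\<And>i. i < n + 1 - m \<Longrightarrow> case (\<lambda>d. (Ve, d, 0)) i of (v, r, c) \<Rightarrow> f v (unit_vec c) r = 0"
  note H = Hom_be[OF f E2_def E2_def] Hom_bmid[OF f E2_def E2_def] Hom_mide[OF f E2_def E2_def]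
  note [simp] = Hom_zero[OF f E2_def E2_def] structure_map_simps
  have CA: "f Ve (unit_vec c) i = f Vb (unit_vec c) i" if "c < m" "i < n" for c i
    using H(1)[of c i] that by simp
  have BC: "f Vmid (unit_vec c) i = f Ve (unit_vec c) i" if "c \<le> m" for c i
    using H(3)[of c i] that by simp
  have C: "f Ve (unit_vec c) i = 0" if "i \<le> n" "c \<le> m" for i c
  proof (rule toeplitz_zero[of m n "\<lambda>c i. f Ve (unit_vec c) i"])
    show "f Ve (unit_vec (Suc c)) (Suc i) = f Ve (unit_vec c) i" if "c < m" "i < n" for i c
      using H(2)[of c "Suc i"] CA[of c i] BC[of "Suc c" "Suc i"] that by simp
    show "f Ve (unit_vec (Suc c)) 0 = 0" if "c < m" for c using H(2)[of c 0] BC[of "Suc c" 0] that by simp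
    show "f Ve (unit_vec c) n = 0" if "c < m" for c using H(1)[of c n] that by simp
  qed (use z that in auto)
  show "(\<forall>c<m. \<forall>i<n. f Vb (unit_vec c) i = 0) \<and>
      (\<forall>c<m + 1. \<forall>i<n + 1. f Vmid (unit_vec c) i = 0) \<and>
      (\<forall>c<m + 1. \<forall>i<n + 1. f Ve (unit_vec c) i = 0)"
    using C BC CA[symmetric] by simp
qed (cases "n \<le> m"; auto simp: algebra_simps not_le dest!: le_Suc_ex less_imp_Suc_add)+

lemma bracket_E3_E3: "\<lbrakk>E3 k m, E3 k n\<rbrakk>\<^sub>R = (n + 1 - m, m - n - 1)"
proof (rule bracket_eqI[OF is_rep_exceptional(3) is_rep_exceptional(3) E3_def E3_def,
      where pos = "\<lambda>d. (Ve, d, 0)"])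
  fix f assume f: "f \<in> Hom (E3 k m) (E3 k n)"
    and z: "\<And>i. i < n + 1 - m \<Longrightarrow> case (\<lambda>d. (Ve, d, 0)) i of (v, r, c) \<Rightarrow> f v (unit_vec c) r = 0"
  note H = Hom_be[OF f E3_def E3_def] Hom_bmid[OF f E3_def E3_def] Hom_mide[OF f E3_def E3_def]
  note [simp] = Hom_zero[OF f E3_def E3_def] structure_map_simps
  have CA: "f Ve (unit_vec c) i = f Vb (unit_vec c) i" if "c < m" "i < n" for c i
    using H(1)[of c i] that by simp
  have BA: "f Vmid (unit_vec c) i = f Vb (unit_vec c) i" if "c < m" for c i
    using H(2)[of c i] that by simp
  have C: "f Ve (unit_vec c) i = 0" if "i \<le> n" "c \<le> m" for i c
  proof (rule toeplitz_zero[of m n "\<lambda>c i. f Ve (unit_vec c) i"])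
    show "f Ve (unit_vec (Suc c)) (Suc i) = f Ve (unit_vec c) i" if "c < m" "i < n" for i c
      using H(3)[of c "Suc i"] CA[of c i] BA[of c i] that by simp
    show "f Ve (unit_vec (Suc c)) 0 = 0" if "c < m" for c using H(3)[of c 0] that by simp
    show "f Ve (unit_vec c) n = 0" if "c < m" for c using H(1)[of c n] that by simp
  qed (use z that in auto)
  show "(\<forall>c<m. \<forall>i<n. f Vb (unit_vec c) i = 0) \<and>
      (\<forall>c<m. \<forall>i<n. f Vmid (unit_vec c) i = 0) \<and>
      (\<forall>c<m + 1. \<forall>i<n + 1. f Ve (unit_vec c) i = 0)"
    using C BA CA[symmetric] by simp
qed (cases "n \<le> m"; auto simp: algebra_simps not_le dest!: le_Suc_ex less_imp_Suc_add)+

lemma bracket_E3_E2: "\<lbrakk>E3 k m, E2 k n\<rbrakk>\<^sub>R = (n + 1 - m, m - n - 1)"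
proof (rule bracket_eqI[OF is_rep_exceptional(3) is_rep_exceptional(2) E3_def E2_def,
      where pos = "\<lambda>d. (Ve, d, 0)"])
  fix f assume f: "f \<in> Hom (E3 k m) (E2 k n)"
    and z: "\<And>i. i < n + 1 - m \<Longrightarrow> case (\<lambda>d. (Ve, d, 0)) i of (v, r, c) \<Rightarrow> f v (unit_vec c) r = 0"
  note H = Hom_be[OF f E3_def E2_def] Hom_bmid[OF f E3_def E2_def] Hom_mide[OF f E3_def E2_def]
  note [simp] = Hom_zero[OF f E3_def E2_def] structure_map_simps
  have CA: "f Ve (unit_vec c) i = f Vb (unit_vec c) i" if "c < m" "i < n" for c i
    using H(1)[of c i] that by simp
  have CB: "f Ve (unit_vec (Suc c)) i = f Vmid (unit_vec c) i" if "c < m" for c i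
    using H(3)[of c i] that by simp
  have C: "f Ve (unit_vec c) i = 0" if "i \<le> n" "c \<le> m" for i c
  proof (rule toeplitz_zero[of m n "\<lambda>c i. f Ve (unit_vec c) i"])
    show "f Ve (unit_vec (Suc c)) (Suc i) = f Ve (unit_vec c) i" if "c < m" "i < n" for i c
      using H(2)[of c "Suc i"] CA[of c i] CB[of c "Suc i"] that by simp
    show "f Ve (unit_vec (Suc c)) 0 = 0" if "c < m" for c using H(2)[of c 0] CB[of c 0] that by simp
    show "f Ve (unit_vec c) n = 0" if "c < m" for c using H(1)[of c n] that by simp
  qed (use z that in auto)
  show "(\<forall>c<m. \<forall>i<n. f Vb (unit_vec c) i = 0) \<and>
      (\<forall>c<m. \<forall>i<n + 1. f Vmid (unit_vec c) i = 0) \<and>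
      (\<forall>c<m + 1. \<forall>i<n + 1. f Ve (unit_vec c) i = 0)"
    using C CB[symmetric] CA[symmetric] by simp
qed (cases "n \<le> m"; auto simp: algebra_simps not_le dest!: le_Suc_ex less_imp_Suc_add)+

text \<open>The image of \<open>j_minus\<close> has no coordinate 0, so the whole top row at
  \<open>Ve\<close> vanishes, corner included; hence the offset \<open>d + 1\<close>.\<close>

lemma bracket_E2_E3: "\<lbrakk>E2 k m, E3 k n\<rbrakk>\<^sub>R = (n - m, m - n)"
proof (rule bracket_eqI[OF is_rep_exceptional(2) is_rep_exceptional(3) E2_def E3_def,
      where pos = "\<lambda>d. (Ve, d + 1, 0)"])
  fix f assume f: "f \<in> Hom (E2 k m) (E3 k n)"
    and z: "\<And>i. i < n - m \<Longrightarrow> case (\<lambda>d. (Ve, d + 1, 0)) i of (v, r, c) \<Rightarrow> f v (unit_vec c) r = 0"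
  note H = Hom_be[OF f E2_def E3_def] Hom_bmid[OF f E2_def E3_def] Hom_mide[OF f E2_def E3_def]
  note [simp] = Hom_zero[OF f E2_def E3_def] structure_map_simps
  have CA: "f Ve (unit_vec c) i = f Vb (unit_vec c) i" if "c < m" "i < n" for c i
    using H(1)[of c i] that by simp
  have CB: "f Ve (unit_vec c) (Suc i) = f Vmid (unit_vec c) i" if "c \<le> m" "i < n" for c i
    using H(3)[of c "Suc i"] that by simp
  have BA: "f Vmid (unit_vec (Suc c)) i = f Vb (unit_vec c) i" if "c < m" for c i
    using H(2)[of c i] that by simp
  have top: "f Ve (unit_vec c) 0 = 0" if "c \<le> m" for c using H(3)[of c 0] that by simp
  have C: "f Ve (unit_vec c) i = 0" if "i \<le> n" "c \<le> m" for i c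
  proof (rule toeplitz_zero[of m n "\<lambda>c i. f Ve (unit_vec c) i"])
    show "f Ve (unit_vec (Suc c)) (Suc i) = f Ve (unit_vec c) i" if "c < m" "i < n" for i c
      using CB[of "Suc c" i] CA[of c i] BA[of c i] that by simp
    show "f Ve (unit_vec (Suc c)) 0 = 0" if "c < m" for c using top that by simp
    show "f Ve (unit_vec c) n = 0" if "c < m" for c using H(1)[of c n] that by simp
    show "f Ve (unit_vec 0) d = 0" if "d < n + 1 - m" for d
      using that z[of "d - 1"] top[of 0] by (cases d) auto
  qed (use that in auto)
  show "(\<forall>c<m. \<forall>i<n. f Vb (unit_vec c) i = 0) \<and>
      (\<forall>c<m + 1. \<forall>i<n. f Vmid (unit_vec c) i = 0) \<and>
      (\<forall>c<m + 1. \<forall>i<n + 1. f Ve (unit_vec c) i = 0)"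
    using C CB[symmetric] CA[symmetric] by simp
qed (cases "n \<le> m"; auto simp: algebra_simps not_le dest!: le_Suc_ex less_imp_Suc_add)+

section \<open>Pairs whose Hankel matrices are forced to vanish\<close>

text \<open>A projection in the source lowers the column index while an inclusion in the target
  raises the row index, so entries are constant along antidiagonals. The kernel of
  \<open>pi_plus\<close> gives the zero last column, and the coordinate missed by
  \<open>j_minus\<close> the zero top row.\<close>

lemma bracket_E1_E2: "\<lbrakk>E1 k m, E2 k n\<rbrakk>\<^sub>R = (0, n + m + 2)"
proof (rule bracket_eqI[OF is_rep_exceptional(1) is_rep_exceptional(2) E1_def E2_def,
      \<comment> \<open>A default value: with N = 0 no entry is selected.\<close>
      where pos = "\<lambda>d. (Vb, 0, 0)"])
  fix f assume f: "f \<in> Hom (E1 k m) (E2 k n)"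
  note H = Hom_be[OF f E1_def E2_def] Hom_bmid[OF f E1_def E2_def] Hom_mide[OF f E1_def E2_def]
  note [simp] = Hom_zero[OF f E1_def E2_def] structure_map_simps
  have CA: "f Ve (unit_vec c) i = (if i < n then f Vb (unit_vec c) i else 0)" if "c < m" for c i
    using H(1)[of c i] that by simp
  have BC: "f Vmid (unit_vec c) i = f Ve (unit_vec c) i" if "c < m" for c i
    using H(3)[of c i] that by simp
  have A: "f Vb (unit_vec c) i = 0" if "i < n" "c \<le> m" for i c
  proof (rule antidiagonal_zero[of n m "\<lambda>i c. f Vb (unit_vec c) i"])
    show "f Vb (unit_vec c) (Suc i) = f Vb (unit_vec (Suc c)) i" if "Suc i < n" "c < m" for i c
      using H(2)[of "Suc c" "Suc i"] CA[of c "Suc i"] BC[of c "Suc i"] that by simp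
    show "f Vb (unit_vec c) 0 = 0" if "0 < n" "c < m" for c
      using H(2)[of "Suc c" 0] CA[of c 0] BC[of c 0] that by simp
    show "f Vb (unit_vec m) i = 0" if "i < n" for i using H(1)[of m i] that by simp
  qed (use that in auto)
  show "(\<forall>c<m + 1. \<forall>i<n. f Vb (unit_vec c) i = 0) \<and>
      (\<forall>c<m. \<forall>i<n + 1. f Vmid (unit_vec c) i = 0) \<and>
      (\<forall>c<m. \<forall>i<n + 1. f Ve (unit_vec c) i = 0)"
    using A BC CA by simp
qed (cases "n \<le> m"; auto simp: algebra_simps not_le dest!: le_Suc_ex less_imp_Suc_add)+

lemma bracket_E1_E3: "\<lbrakk>E1 k m, E3 k n\<rbrakk>\<^sub>R = (0, n + m + 1)"
proof (rule bracket_eqI[OF is_rep_exceptional(1) is_rep_exceptional(3) E1_def E3_def,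
      where pos = "\<lambda>d. (Vb, 0, 0)"])
  fix f assume f: "f \<in> Hom (E1 k m) (E3 k n)"
  note H = Hom_be[OF f E1_def E3_def] Hom_bmid[OF f E1_def E3_def] Hom_mide[OF f E1_def E3_def]
  note [simp] = Hom_zero[OF f E1_def E3_def] structure_map_simps
  have CA: "f Ve (unit_vec c) i = (if i < n then f Vb (unit_vec c) i else 0)" if "c < m" for c i
    using H(1)[of c i] that by simp
  have AB: "f Vb (unit_vec (Suc c)) i = f Vmid (unit_vec c) i" if "c < m" for c i
    using H(2)[of "Suc c" i] that by simp
  have A: "f Vb (unit_vec c) i = 0" if "i < n" "c \<le> m" for i c
  proof (rule antidiagonal_zero[of n m "\<lambda>i c. f Vb (unit_vec c) i"])
    show "f Vb (unit_vec c) (Suc i) = f Vb (unit_vec (Suc c)) i" if "Suc i < n" "c < m" for i c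
      using H(3)[of c "Suc i"] CA[of c "Suc i"] AB[of c i] that by simp
    show "f Vb (unit_vec c) 0 = 0" if "0 < n" "c < m" for c
      using H(3)[of c 0] CA[of c 0] that by simp
    show "f Vb (unit_vec m) i = 0" if "i < n" for i using H(1)[of m i] that by simp
  qed (use that in auto)
  show "(\<forall>c<m + 1. \<forall>i<n. f Vb (unit_vec c) i = 0) \<and>
      (\<forall>c<m. \<forall>i<n. f Vmid (unit_vec c) i = 0) \<and>
      (\<forall>c<m. \<forall>i<n + 1. f Ve (unit_vec c) i = 0)"
    using A AB[symmetric] CA by simp
qed (cases "n \<le> m"; auto simp: algebra_simps not_le dest!: le_Suc_ex less_imp_Suc_add)+

lemma bracket_E4_E2: "\<lbrakk>E4 k m, E2 k n\<rbrakk>\<^sub>R = (0, n + m + 2)"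
proof (rule bracket_eqI[OF is_rep_exceptional(4) is_rep_exceptional(2) E4_def E2_def,
      where pos = "\<lambda>d. (Vb, 0, 0)"])
  fix f assume f: "f \<in> Hom (E4 k m) (E2 k n)"
  note H = Hom_be[OF f E4_def E2_def] Hom_bmid[OF f E4_def E2_def] Hom_mide[OF f E4_def E2_def]
  note [simp] = Hom_zero[OF f E4_def E2_def] structure_map_simps
  have CA: "f Ve (unit_vec c) i = (if i < n then f Vb (unit_vec c) i else 0)" if "c < m" for c i
    using H(1)[of c i] that by simp
  have CB: "f Vmid (unit_vec (Suc c)) i = f Ve (unit_vec c) i" if "c < m" for c i
    using H(3)[of "Suc c" i] that by simp
  have A: "f Vb (unit_vec c) i = 0" if "i < n" "c \<le> m" for i c
  proof (rule antidiagonal_zero[of n m "\<lambda>i c. f Vb (unit_vec c) i"])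
    show "f Vb (unit_vec c) (Suc i) = f Vb (unit_vec (Suc c)) i" if "Suc i < n" "c < m" for i c
      using H(2)[of "Suc c" "Suc i"] CA[of c "Suc i"] CB[of c "Suc i"] that by simp
    show "f Vb (unit_vec c) 0 = 0" if "0 < n" "c < m" for c
      using H(2)[of "Suc c" 0] CA[of c 0] CB[of c 0] that by simp
    show "f Vb (unit_vec m) i = 0" if "i < n" for i using H(1)[of m i] that by simp
  qed (use that in auto)
  \<comment> \<open>Row 0 at \<open>Vmid\<close> is missed by \<open>j_minus\<close>; the other rows
    are those at \<open>Vb\<close> moved down by one.\<close>
  have B: "f Vmid (unit_vec c) i = 0" if "c \<le> m" "i \<le> n" for c i
    using H(2)[of c i] A[of "i - 1" c] that by (cases i) auto
  show "(\<forall>c<m + 1. \<forall>i<n. f Vb (unit_vec c) i = 0) \<and>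
      (\<forall>c<m + 1. \<forall>i<n + 1. f Vmid (unit_vec c) i = 0) \<and>
      (\<forall>c<m. \<forall>i<n + 1. f Ve (unit_vec c) i = 0)"
    using A B CA by simp
qed (cases "n \<le> m"; auto simp: algebra_simps not_le dest!: le_Suc_ex less_imp_Suc_add)+

lemma bracket_E4_E3: "\<lbrakk>E4 k m, E3 k n\<rbrakk>\<^sub>R = (0, n + m + 2)"
proof (rule bracket_eqI[OF is_rep_exceptional(4) is_rep_exceptional(3) E4_def E3_def,
      where pos = "\<lambda>d. (Vb, 0, 0)"])
  fix f assume f: "f \<in> Hom (E4 k m) (E3 k n)"
  note H = Hom_be[OF f E4_def E3_def] Hom_bmid[OF f E4_def E3_def] Hom_mide[OF f E4_def E3_def]
  note [simp] = Hom_zero[OF f E4_def E3_def] structure_map_simps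
  have CA: "f Ve (unit_vec c) i = (if i < n then f Vb (unit_vec c) i else 0)" if "c < m" for c i
    using H(1)[of c i] that by simp
  have BA: "f Vmid (unit_vec c) i = f Vb (unit_vec c) i" if "c \<le> m" for c i
    using H(2)[of c i] that by simp
  have A: "f Vb (unit_vec c) i = 0" if "i < n" "c \<le> m" for i c
  proof (rule antidiagonal_zero[of n m "\<lambda>i c. f Vb (unit_vec c) i"])
    show "f Vb (unit_vec c) (Suc i) = f Vb (unit_vec (Suc c)) i" if "Suc i < n" "c < m" for i c
      using H(3)[of "Suc c" "Suc i"] CA[of c "Suc i"] BA[of "Suc c" i] that by simp
    show "f Vb (unit_vec c) 0 = 0" if "0 < n" "c < m" for c
      using H(3)[of "Suc c" 0] CA[of c 0] that by simp
    show "f Vb (unit_vec m) i = 0" if "i < n" for i using H(1)[of m i] that by simp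
  qed (use that in auto)
  show "(\<forall>c<m + 1. \<forall>i<n. f Vb (unit_vec c) i = 0) \<and>
      (\<forall>c<m + 1. \<forall>i<n. f Vmid (unit_vec c) i = 0) \<and>
      (\<forall>c<m. \<forall>i<n + 1. f Ve (unit_vec c) i = 0)"
    using A BA CA by simp
qed (cases "n \<le> m"; auto simp: algebra_simps not_le dest!: le_Suc_ex less_imp_Suc_add)+

section \<open>Pairs with free Hankel matrices\<close>

text \<open>Inclusions in the source and projections in the target force no zeros, so every
  antidiagonal is free. \<open>pos\<close> lists the n entries of the first column at
  \<open>Ve\<close>, then the m entries of the bottom row at \<open>Vb\<close>.\<close>

lemma bracket_E2_E1: "\<lbrakk>E2 k m, E1 k n\<rbrakk>\<^sub>R = (n + m, 0)"
proof (rule bracket_eqI[OF is_rep_exceptional(2) is_rep_exceptional(1) E2_def E1_def,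
      where pos = "\<lambda>d. if d < n then (Ve, d, 0) else (Vb, n, d - n)"])
  fix f assume f: "f \<in> Hom (E2 k m) (E1 k n)"
    and z: "\<And>i. i < n + m \<Longrightarrow> case (\<lambda>d. if d < n then (Ve, d, 0) else (Vb, n, d - n)) i of (v, r, c) \<Rightarrow> f v (unit_vec c) r = 0"
  note H = Hom_be[OF f E2_def E1_def] Hom_bmid[OF f E2_def E1_def] Hom_mide[OF f E2_def E1_def]
  note [simp] = Hom_zero[OF f E2_def E1_def] structure_map_simps
  have CA: "f Ve (unit_vec c) i = f Vb (unit_vec c) i" if "i < n" "c < m" for c i
    using H(1)[of c i] that by simp
  have BC: "f Vmid (unit_vec c) i = f Ve (unit_vec c) i" if "c \<le> m" for c i
    using H(3)[of c i] that by simp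
  have shift: "f Ve (unit_vec (Suc c)) i = f Vb (unit_vec c) (Suc i)" if "i < n" "c < m" for c i
    using H(2)[of c i] BC[of "Suc c" i] that by simp
  have first: "f Ve (unit_vec 0) i = 0" if "i < n" for i using z[of i] that by simp
  have bottom: "f Vb (unit_vec c) n = 0" if "c < m" for c using z[of "n + c"] that by simp
  have C: "f Ve (unit_vec c) i = 0" if "i < n" "c \<le> m" for i c
    by (rule hankel_zero[where A = "\<lambda>i c. f Vb (unit_vec c) i" and C = "\<lambda>i c. f Ve (unit_vec c) i", OF shift CA[symmetric] first bottom that])
  have A: "f Vb (unit_vec c) i = 0" if "i \<le> n" "c < m" for i c
    by (rule hankel_zero'[where A = "\<lambda>i c. f Vb (unit_vec c) i" and C = "\<lambda>i c. f Ve (unit_vec c) i", OF shift CA[symmetric] first bottom that])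
  show "(\<forall>c<m. \<forall>i<n + 1. f Vb (unit_vec c) i = 0) \<and>
      (\<forall>c<m + 1. \<forall>i<n. f Vmid (unit_vec c) i = 0) \<and>
      (\<forall>c<m + 1. \<forall>i<n. f Ve (unit_vec c) i = 0)"
    using A BC C by simp
qed (cases "n \<le> m"; auto simp: algebra_simps not_le dest!: le_Suc_ex less_imp_Suc_add)+

lemma bracket_E3_E1: "\<lbrakk>E3 k m, E1 k n\<rbrakk>\<^sub>R = (n + m, 0)"
proof (rule bracket_eqI[OF is_rep_exceptional(3) is_rep_exceptional(1) E3_def E1_def,
      where pos = "\<lambda>d. if d < n then (Ve, d, 0) else (Vb, n, d - n)"])
  fix f assume f: "f \<in> Hom (E3 k m) (E1 k n)"
    and z: "\<And>i. i < n + m \<Longrightarrow> case (\<lambda>d. if d < n then (Ve, d, 0) else (Vb, n, d - n)) i of (v, r, c) \<Rightarrow> f v (unit_vec c) r = 0"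
  note H = Hom_be[OF f E3_def E1_def] Hom_bmid[OF f E3_def E1_def] Hom_mide[OF f E3_def E1_def]
  note [simp] = Hom_zero[OF f E3_def E1_def] structure_map_simps
  have CA: "f Ve (unit_vec c) i = f Vb (unit_vec c) i" if "i < n" "c < m" for c i
    using H(1)[of c i] that by simp
  have BA: "f Vmid (unit_vec c) i = f Vb (unit_vec c) (Suc i)" if "c < m" "i < n" for c i
    using H(2)[of c i] that by simp
  have shift: "f Ve (unit_vec (Suc c)) i = f Vb (unit_vec c) (Suc i)" if "i < n" "c < m" for c i
    using H(3)[of c i] BA[of c i] that by simp
  have first: "f Ve (unit_vec 0) i = 0" if "i < n" for i using z[of i] that by simp
  have bottom: "f Vb (unit_vec c) n = 0" if "c < m" for c using z[of "n + c"] that by simp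
  have C: "f Ve (unit_vec c) i = 0" if "i < n" "c \<le> m" for i c
    by (rule hankel_zero[where A = "\<lambda>i c. f Vb (unit_vec c) i" and C = "\<lambda>i c. f Ve (unit_vec c) i", OF shift CA[symmetric] first bottom that])
  have A: "f Vb (unit_vec c) i = 0" if "i \<le> n" "c < m" for i c
    by (rule hankel_zero'[where A = "\<lambda>i c. f Vb (unit_vec c) i" and C = "\<lambda>i c. f Ve (unit_vec c) i", OF shift CA[symmetric] first bottom that])
  show "(\<forall>c<m. \<forall>i<n + 1. f Vb (unit_vec c) i = 0) \<and>
      (\<forall>c<m. \<forall>i<n. f Vmid (unit_vec c) i = 0) \<and>
      (\<forall>c<m + 1. \<forall>i<n. f Ve (unit_vec c) i = 0)"
    using A BA C by simp
qed (cases "n \<le> m"; auto simp: algebra_simps not_le dest!: le_Suc_ex less_imp_Suc_add)+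

lemma bracket_E3_E4: "\<lbrakk>E3 k m, E4 k n\<rbrakk>\<^sub>R = (n + m, 0)"
proof (rule bracket_eqI[OF is_rep_exceptional(3) is_rep_exceptional(4) E3_def E4_def,
      where pos = "\<lambda>d. if d < n then (Ve, d, 0) else (Vb, n, d - n)"])
  fix f assume f: "f \<in> Hom (E3 k m) (E4 k n)"
    and z: "\<And>i. i < n + m \<Longrightarrow> case (\<lambda>d. if d < n then (Ve, d, 0) else (Vb, n, d - n)) i of (v, r, c) \<Rightarrow> f v (unit_vec c) r = 0"
  note H = Hom_be[OF f E3_def E4_def] Hom_bmid[OF f E3_def E4_def] Hom_mide[OF f E3_def E4_def]
  note [simp] = Hom_zero[OF f E3_def E4_def] structure_map_simps
  have CA: "f Ve (unit_vec c) i = f Vb (unit_vec c) i" if "i < n" "c < m" for c i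
    using H(1)[of c i] that by simp
  have BA: "f Vmid (unit_vec c) i = f Vb (unit_vec c) i" if "c < m" for c i
    using H(2)[of c i] that by simp
  have shift: "f Ve (unit_vec (Suc c)) i = f Vb (unit_vec c) (Suc i)" if "i < n" "c < m" for c i
    using H(3)[of c i] BA[of c "Suc i"] that by simp
  have first: "f Ve (unit_vec 0) i = 0" if "i < n" for i using z[of i] that by simp
  have bottom: "f Vb (unit_vec c) n = 0" if "c < m" for c using z[of "n + c"] that by simp
  have C: "f Ve (unit_vec c) i = 0" if "i < n" "c \<le> m" for i c
    by (rule hankel_zero[where A = "\<lambda>i c. f Vb (unit_vec c) i" and C = "\<lambda>i c. f Ve (unit_vec c) i", OF shift CA[symmetric] first bottom that])
  have A: "f Vb (unit_vec c) i = 0" if "i \<le> n" "c < m" for i c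
    by (rule hankel_zero'[where A = "\<lambda>i c. f Vb (unit_vec c) i" and C = "\<lambda>i c. f Ve (unit_vec c) i", OF shift CA[symmetric] first bottom that])
  show "(\<forall>c<m. \<forall>i<n + 1. f Vb (unit_vec c) i = 0) \<and>
      (\<forall>c<m. \<forall>i<n + 1. f Vmid (unit_vec c) i = 0) \<and>
      (\<forall>c<m + 1. \<forall>i<n. f Ve (unit_vec c) i = 0)"
    using A BA C by simp
qed (cases "n \<le> m"; auto simp: algebra_simps not_le dest!: le_Suc_ex less_imp_Suc_add)+

text \<open>\<open>Vmid\<close> carries a full (n+1) x (m+1) Hankel matrix, with one antidiagonal
  more. It plays the role of both A and C in \<open>hankel_zero\<close>, and \<open>bottom\<close>
  includes the corner, hence c \<le> m.\<close>

lemma bracket_E2_E4: "\<lbrakk>E2 k m, E4 k n\<rbrakk>\<^sub>R = (1 + n + m, 0)"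
proof (rule bracket_eqI[OF is_rep_exceptional(2) is_rep_exceptional(4) E2_def E4_def,
      where pos = "\<lambda>d. if d < n then (Vmid, d, 0) else (Vmid, n, d - n)"])
  fix f assume f: "f \<in> Hom (E2 k m) (E4 k n)"
    and z: "\<And>i. i < 1 + n + m \<Longrightarrow> case (\<lambda>d. if d < n then (Vmid, d, 0) else (Vmid, n, d - n)) i of (v, r, c) \<Rightarrow> f v (unit_vec c) r = 0"
  note H = Hom_be[OF f E2_def E4_def] Hom_bmid[OF f E2_def E4_def] Hom_mide[OF f E2_def E4_def]
  note [simp] = Hom_zero[OF f E2_def E4_def] structure_map_simps
  have CA: "f Ve (unit_vec c) i = f Vb (unit_vec c) i" if "i < n" "c < m" for c i
    using H(1)[of c i] that by simp
  have BA: "f Vmid (unit_vec (Suc c)) i = f Vb (unit_vec c) i" if "c < m" for c i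
    using H(2)[of c i] that by simp
  have CB: "f Ve (unit_vec c) i = f Vmid (unit_vec c) (Suc i)" if "c \<le> m" "i < n" for c i
    using H(3)[of c i] that by simp
  have shift: "f Vmid (unit_vec (Suc c)) i = f Vmid (unit_vec c) (Suc i)" if "i < n" "c < m" for i c
    using BA CA CB that by simp
  have first: "f Vmid (unit_vec 0) i = 0" if "i < n" for i using z[of i] that by simp
  have bottom: "f Vmid (unit_vec c) n = 0" if "c \<le> m" for c using z[of "n + c"] that by simp
  have B: "f Vmid (unit_vec c) i = 0" if "i \<le> n" "c \<le> m" for i c
    using hankel_zero[where A = "\<lambda>i c. f Vmid (unit_vec c) i" and C = "\<lambda>i c. f Vmid (unit_vec c) i", OF shift refl first bottom]
      bottom that by (cases "i = n") auto
  show "(\<forall>c<m. \<forall>i<n + 1. f Vb (unit_vec c) i = 0) \<and>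
      (\<forall>c<m + 1. \<forall>i<n + 1. f Vmid (unit_vec c) i = 0) \<and>
      (\<forall>c<m + 1. \<forall>i<n. f Ve (unit_vec c) i = 0)"
    using B BA[symmetric] CB by simp
qed (cases "n \<le> m"; auto simp: algebra_simps not_le dest!: le_Suc_ex less_imp_Suc_add)+

section \<open>Pairs involving \<open>M\<close>\<close>

text \<open>A morphism from \<open>M\<close> is a vector at mid in the kernel of mid to e, which
  here is the identity.\<close>

lemma bracket_M_E1: "\<lbrakk>M k, E1 k m\<rbrakk>\<^sub>R = (0, 0)"
proof (rule bracket_eqI[OF is_rep_exceptional(5) is_rep_exceptional(1) M_def E1_def,
      where pos = "\<lambda>d. (Vmid, 0, 0)"])
  fix f assume f: "f \<in> Hom (M k) (E1 k m)"
  note H = Hom_be[OF f M_def E1_def] Hom_bmid[OF f M_def E1_def] Hom_mide[OF f M_def E1_def]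
  note [simp] = Hom_zero[OF f M_def E1_def] structure_map_simps
  have B: "f Vmid (unit_vec 0) i = 0" for c i :: nat
    using H(3)[of 0 i] by simp
  show "(\<forall>c<0. \<forall>i<m + 1. f Vb (unit_vec c) i = 0) \<and>
      (\<forall>c<1. \<forall>i<m. f Vmid (unit_vec c) i = 0) \<and>
      (\<forall>c<0. \<forall>i<m. f Ve (unit_vec c) i = 0)"
    using B by simp
qed simp_all

text \<open>A morphism to \<open>M\<close> is a linear form at mid killing the image of b to mid;
  \<open>pi_minus\<close> is onto.\<close>

lemma bracket_E1_M: "\<lbrakk>E1 k m, M k\<rbrakk>\<^sub>R = (0, 1)"
proof (rule bracket_eqI[OF is_rep_exceptional(1) is_rep_exceptional(5) E1_def M_def,
      where pos = "\<lambda>d. (Vmid, 0, 0)"])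
  fix f assume f: "f \<in> Hom (E1 k m) (M k)"
  note H = Hom_be[OF f E1_def M_def] Hom_bmid[OF f E1_def M_def] Hom_mide[OF f E1_def M_def]
  note [simp] = Hom_zero[OF f E1_def M_def] structure_map_simps
  have B: "f Vmid (unit_vec c) i = 0" if "c < m" for c i :: nat
    using H(2)[of "Suc c" i] that by simp
  show "(\<forall>c<m + 1. \<forall>i<0. f Vb (unit_vec c) i = 0) \<and>
      (\<forall>c<m. \<forall>i<1. f Vmid (unit_vec c) i = 0) \<and>
      (\<forall>c<m. \<forall>i<0. f Ve (unit_vec c) i = 0)"
    using B by simp
qed simp_all

lemma bracket_M_E2: "\<lbrakk>M k, E2 k m\<rbrakk>\<^sub>R = (0, 0)"
proof (rule bracket_eqI[OF is_rep_exceptional(5) is_rep_exceptional(2) M_def E2_def,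
      where pos = "\<lambda>d. (Vmid, 0, 0)"])
  fix f assume f: "f \<in> Hom (M k) (E2 k m)"
  note H = Hom_be[OF f M_def E2_def] Hom_bmid[OF f M_def E2_def] Hom_mide[OF f M_def E2_def]
  note [simp] = Hom_zero[OF f M_def E2_def] structure_map_simps
  have B: "f Vmid (unit_vec 0) i = 0" for c i :: nat
    using H(3)[of 0 i] by simp
  show "(\<forall>c<0. \<forall>i<m. f Vb (unit_vec c) i = 0) \<and>
      (\<forall>c<1. \<forall>i<m + 1. f Vmid (unit_vec c) i = 0) \<and>
      (\<forall>c<0. \<forall>i<m + 1. f Ve (unit_vec c) i = 0)"
    using B by simp
qed simp_all

text \<open>The image of \<open>j_minus\<close> misses only coordinate 0, which leaves one
  parameter.\<close>

lemma bracket_E2_M: "\<lbrakk>E2 k m, M k\<rbrakk>\<^sub>R = (1, 0)"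
proof (rule bracket_eqI[OF is_rep_exceptional(2) is_rep_exceptional(5) E2_def M_def,
      where pos = "\<lambda>d. (Vmid, 0, 0)"])
  fix f assume f: "f \<in> Hom (E2 k m) (M k)"
    and z: "\<And>i. i < (1 :: nat) \<Longrightarrow> case (\<lambda>d. (Vmid, 0, 0)) i of (v, r, c) \<Rightarrow> f v (unit_vec c) r = 0"
  note H = Hom_be[OF f E2_def M_def] Hom_bmid[OF f E2_def M_def] Hom_mide[OF f E2_def M_def]
  note [simp] = Hom_zero[OF f E2_def M_def] structure_map_simps
  have B: "f Vmid (unit_vec (Suc c)) i = 0" if "c < m" for c i :: nat
    using H(2)[of c i] that by simp
  show "(\<forall>c<m. \<forall>i<0. f Vb (unit_vec c) i = 0) \<and>
      (\<forall>c<m + 1. \<forall>i<1. f Vmid (unit_vec c) i = 0) \<and>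
      (\<forall>c<m + 1. \<forall>i<0. f Ve (unit_vec c) i = 0)"
    using B z by (auto simp: less_Suc_eq_0_disj)
qed simp_all

lemma bracket_M_E3: "\<lbrakk>M k, E3 k m\<rbrakk>\<^sub>R = (0, 1)"
proof (rule bracket_eqI[OF is_rep_exceptional(5) is_rep_exceptional(3) M_def E3_def,
      where pos = "\<lambda>d. (Vmid, 0, 0)"])
  fix f assume f: "f \<in> Hom (M k) (E3 k m)"
  note H = Hom_be[OF f M_def E3_def] Hom_bmid[OF f M_def E3_def] Hom_mide[OF f M_def E3_def]
  note [simp] = Hom_zero[OF f M_def E3_def] structure_map_simps
  have B: "f Vmid (unit_vec 0) i = 0" if "i < m" for c i :: nat
    using H(3)[of 0 "Suc i"] that by simp
  show "(\<forall>c<0. \<forall>i<m. f Vb (unit_vec c) i = 0) \<and>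
      (\<forall>c<1. \<forall>i<m. f Vmid (unit_vec c) i = 0) \<and>
      (\<forall>c<0. \<forall>i<m + 1. f Ve (unit_vec c) i = 0)"
    using B by simp
qed simp_all

lemma bracket_E3_M: "\<lbrakk>E3 k m, M k\<rbrakk>\<^sub>R = (0, 0)"
proof (rule bracket_eqI[OF is_rep_exceptional(3) is_rep_exceptional(5) E3_def M_def,
      where pos = "\<lambda>d. (Vmid, 0, 0)"])
  fix f assume f: "f \<in> Hom (E3 k m) (M k)"
  note H = Hom_be[OF f E3_def M_def] Hom_bmid[OF f E3_def M_def] Hom_mide[OF f E3_def M_def]
  note [simp] = Hom_zero[OF f E3_def M_def] structure_map_simps
  have B: "f Vmid (unit_vec c) i = 0" if "c < m" for c i :: nat
    using H(2)[of c i] that by simp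
  show "(\<forall>c<m. \<forall>i<0. f Vb (unit_vec c) i = 0) \<and>
      (\<forall>c<m. \<forall>i<1. f Vmid (unit_vec c) i = 0) \<and>
      (\<forall>c<m + 1. \<forall>i<0. f Ve (unit_vec c) i = 0)"
    using B by simp
qed simp_all

text \<open>The kernel of \<open>pi_minus\<close> is spanned by \<open>unit_vec 0\<close>.\<close>

lemma bracket_M_E4: "\<lbrakk>M k, E4 k m\<rbrakk>\<^sub>R = (1, 0)"
proof (rule bracket_eqI[OF is_rep_exceptional(5) is_rep_exceptional(4) M_def E4_def,
      where pos = "\<lambda>d. (Vmid, 0, 0)"])
  fix f assume f: "f \<in> Hom (M k) (E4 k m)"
    and z: "\<And>i. i < (1 :: nat) \<Longrightarrow> case (\<lambda>d. (Vmid, 0, 0)) i of (v, r, c) \<Rightarrow> f v (unit_vec c) r = 0"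
  note H = Hom_be[OF f M_def E4_def] Hom_bmid[OF f M_def E4_def] Hom_mide[OF f M_def E4_def]
  note [simp] = Hom_zero[OF f M_def E4_def] structure_map_simps
  have B: "f Vmid (unit_vec 0) (Suc i) = 0" if "i < m" for c i :: nat
    using H(3)[of 0 i] that by simp
  show "(\<forall>c<0. \<forall>i<m + 1. f Vb (unit_vec c) i = 0) \<and>
      (\<forall>c<1. \<forall>i<m + 1. f Vmid (unit_vec c) i = 0) \<and>
      (\<forall>c<0. \<forall>i<m. f Ve (unit_vec c) i = 0)"
    using B z by (auto simp: less_Suc_eq_0_disj)
qed simp_all

lemma bracket_E4_M: "\<lbrakk>E4 k m, M k\<rbrakk>\<^sub>R = (0, 0)"
proof (rule bracket_eqI[OF is_rep_exceptional(4) is_rep_exceptional(5) E4_def M_def,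
      where pos = "\<lambda>d. (Vmid, 0, 0)"])
  fix f assume f: "f \<in> Hom (E4 k m) (M k)"
  note H = Hom_be[OF f E4_def M_def] Hom_bmid[OF f E4_def M_def] Hom_mide[OF f E4_def M_def]
  note [simp] = Hom_zero[OF f E4_def M_def] structure_map_simps
  have B: "f Vmid (unit_vec c) i = 0" if "c \<le> m" for c i :: nat
    using H(2)[of c i] that by simp
  show "(\<forall>c<m + 1. \<forall>i<0. f Vb (unit_vec c) i = 0) \<and>
      (\<forall>c<m + 1. \<forall>i<1. f Vmid (unit_vec c) i = 0) \<and>
      (\<forall>c<m. \<forall>i<0. f Ve (unit_vec c) i = 0)"
    using B by simp
qed simp_all

section \<open>Pairs involving \<open>M'\<close>\<close>

text \<open>A morphism is determined at \<open>Vb\<close>, where its value lies in the kernel of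
  \<open>pi_minus\<close>, a line.\<close>

lemma bracket_M'_E1: "\<lbrakk>M' k, E1 k m\<rbrakk>\<^sub>R = (1, 0)"
proof (rule bracket_eqI[OF is_rep_exceptional(6) is_rep_exceptional(1) M'_def E1_def,
      where pos = "\<lambda>d. (Vb, 0, 0)"])
  fix f assume f: "f \<in> Hom (M' k) (E1 k m)"
    and z: "\<And>i. i < (1 :: nat) \<Longrightarrow> case (\<lambda>d. (Vb, 0, 0)) i of (v, r, c) \<Rightarrow> f v (unit_vec c) r = 0"
  note H = Hom_be[OF f M'_def E1_def] Hom_bmid[OF f M'_def E1_def] Hom_mide[OF f M'_def E1_def]
  note [simp] = Hom_zero[OF f M'_def E1_def] structure_map_simps
  have A: "f Vb (unit_vec 0) (Suc i) = 0" if "i < m" for c i :: nat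
    using H(2)[of 0 i] that by simp
  have A': "f Vb (unit_vec 0) i = 0" if "i \<le> m" for i
    using A[of "i - 1"] z that by (cases i) auto
  show "(\<forall>c<1. \<forall>i<m + 1. f Vb (unit_vec c) i = 0) \<and>
      (\<forall>c<0. \<forall>i<m. f Vmid (unit_vec c) i = 0) \<and>
      (\<forall>c<1. \<forall>i<m. f Ve (unit_vec c) i = 0)"
    using A' H(1)[of 0] by simp
qed simp_all

text \<open>A morphism to \<open>M'\<close> kills the image of mid to e, here the whole space at e;
  the identity in \<open>M'\<close> transports this to b.\<close>

lemma bracket_E1_M': "\<lbrakk>E1 k m, M' k\<rbrakk>\<^sub>R = (0, 0)"
proof (rule bracket_eqI[OF is_rep_exceptional(1) is_rep_exceptional(6) E1_def M'_def,
      where pos = "\<lambda>d. (Vb, 0, 0)"])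
  fix f assume f: "f \<in> Hom (E1 k m) (M' k)"
  note H = Hom_be[OF f E1_def M'_def] Hom_bmid[OF f E1_def M'_def] Hom_mide[OF f E1_def M'_def]
  note [simp] = Hom_zero[OF f E1_def M'_def] structure_map_simps
  have C: "f Ve (unit_vec c) i = 0" if "c < m" for c i :: nat
    using H(3)[of c i] that by simp
  have A: "f Vb (unit_vec c) i = 0" if "c \<le> m" for c i
    using H(1)[of c i] C[of c i] that by (simp split: if_splits)
  show "(\<forall>c<m + 1. \<forall>i<1. f Vb (unit_vec c) i = 0) \<and>
      (\<forall>c<m. \<forall>i<0. f Vmid (unit_vec c) i = 0) \<and>
      (\<forall>c<m. \<forall>i<1. f Ve (unit_vec c) i = 0)"
    using A C by simp
qed simp_all

lemma bracket_M'_E2: "\<lbrakk>M' k, E2 k m\<rbrakk>\<^sub>R = (0, 1)"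
proof (rule bracket_eqI[OF is_rep_exceptional(6) is_rep_exceptional(2) M'_def E2_def,
      where pos = "\<lambda>d. (Vb, 0, 0)"])
  fix f assume f: "f \<in> Hom (M' k) (E2 k m)"
  note H = Hom_be[OF f M'_def E2_def] Hom_bmid[OF f M'_def E2_def] Hom_mide[OF f M'_def E2_def]
  note [simp] = Hom_zero[OF f M'_def E2_def] structure_map_simps
  have A: "f Vb (unit_vec 0) i = 0" if "i < m" for c i :: nat
    using H(2)[of 0 "Suc i"] that by simp
  have C: "f Ve (unit_vec 0) i = 0" if "i \<le> m" for i
    using H(1)[of 0 i] A[of i] that by simp
  show "(\<forall>c<1. \<forall>i<m. f Vb (unit_vec c) i = 0) \<and>
      (\<forall>c<0. \<forall>i<m + 1. f Vmid (unit_vec c) i = 0) \<and>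
      (\<forall>c<1. \<forall>i<m + 1. f Ve (unit_vec c) i = 0)"
    using A C by simp
qed simp_all

lemma bracket_E2_M': "\<lbrakk>E2 k m, M' k\<rbrakk>\<^sub>R = (0, 0)"
proof (rule bracket_eqI[OF is_rep_exceptional(2) is_rep_exceptional(6) E2_def M'_def,
      where pos = "\<lambda>d. (Vb, 0, 0)"])
  fix f assume f: "f \<in> Hom (E2 k m) (M' k)"
  note H = Hom_be[OF f E2_def M'_def] Hom_bmid[OF f E2_def M'_def] Hom_mide[OF f E2_def M'_def]
  note [simp] = Hom_zero[OF f E2_def M'_def] structure_map_simps
  have C: "f Ve (unit_vec c) i = 0" if "c \<le> m" for c i :: nat
    using H(3)[of c i] that by simp
  have A: "f Vb (unit_vec c) i = 0" if "c < m" for c i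
    using H(1)[of c i] C[of c i] that by (simp split: if_splits)
  show "(\<forall>c<m. \<forall>i<1. f Vb (unit_vec c) i = 0) \<and>
      (\<forall>c<m + 1. \<forall>i<0. f Vmid (unit_vec c) i = 0) \<and>
      (\<forall>c<m + 1. \<forall>i<1. f Ve (unit_vec c) i = 0)"
    using A C by simp
qed simp_all

lemma bracket_M'_E3: "\<lbrakk>M' k, E3 k m\<rbrakk>\<^sub>R = (0, 0)"
proof (rule bracket_eqI[OF is_rep_exceptional(6) is_rep_exceptional(3) M'_def E3_def,
      where pos = "\<lambda>d. (Vb, 0, 0)"])
  fix f assume f: "f \<in> Hom (M' k) (E3 k m)"
  note H = Hom_be[OF f M'_def E3_def] Hom_bmid[OF f M'_def E3_def] Hom_mide[OF f M'_def E3_def]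
  note [simp] = Hom_zero[OF f M'_def E3_def] structure_map_simps
  have A: "f Vb (unit_vec 0) i = 0" for c i :: nat
    using H(2)[of 0 i] by simp
  have C: "f Ve (unit_vec 0) i = 0" if "i \<le> m" for i
    using H(1)[of 0 i] A[of i] that by simp
  show "(\<forall>c<1. \<forall>i<m. f Vb (unit_vec c) i = 0) \<and>
      (\<forall>c<0. \<forall>i<m. f Vmid (unit_vec c) i = 0) \<and>
      (\<forall>c<1. \<forall>i<m + 1. f Ve (unit_vec c) i = 0)"
    using A C by simp
qed simp_all

text \<open>Modulo the image of \<open>j_minus\<close> only coordinate 0 at e survives, and the map
  at b is determined by the one at e.\<close>

lemma bracket_E3_M': "\<lbrakk>E3 k m, M' k\<rbrakk>\<^sub>R = (1, 0)"
proof (rule bracket_eqI[OF is_rep_exceptional(3) is_rep_exceptional(6) E3_def M'_def,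
      where pos = "\<lambda>d. (Ve, 0, 0)"])
  fix f assume f: "f \<in> Hom (E3 k m) (M' k)"
    and z: "\<And>i. i < (1 :: nat) \<Longrightarrow> case (\<lambda>d. (Ve, 0, 0)) i of (v, r, c) \<Rightarrow> f v (unit_vec c) r = 0"
  note H = Hom_be[OF f E3_def M'_def] Hom_bmid[OF f E3_def M'_def] Hom_mide[OF f E3_def M'_def]
  note [simp] = Hom_zero[OF f E3_def M'_def] structure_map_simps
  have C': "f Ve (unit_vec (Suc c)) i = 0" if "c < m" for c i :: nat
    using H(3)[of c i] that by simp
  have C: "f Ve (unit_vec c) 0 = 0" if "c \<le> m" for c
    using C'[of "c - 1" 0] z that by (cases c) auto
  have A: "f Vb (unit_vec c) 0 = 0" if "c < m" for c
    using H(1)[of c 0] C[of c] that by simp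
  show "(\<forall>c<m. \<forall>i<1. f Vb (unit_vec c) i = 0) \<and>
      (\<forall>c<m. \<forall>i<0. f Vmid (unit_vec c) i = 0) \<and>
      (\<forall>c<m + 1. \<forall>i<1. f Ve (unit_vec c) i = 0)"
    using A C by simp
qed simp_all

lemma bracket_M'_E4: "\<lbrakk>M' k, E4 k m\<rbrakk>\<^sub>R = (0, 0)"
proof (rule bracket_eqI[OF is_rep_exceptional(6) is_rep_exceptional(4) M'_def E4_def,
      where pos = "\<lambda>d. (Vb, 0, 0)"])
  fix f assume f: "f \<in> Hom (M' k) (E4 k m)"
  note H = Hom_be[OF f M'_def E4_def] Hom_bmid[OF f M'_def E4_def] Hom_mide[OF f M'_def E4_def]
  note [simp] = Hom_zero[OF f M'_def E4_def] structure_map_simps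
  have A: "f Vb (unit_vec 0) i = 0" for c i :: nat
    using H(2)[of 0 i] by simp
  have C: "f Ve (unit_vec 0) i = 0" if "i < m" for i
    using H(1)[of 0 i] A[of i] that by simp
  show "(\<forall>c<1. \<forall>i<m + 1. f Vb (unit_vec c) i = 0) \<and>
      (\<forall>c<0. \<forall>i<m + 1. f Vmid (unit_vec c) i = 0) \<and>
      (\<forall>c<1. \<forall>i<m. f Ve (unit_vec c) i = 0)"
    using A C by simp
qed simp_all

lemma bracket_E4_M': "\<lbrakk>E4 k m, M' k\<rbrakk>\<^sub>R = (0, 1)"
proof (rule bracket_eqI[OF is_rep_exceptional(4) is_rep_exceptional(6) E4_def M'_def,
      where pos = "\<lambda>d. (Vb, 0, 0)"])
  fix f assume f: "f \<in> Hom (E4 k m) (M' k)"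
  note H = Hom_be[OF f E4_def M'_def] Hom_bmid[OF f E4_def M'_def] Hom_mide[OF f E4_def M'_def]
  note [simp] = Hom_zero[OF f E4_def M'_def] structure_map_simps
  have C: "f Ve (unit_vec c) i = 0" if "c < m" for c i :: nat
    using H(3)[of "Suc c" i] that by simp
  have A: "f Vb (unit_vec c) i = 0" if "c \<le> m" for c i
    using H(1)[of c i] C[of c i] that by (simp split: if_splits)
  show "(\<forall>c<m + 1. \<forall>i<1. f Vb (unit_vec c) i = 0) \<and>
      (\<forall>c<m + 1. \<forall>i<0. f Vmid (unit_vec c) i = 0) \<and>
      (\<forall>c<m. \<forall>i<1. f Ve (unit_vec c) i = 0)"
    using A C by simp
qed simp_all

text \<open>The supports are disjoint, so the Euler form alone decides.\<close>

lemma bracket_M_M': "\<lbrakk>M k, M' k\<rbrakk>\<^sub>R = (0, 1)"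
  by (rule bracket_eqI[OF is_rep_exceptional(5) is_rep_exceptional(6) M_def M'_def,
      where pos = "\<lambda>d. (Vb, 0, 0)"]) simp_all

lemma bracket_M'_M: "\<lbrakk>M' k, M k\<rbrakk>\<^sub>R = (0, 1)"
  by (rule bracket_eqI[OF is_rep_exceptional(6) is_rep_exceptional(5) M'_def M_def,
      where pos = "\<lambda>d. (Vb, 0, 0)"]) simp_all

theorem proposition2p4:
  fixes k :: "'k::alg_closed_field itself"
  shows
    "(\<forall>m n. m < n \<longrightarrow>
        \<lbrakk>E1 k m, E1 k n\<rbrakk>\<^sub>R = (0, n - m - 1) \<and> \<lbrakk>E1 k n, E1 k m\<rbrakk>\<^sub>R = (1 + n - m, 0) \<and>
        \<lbrakk>E4 k m, E4 k n\<rbrakk>\<^sub>R = (0, n - m - 1) \<and> \<lbrakk>E4 k n, E4 k m\<rbrakk>\<^sub>R = (1 + n - m, 0)) \<and>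
     (\<forall>m n. n < m \<longrightarrow>
        \<lbrakk>E2 k m, E2 k n\<rbrakk>\<^sub>R = (0, m - n - 1) \<and> \<lbrakk>E2 k n, E2 k m\<rbrakk>\<^sub>R = (1 + m - n, 0) \<and>
        \<lbrakk>E3 k m, E3 k n\<rbrakk>\<^sub>R = (0, m - n - 1) \<and> \<lbrakk>E3 k n, E3 k m\<rbrakk>\<^sub>R = (1 + m - n, 0)) \<and>
     (\<forall>m n.
        \<lbrakk>E1 k m, E2 k n\<rbrakk>\<^sub>R = (0, n + m + 2) \<and> \<lbrakk>E2 k n, E1 k m\<rbrakk>\<^sub>R = (n + m, 0) \<and>
        \<lbrakk>E1 k m, E3 k n\<rbrakk>\<^sub>R = (0, n + m + 1) \<and> \<lbrakk>E3 k n, E1 k m\<rbrakk>\<^sub>R = (n + m, 0) \<and>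
        \<lbrakk>E2 k m, E4 k n\<rbrakk>\<^sub>R = (1 + n + m, 0) \<and> \<lbrakk>E4 k n, E2 k m\<rbrakk>\<^sub>R = (0, n + m + 2) \<and>
        \<lbrakk>E3 k m, E4 k n\<rbrakk>\<^sub>R = (n + m, 0) \<and> \<lbrakk>E4 k n, E3 k m\<rbrakk>\<^sub>R = (0, n + m + 2)) \<and>
     (\<forall>m n. m \<le> n \<longrightarrow>
        \<lbrakk>E1 k m, E4 k n\<rbrakk>\<^sub>R = (0, n - m) \<and> \<lbrakk>E4 k n, E1 k m\<rbrakk>\<^sub>R = (1 + n - m, 0)) \<and>
     (\<forall>m n. n < m \<longrightarrow>
        \<lbrakk>E1 k m, E4 k n\<rbrakk>\<^sub>R = (m - n, 0) \<and> \<lbrakk>E4 k n, E1 k m\<rbrakk>\<^sub>R = (0, m - n - 1)) \<and>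
     (\<forall>m n. n \<le> m \<longrightarrow>
        \<lbrakk>E2 k m, E3 k n\<rbrakk>\<^sub>R = (0, m - n) \<and> \<lbrakk>E3 k n, E2 k m\<rbrakk>\<^sub>R = (1 + m - n, 0)) \<and>
     (\<forall>m n. m < n \<longrightarrow>
        \<lbrakk>E2 k m, E3 k n\<rbrakk>\<^sub>R = (n - m, 0) \<and> \<lbrakk>E3 k n, E2 k m\<rbrakk>\<^sub>R = (0, n - m - 1)) \<and>
     (\<forall>m.
        \<lbrakk>M k, E1 k m\<rbrakk>\<^sub>R = (0, 0) \<and> \<lbrakk>E1 k m, M k\<rbrakk>\<^sub>R = (0, 1) \<and>
        \<lbrakk>M k, E2 k m\<rbrakk>\<^sub>R = (0, 0) \<and> \<lbrakk>E2 k m, M k\<rbrakk>\<^sub>R = (1, 0) \<and>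
        \<lbrakk>M k, E3 k m\<rbrakk>\<^sub>R = (0, 1) \<and> \<lbrakk>E3 k m, M k\<rbrakk>\<^sub>R = (0, 0) \<and>
        \<lbrakk>M k, E4 k m\<rbrakk>\<^sub>R = (1, 0) \<and> \<lbrakk>E4 k m, M k\<rbrakk>\<^sub>R = (0, 0) \<and>
        \<lbrakk>M' k, E1 k m\<rbrakk>\<^sub>R = (1, 0) \<and> \<lbrakk>E1 k m, M' k\<rbrakk>\<^sub>R = (0, 0) \<and>
        \<lbrakk>M' k, E2 k m\<rbrakk>\<^sub>R = (0, 1) \<and> \<lbrakk>E2 k m, M' k\<rbrakk>\<^sub>R = (0, 0) \<and>
        \<lbrakk>M' k, E3 k m\<rbrakk>\<^sub>R = (0, 0) \<and> \<lbrakk>E3 k m, M' k\<rbrakk>\<^sub>R = (1, 0) \<and>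
        \<lbrakk>M' k, E4 k m\<rbrakk>\<^sub>R = (0, 0) \<and> \<lbrakk>E4 k m, M' k\<rbrakk>\<^sub>R = (0, 1)) \<and>
     \<lbrakk>M k, M' k\<rbrakk>\<^sub>R = (0, 1) \<and> \<lbrakk>M' k, M k\<rbrakk>\<^sub>R = (0, 1)"
  \<comment> \<open>Each order hypothesis makes one of the truncated differences 0.\<close>
  by (simp add: bracket_E1_E1 bracket_E4_E4 bracket_E2_E2 bracket_E3_E3 bracket_E1_E2 bracket_E2_E1
      bracket_E1_E3 bracket_E3_E1 bracket_E2_E4 bracket_E4_E2 bracket_E3_E4 bracket_E4_E3
      bracket_E1_E4 bracket_E4_E1 bracket_E2_E3 bracket_E3_E2
      bracket_M_E1 bracket_E1_M bracket_M_E2 bracket_E2_M bracket_M_E3 bracket_E3_M bracket_M_E4 bracket_E4_M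
      bracket_M'_E1 bracket_E1_M' bracket_M'_E2 bracket_E2_M' bracket_M'_E3 bracket_E3_M' bracket_M'_E4
      bracket_E4_M' bracket_M_M' bracket_M'_M)

end
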